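(* Let $\mu(n)=\frac{\pi\sqrt{24n-1}}{6}$. For every integer $n$ with $\mu(n)\geq 4$ (equivalently, $n\geq 3$), \[M_0(n)-M_1(n)=\frac{(-1)^n\pi}{\sqrt{6}\,\mu(n)}e^{\frac{\mu(n)}{2}}+E_\beta(n),\qquad\text{where}\qquad |E_\beta(n)|\leq 63\, \mu(n)^{\frac{1}{2}}e^{\frac{\mu(n)}{4}}.\]
   Context: For a partition $\lambda$ of a positive integer, let $\omega(\lambda)$ be the number of parts equal to $1$ and let $\nu(\lambda)$ be the number of parts of $\lambda$ strictly larger than $\omega(\lambda)$. The crank of $\lambda$ is its largest part if $\omega(\lambda)=0$, and $\nu(\lambda)-\omega(\lambda)$ if $\omega(\lambda)>0$. For $n\geq 0$, $M_0(n)$ (resp. $M_1(n)$) denotes the number of partitions of $n$ with even (resp. odd) crank. *)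

theory Defs
  imports Complex_Main "HOL-Library.Multiset"
begin

text \<open>A partition of \<open>n\<close> is the multiset of its (positive) parts.\<close>

definition partitions :: "nat \<Rightarrow> nat multiset set" where
  "partitions n = {L. 0 \<notin># L \<and> sum_mset L = n}"

definition ones :: "nat multiset \<Rightarrow> nat" where
  "ones L = count L 1"

definition num_larger :: "nat multiset \<Rightarrow> nat" where
  "num_larger L = size (filter_mset (\<lambda>k. k > ones L) L)"

text \<open>
  The crank of the empty partition (the only partition of 0), which has no largest part,
  is 0 by convention.
\<close>

definition crank :: "nat multiset \<Rightarrow> int" where
  "crank L =
     (if L = {#} then 0
      else if ones L = 0 then int (Max (set_mset L))
      else int (num_larger L) - int (ones L))"

definition M0 :: "nat \<Rightarrow> nat" where
  "M0 n = card {L \<in> partitions n. even (crank L)}"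

definition M1 :: "nat \<Rightarrow> nat" where
  "M1 n = card {L \<in> partitions n. odd (crank L)}"

text \<open>
  The subtraction under the root is real; since \<open>sqrt\<close> is odd, \<open>mu 0 < 0\<close>, so that
  \<open>n = 0\<close> is excluded by \<open>mu n \<ge> 4\<close>.
\<close>

definition mu :: "nat \<Rightarrow> real" where
  "mu n = pi * sqrt (24 * real n - 1) / 6"

text \<open>The cardinalities in \<open>M0\<close> and \<open>M1\<close> are those of finite sets.\<close>

lemma finite_partitions: "finite (partitions n)"
proof (rule finite_subset)
  have "set_mset L \<subseteq> {..n}" if "L \<in> partitions n" for L
    using that by (auto simp: partitions_def dest!: multi_member_split)
  moreover have "size L \<le> n" if "L \<in> partitions n" for L
  proof -
    have "size K \<le> sum_mset K" if "0 \<notin># K" for K :: "nat multiset"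
      using that by (induction K) auto
    then show ?thesis using that by (auto simp: partitions_def)
  qed
  ultimately have bd: "set_mset L \<subseteq> {..n} \<and> size L \<le> n" if "L \<in> partitions n" for L
    using that by blast
  show "partitions n \<subseteq> mset ` {xs. set xs \<subseteq> {..n} \<and> length xs \<le> n}"
  proof
    fix L assume L: "L \<in> partitions n"
    obtain xs where xs: "L = mset xs" by (metis ex_mset)
    show "L \<in> mset ` {xs. set xs \<subseteq> {..n} \<and> length xs \<le> n}"
      using bd[OF L] unfolding xs by simp
  qed
  show "finite (mset ` {xs. set xs \<subseteq> {..n} \<and> length xs \<le> n})"
    by (intro finite_imageI finite_lists_length_le) simp
qed

end

theory Submission
  imports Defs "HOL-Complex_Analysis.Complex_Analysis" "HOL-Real_Asymp.Real_Asymp"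
    "HOL-Probability.Distributions"
begin

text \<open>
  The q-binomial theorem shows that, up to the correction \<open>2 q\<close> at \<open>n = 1\<close>, the generating function of
  \<open>M0 n - M1 n\<close> is \<open>F(q) = \<Prod> (1 - q\<^sup>k) / (1 + q\<^sup>k)\<^sup>2\<close>. With \<open>q = exp (2 \<pi> \<i> t)\<close>, the function \<open>F(- q)\<close> is
  \<open>q\<close> to the power \<open>1/24\<close> times the eta quotient \<open>f(t) = \<eta>(2t)\<^sup>7 / (\<eta>(t) \<eta>(4t))\<^sup>3\<close>, which satisfies
  \<open>f(- 1 / (4t)) = sqrt (- 2 \<i> t) f(t)\<close>. Hence \<open>(Im u)\<close> to the power \<open>1/4\<close> times \<open>|f(u/2)|\<close> is invariant
  under \<open>u \<mapsto> u + 2\<close> and \<open>u \<mapsto> - 1 / u\<close>.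

  The coefficient is the integral of \<open>F(- q) / q\<^sup>n\<close> over the segment \<open>Im t = y\<close> with \<open>y = \<pi> / (24 \<mu>(n))\<close>,
  which is the saddle point of the term of size \<open>exp (\<mu>(n) / 4)\<close>. For \<open>|Re t| \<ge> sqrt 3 y\<close> the invariance bounds
  the integrand by \<open>exp (\<mu>(n) / 4)\<close> times a multiple of \<open>sqrt \<mu>(n)\<close>. For \<open>|Re t| \<le> sqrt 3 y\<close>
  the transformation formula replaces \<open>f\<close> by an elementary function, whose integral is a truncated
  Gaussian integral and yields the main term.

  The transformation formula of \<open>\<eta>\<close> on the imaginary axis follows from the partial fractions of
  the cotangent: they turn \<open>ln \<eta>(\<i> y)\<close> into the double series of \<open>y / (k\<^sup>2 y\<^sup>2 + n\<^sup>2)\<close>, whose summation over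
  \<open>k, n \<le> K\<close> is unchanged under \<open>y \<mapsto> 1 / y\<close>, and the term \<open>ln y / 2\<close> comes from the conditional
  convergence.
\<close>

text \<open>F grows fastest towards \<open>q = - 1\<close>, where factors of its denominator vanish;
  this is why \<open>F (- q)\<close> is studied and where \<open>(- 1) ^ n\<close> comes from. The
  group generated by \<open>u -> u + 2\<close> and \<open>u -> - 1 / u\<close> has two cusps: the
  invariant grows at infinity, like \<open>exp (pi Im u / 24)\<close>, but decays at the odd cusp 1.
  A bound thus needs only the largest imaginary part in an orbit, which replaces the Farey
  dissection of the circle method; and as only moduli enter it, roots of unity drop out. The saddle
  point of the main term lies at height \<open>2 y\<close>, above the segment of integration. The
  lower height is chosen because the competing images of a point have height at most
  \<open>1 / (8 y)\<close>, which costs \<open>exp (mu / 4)\<close> on the whole segment. The number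
  \<open>sqrt 3\<close> is where the two regimes meet: at \<open>|Re t| = sqrt 3 y\<close> one has
  \<open>|t| = 2 y\<close>, so that the image of \<open>2 t\<close> under inversion has height
  exactly \<open>1 / (8 y)\<close>, the main term has itself dropped to \<open>exp (mu / 4)\<close>,
  and the endpoints lie on the circle through the saddle point, which makes the truncated integral
  symmetric.\<close>

section \<open>The transformation formula of the eta function on the imaginary axis\<close>

text \<open>Logarithmic derivative of Euler's reflection formula
  \<open>Gamma z * Gamma (1 - z) = pi / sin (pi z)\<close>.\<close>

lemma Digamma_reflection_complex:
  fixes z :: complex
  assumes "z \<notin> \<int>"
  shows "Digamma z - Digamma (1 - z) = - pi * cot (pi * z)"
proof -
  have nz: "sin (pi * z) \<noteq> 0" using assms by (auto simp: sin_eq_0)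
  have z: "z \<notin> \<int>\<^sub>\<le>\<^sub>0" "1 - z \<notin> \<int>\<^sub>\<le>\<^sub>0"
    using assms Ints_diff[of 1 "1 - z"] nonpos_Ints_subset_Ints by auto
  have "((\<lambda>z. Gamma z * Gamma (1 - z)) has_field_derivative
      Gamma z * Gamma (1 - z) * (Digamma z - Digamma (1 - z))) (at z)"
    using z by (auto intro!: derivative_eq_intros simp: algebra_simps)
  moreover have "(\<lambda>z. Gamma z * Gamma (1 - z)) = (\<lambda>z::complex. pi / sin (pi * z))"
    by (rule ext) (rule Gamma_reflection_complex)
  ultimately have "((\<lambda>z. pi / sin (pi * z)) has_field_derivative
      pi / sin (pi * z) * (Digamma z - Digamma (1 - z))) (at z)"
    using Gamma_reflection_complex[of z] by simp
  moreover have "((\<lambda>z::complex. pi / sin (pi * z)) has_field_derivative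
      - (pi * (cos (pi * z) * pi)) / (sin (pi * z) * sin (pi * z))) (at z)"
    using nz by (auto intro!: derivative_eq_intros)
  ultimately have "pi / sin (pi * z) * (Digamma z - Digamma (1 - z)) =
      - (pi * (cos (pi * z) * pi)) / (sin (pi * z) * sin (pi * z))"
    by (rule DERIV_unique)
  hence "of_real pi * (sin (pi * z) * (Digamma z - Digamma (1 - z))) =
      of_real pi * (sin (pi * z) * (- pi * cot (pi * z)))"
    using nz by (simp add: cot_def divide_simps mult_ac)
  hence "sin (pi * z) * (Digamma z - Digamma (1 - z)) = sin (pi * z) * (- pi * cot (pi * z))"
    by (subst (asm) mult_left_cancel) simp_all
  thus ?thesis using nz by (subst (asm) mult_left_cancel) simp_all
qed

text \<open>The Digamma series at \<open>z\<close> and \<open>1 - z\<close> differ by the terms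
  \<open>1 / (k + 1 - z) - 1 / (z + k)\<close>. A telescoping series of sum \<open>1 / z\<close>
  moves the second fraction to \<open>k + 1\<close>, so that the poles at \<open>k + 1\<close> and
  \<open>- (k + 1)\<close> meet in one term.\<close>

lemma cot_partial_fractions:
  fixes z :: complex
  assumes "z \<notin> \<int>"
  shows "(\<lambda>k. 2 * z / ((of_nat (Suc k))\<^sup>2 - z\<^sup>2)) sums (1 / z - pi * cot (pi * z))"
proof -
  have nz: "z \<noteq> of_int m" for m using assms by (metis Ints_of_int)
  have nk: "z + of_nat k \<noteq> 0" for k using nz[of "- int k"]
    by (simp add: eq_neg_iff_add_eq_0)
  have nk': "of_nat k - z \<noteq> 0" for k using nz[of "int k"] by auto
  have n1: "1 - z + of_nat k \<noteq> 0" for k using nk'[of "Suc k"] by (simp add: algebra_simps)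
  have s1: "(\<lambda>k. inverse (of_nat (Suc k)) - inverse (z + of_nat k)) sums (Digamma z + euler_mascheroni)"
    if "z \<notin> \<int>" for z :: complex
  proof -
    have "z \<noteq> 0" using that by auto
    from summable_sums[OF summable_Digamma[OF this]] show ?thesis by (simp add: Digamma_def)
  qed
  have z1: "1 - z \<notin> \<int>" using assms Ints_diff[of 1 "1 - z"] by auto
  from sums_diff[OF s1[OF assms] s1[OF z1]]
  have "(\<lambda>k. inverse (1 - z + of_nat k) - inverse (z + of_nat k)) sums (Digamma z - Digamma (1 - z))"
    by simp
  moreover have "(\<lambda>k. inverse (z + of_nat k) - inverse (z + of_nat (Suc k))) sums (inverse (z + of_nat 0) - 0)"
    by (intro telescope_sums' )
       (intro filterlim_compose[OF tendsto_inverse_0] tendsto_add_filterlim_at_infinity[OF tendsto_const] tendsto_of_nat)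
  ultimately have "(\<lambda>k. (inverse (1 - z + of_nat k) - inverse (z + of_nat k)) +
       (inverse (z + of_nat k) - inverse (z + of_nat (Suc k)))) sums
       ((Digamma z - Digamma (1 - z)) + (inverse (z + of_nat 0) - 0))"
    by (rule sums_add)
  also have "(\<lambda>k. (inverse (1 - z + of_nat k) - inverse (z + of_nat k)) +
       (inverse (z + of_nat k) - inverse (z + of_nat (Suc k)))) =
       (\<lambda>k. 2 * z / ((of_nat (Suc k))\<^sup>2 - z\<^sup>2))"
  proof (rule ext)
    fix k
    have "z + of_nat (Suc k) \<noteq> 0" "1 - z + of_nat k \<noteq> 0" using nk n1 by blast+
    moreover have "(of_nat (Suc k))\<^sup>2 - z\<^sup>2 = (z + of_nat (Suc k)) * (1 - z + of_nat k)"
      by (simp add: power2_eq_square algebra_simps)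
    ultimately show "(inverse (1 - z + of_nat k) - inverse (z + of_nat k)) +
       (inverse (z + of_nat k) - inverse (z + of_nat (Suc k))) = 2 * z / ((of_nat (Suc k))\<^sup>2 - z\<^sup>2)"
      by (simp add: divide_simps del: of_nat_Suc) (simp add: algebra_simps)
  qed
  also have "((Digamma z - Digamma (1 - z)) + (inverse (z + of_nat 0) - 0)) = 1 / z - pi * cot (pi * z)"
    by (subst Digamma_reflection_complex[OF assms]) (simp add: inverse_eq_divide)
  finally show ?thesis .
qed

text \<open>The cotangent series at \<open>z = \<i> x\<close>, where both sides are purely
  imaginary. The kernel \<open>1 / (exp (2 pi x) - 1)\<close> is that of the Lambert series for the
  logarithm of the Euler product.\<close>

lemma inverse_exp_minus_one_partial_fractions:
  fixes x :: real
  assumes "x > 0"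
  shows "(\<lambda>k. x / (x\<^sup>2 + (real (Suc k))\<^sup>2)) sums (pi * (1 / (exp (2 * pi * x) - 1) - 1 / (2 * pi * x) + 1 / 2))"
proof -
  define z where "z = \<i> * complex_of_real x"
  have z: "z \<notin> \<int>"
  proof
    assume "z \<in> \<int>" then obtain m where "z = of_int m" by (elim Ints_cases)
    hence "Im z = Im (of_int m)" by simp
    thus False using assms by (simp add: z_def)
  qed
  define E where "E = exp (pi * x)"
  have E: "E > 1" using assms by (simp add: E_def)
  have E2: "exp (2 * pi * x) = E\<^sup>2" unfolding E_def by (simp add: exp_double[symmetric] mult.assoc)
  have ca: "\<i> * (of_real pi * z) = - of_real (pi * x)" by (simp add: z_def algebra_simps)
  have "cot (pi * z) = - \<i> * of_real ((E\<^sup>2 + 1) / (E\<^sup>2 - 1))"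
  proof -
    have e: "exp (\<i> * (of_real pi * z)) = of_real (inverse E)" "exp (- (\<i> * (of_real pi * z))) = of_real E"
      unfolding ca E_def by (simp_all add: exp_minus exp_of_real[symmetric])
    have "E\<^sup>2 - 1 \<noteq> 0" using E by (simp add: power2_eq_1_iff)
    moreover have "inverse E - E \<noteq> 0" using E by (simp add: field_simps) (simp add: power2_eq_square[symmetric] power2_eq_1_iff)
    ultimately have "(inverse E + E) / (inverse E - E) = - ((E\<^sup>2 + 1) / (E\<^sup>2 - 1))" using E
      by (simp add: field_simps power2_eq_square)
    hence *: "complex_of_real (inverse E + E) / of_real (inverse E - E) = - of_real ((E\<^sup>2 + 1) / (E\<^sup>2 - 1))"
      by (metis of_real_divide of_real_minus)
    have "cot (pi * z) = ((of_real (inverse E) + of_real E) / 2) / ((of_real (inverse E) - of_real E) / (2 * \<i>))"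
      unfolding cot_def cos_exp_eq sin_exp_eq e ..
    also have "\<dots> = \<i> * (complex_of_real (inverse E + E) / of_real (inverse E - E))"
      by (simp only: of_real_add of_real_diff) (simp add: divide_simps)
    finally have "cot (pi * z) = \<i> * (complex_of_real (inverse E + E) / of_real (inverse E - E))" .
    thus ?thesis unfolding * by simp
  qed
  moreover have "1 / z = - \<i> * of_real (1 / x)" using assms by (simp add: z_def field_simps)
  ultimately have "1 / z - pi * cot (pi * z) = - \<i> * of_real (1 / x) - pi * (- \<i> * of_real ((E\<^sup>2 + 1) / (E\<^sup>2 - 1)))"
    by (simp only:)
  also have "\<dots> = \<i> * of_real (pi * ((E\<^sup>2 + 1) / (E\<^sup>2 - 1)) - 1 / x)"
    unfolding of_real_diff of_real_mult by algebra
  finally have eq: "1 / z - pi * cot (pi * z) = \<i> * of_real (pi * ((E\<^sup>2 + 1) / (E\<^sup>2 - 1)) - 1 / x)" .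
  have "(\<lambda>k. \<i> * complex_of_real (2 * x / (x\<^sup>2 + (real (Suc k))\<^sup>2))) sums (1 / z - pi * cot (pi * z))"
    using cot_partial_fractions[OF z] by (simp add: z_def power_mult_distrib add.commute mult.left_commute)
  hence "(\<lambda>k. \<i> * complex_of_real (2 * x / (x\<^sup>2 + (real (Suc k))\<^sup>2))) sums
       (\<i> * of_real (pi * ((E\<^sup>2 + 1) / (E\<^sup>2 - 1)) - 1 / x))" unfolding eq .
  from sums_Im[OF this] have "(\<lambda>k. 2 * x / (x\<^sup>2 + (real (Suc k))\<^sup>2)) sums (pi * ((E\<^sup>2 + 1) / (E\<^sup>2 - 1)) - 1 / x)"
    by simp
  from sums_mult[OF this, of "1/2"] have "(\<lambda>k. x / (x\<^sup>2 + (real (Suc k))\<^sup>2)) sums ((pi * ((E\<^sup>2 + 1) / (E\<^sup>2 - 1)) - 1 / x) / 2)"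
    by simp
  moreover have "(pi * ((E\<^sup>2 + 1) / (E\<^sup>2 - 1)) - 1 / x) / 2 = pi * (1 / (E\<^sup>2 - 1) - 1 / (2 * pi * x) + 1 / 2)"
  proof -
    have "E\<^sup>2 - 1 \<noteq> 0" using E by (simp add: power2_eq_1_iff)
    thus ?thesis using assms by (simp add: field_simps)
  qed
  ultimately show ?thesis unfolding E2 by simp
qed

section \<open>Comparison of the pole sums with the arctangent\<close>

lemma arctan_step_bounds:
  fixes p v :: real
  assumes "p > 0" "v \<ge> 0"
  shows "p / (p\<^sup>2 + (v + 1)\<^sup>2) \<le> arctan ((v + 1) / p) - arctan (v / p)"
    and "arctan ((v + 1) / p) - arctan (v / p) \<le> p / (p\<^sup>2 + v\<^sup>2)"
proof -
  have der: "((\<lambda>v. arctan (v / p)) has_real_derivative p / (p\<^sup>2 + x\<^sup>2)) (at x)" for x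
    using assms(1) by (auto intro!: derivative_eq_intros simp: field_simps power2_eq_square)
  \<comment> \<open>\<open>arctan (v / p)\<close> is a primitive of
    \<open>p / (p\<^sup>2 + v\<^sup>2)\<close>, which decreases for \<open>v \<ge> 0\<close>: an
    integral comparison on one unit step.\<close>
  obtain \<xi> where \<xi>: "v < \<xi>" "\<xi> < v + 1"
      "arctan ((v + 1) / p) - arctan (v / p) = (v + 1 - v) * (p / (p\<^sup>2 + \<xi>\<^sup>2))"
    using MVT2[of v "v + 1" "\<lambda>v. arctan (v / p)" "\<lambda>x. p / (p\<^sup>2 + x\<^sup>2)"] der by auto
  have "p / (p\<^sup>2 + (v + 1)\<^sup>2) \<le> p / (p\<^sup>2 + \<xi>\<^sup>2)" "p / (p\<^sup>2 + \<xi>\<^sup>2) \<le> p / (p\<^sup>2 + v\<^sup>2)"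
    using assms \<xi> by (auto intro!: divide_left_mono add_left_mono power_mono mult_pos_pos add_pos_nonneg)
  thus "p / (p\<^sup>2 + (v + 1)\<^sup>2) \<le> arctan ((v + 1) / p) - arctan (v / p)"
       "arctan ((v + 1) / p) - arctan (v / p) \<le> p / (p\<^sup>2 + v\<^sup>2)"
    using \<xi> by auto
qed

lemma summable_pole_pair:
  assumes "p > 0"
  shows "summable (\<lambda>n. p / (p\<^sup>2 + (real (Suc n))\<^sup>2))"
  using inverse_exp_minus_one_partial_fractions[OF assms] by (rule sums_summable)

text \<open>The two bounds differ by one step of the arctangent, of order
  \<open>p / K\<^sup>2\<close>. This precision survives when the tails for \<open>p = k y\<close>
  are divided by \<open>k\<close> and summed over \<open>k \<le> K\<close>.\<close>

lemma suminf_tail_pole_pair_bounds: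
  fixes p :: real and K :: nat
  assumes "p > 0"
  defines "T \<equiv> (\<Sum>n. p / (p\<^sup>2 + (real (Suc (n + K)))\<^sup>2))"
  shows "T \<le> pi / 2 - arctan (real K / p)" "pi / 2 - arctan (real (Suc K) / p) \<le> T"
proof -
  have s: "summable (\<lambda>n. p / (p\<^sup>2 + (real (Suc (n + K)))\<^sup>2))"
    using summable_pole_pair[OF assms(1)] by (subst summable_iff_shift[of "\<lambda>n. p / (p\<^sup>2 + (real (Suc n))\<^sup>2)"])
  have lim: "(\<lambda>n. arctan (real (n + M) / p)) \<longlonglongrightarrow> pi / 2" for M
  proof -
    have "filterlim (\<lambda>n. real (n + M) / p) at_top sequentially"
      using assms(1) by real_asymp
    from filterlim_compose[OF tendsto_arctan_at_top this] show ?thesis .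
  qed
  have tel: "(\<lambda>n. arctan (real (Suc n + M) / p) - arctan (real (n + M) / p)) sums (pi / 2 - arctan (real M / p))" for M
    using telescope_sums[OF lim[of M]] by simp
  have "T \<le> (\<Sum>n. arctan (real (Suc n + K) / p) - arctan (real (n + K) / p))"
    unfolding T_def
  proof (intro suminf_le s sums_summable[OF tel])
    fix n show "p / (p\<^sup>2 + (real (Suc (n + K)))\<^sup>2) \<le> arctan (real (Suc n + K) / p) - arctan (real (n + K) / p)"
      using arctan_step_bounds(1)[OF assms(1), of "real (n + K)"] by (simp add: add_ac)
  qed
  thus "T \<le> pi / 2 - arctan (real K / p)" using sums_unique[OF tel, of K] by simp
  have "(\<Sum>n. arctan (real (Suc n + Suc K) / p) - arctan (real (n + Suc K) / p)) \<le> T"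
    unfolding T_def
  proof (intro suminf_le s sums_summable[OF tel])
    fix n show "arctan (real (Suc n + Suc K) / p) - arctan (real (n + Suc K) / p) \<le> p / (p\<^sup>2 + (real (Suc (n + K)))\<^sup>2)"
      using arctan_step_bounds(2)[OF assms(1), of "real (Suc (n + K))"] by (simp add: add_ac)
  qed
  thus "pi / 2 - arctan (real (Suc K) / p) \<le> T" using sums_unique[OF tel, of "Suc K"] by simp
qed

text \<open>The error does not depend on \<open>K\<close>; it will be used with \<open>p\<close>
  proportional to \<open>K\<close>, where it is of order \<open>1 / K\<close>.\<close>

lemma sum_pole_pair_bounds:
  fixes p :: real and K :: nat
  assumes "p > 0"
  shows "\<bar>(\<Sum>k=1..K. p / (p\<^sup>2 + (real k)\<^sup>2)) - arctan (real K / p)\<bar> \<le> 1 / p"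
proof -
  have "(\<Sum>k=1..K. p / (p\<^sup>2 + (real k)\<^sup>2)) \<le> arctan (real K / p) \<and>
        arctan (real (Suc K) / p) - arctan (1 / p) \<le> (\<Sum>k=1..K. p / (p\<^sup>2 + (real k)\<^sup>2))"
  proof (induction K)
    case (Suc K)
    show ?case using Suc.IH arctan_step_bounds(1)[OF assms, of "real K"] arctan_step_bounds(2)[OF assms, of "real (Suc K)"]
      by (auto simp: add_ac)
  qed simp
  moreover have "arctan (real K / p) \<le> arctan (real (Suc K) / p)"
    using assms by (intro arctan_monotone') (auto simp: divide_right_mono)
  moreover have "arctan (1 / p) \<le> 1 / p" using assms arctan_le_self[of "1/p"] by simp
  ultimately show ?thesis using assms by (auto simp: abs_le_iff)
qed

text \<open>The source of the logarithm. The sum vanishes at \<open>y = 1\<close>, and its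
  derivative at \<open>t\<close> is \<open>1 / t\<close> times two pole sums, with
  \<open>p = K / t\<close> and \<open>p = K t\<close>. These tend to \<open>arctan t\<close> and
  \<open>arctan (1 / t)\<close>, which add up to \<open>pi / 2\<close>, with an error of order
  \<open>1 / K\<close> uniform between \<open>1\<close> and \<open>y\<close>.\<close>

lemma sum_arctan_difference_limit:
  fixes y :: real
  assumes "y > 0"
  shows "(\<lambda>K. \<Sum>k=1..K. (arctan (real K * y / real k) - arctan (real K / (real k * y))) / real k)
           \<longlonglongrightarrow> pi / 2 * ln y"
proof -
  define H where "H K t = (\<Sum>k=1..K. (arctan (real K * t / real k) - arctan (real K / (real k * t))) / real k)"
    for K :: nat and t :: real
  define H' where "H' K t = (\<Sum>k=1..K. real K / ((real K / t)\<^sup>2 + (real k)\<^sup>2) / t\<^sup>2 + real K / ((real K * t)\<^sup>2 + (real k)\<^sup>2))"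
    for K :: nat and t :: real
  \<comment> \<open>Bounds \<open>1 + 1 / t\<^sup>2\<close> for all \<open>t\<close> between
    \<open>1\<close> and \<open>y\<close>, whichever of the two is smaller.\<close>
  define C where "C = 1 + 1 / (min 1 y)\<^sup>2"
  have der: "(H K has_real_derivative H' K t) (at t)" if "t > 0" "K > 0" for K t
    unfolding H_def H'_def
  proof (intro DERIV_sum)
    fix k assume "k \<in> {1..K}"
    hence k: "real k > 0" by simp
    have K: "real K > 0" using that by simp
    have *: "(((\<lambda>t. (arctan (real K * t / real k) - arctan (real K / (real k * t))) / real k) has_real_derivative
       ((real K / real k) / (1 + (real K * t / real k)\<^sup>2) - (- (real K * real k) / (real k * t)\<^sup>2) / (1 + (real K / (real k * t))\<^sup>2)) / real k)) (at t)"
      using k that by (auto intro!: derivative_eq_intros simp: field_simps power2_eq_square)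
    have e1: "(real K / real k) / (1 + (real K * t / real k)\<^sup>2) / real k = real K / ((real K * t)\<^sup>2 + (real k)\<^sup>2)"
      using k K that by (simp add: divide_simps add_pos_pos power_mult_distrib power2_eq_square)
    have e2: "(real K * real k) / (real k * t)\<^sup>2 / (1 + (real K / (real k * t))\<^sup>2) / real k = real K / ((real K / t)\<^sup>2 + (real k)\<^sup>2) / t\<^sup>2"
    proof -
      have "(real k * t)\<^sup>2 * (1 + (real K / (real k * t))\<^sup>2) = ((real K / t)\<^sup>2 + (real k)\<^sup>2) * t\<^sup>2"
        using k that by (simp add: algebra_simps power_divide power_mult_distrib)
      moreover have "a * c / A / B / c = a / (A * B)" if "c \<noteq> 0" for a c A B :: real
        using that by simp
      ultimately show ?thesis using k by (simp only: divide_divide_eq_left)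
    qed
    have e3: "(A - (- B) / D / D') / k = B / D / D' / k + A / k" for A B D D' k :: real
      by (simp add: add_divide_distrib diff_divide_distrib)
    show "((\<lambda>t. (arctan (real K * t / real k) - arctan (real K / (real k * t))) / real k) has_real_derivative
       real K / ((real K / t)\<^sup>2 + (real k)\<^sup>2) / t\<^sup>2 + real K / ((real K * t)\<^sup>2 + (real k)\<^sup>2)) (at t)"
      by (rule DERIV_cong[OF *]) (simp only: e3 e1 e2)
  qed
  have H'_bound: "\<bar>H' K t - pi / 2 / t\<bar> \<le> (1 + 1 / t\<^sup>2) / real K" if t: "t > 0" and K: "K > 0" for K t
  proof -
    define S1 where "S1 = (\<Sum>k=1..K. (real K / t) / ((real K / t)\<^sup>2 + (real k)\<^sup>2))"
    define S2 where "S2 = (\<Sum>k=1..K. (real K * t) / ((real K * t)\<^sup>2 + (real k)\<^sup>2))"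
    have "\<bar>S1 - arctan (real K / (real K / t))\<bar> \<le> 1 / (real K / t)"
         "\<bar>S2 - arctan (real K / (real K * t))\<bar> \<le> 1 / (real K * t)"
      unfolding S1_def S2_def using that by (intro sum_pole_pair_bounds; simp)+
    hence "\<bar>S1 - arctan t\<bar> \<le> t / real K" "\<bar>S2 - arctan (1 / t)\<bar> \<le> 1 / (real K * t)"
      using that by simp_all
    moreover have "arctan t + arctan (1 / t) = pi / 2"
      using arctan_inverse[of t] t by (simp add: inverse_eq_divide)
    ultimately have "\<bar>S1 + S2 - pi / 2\<bar> \<le> t / real K + 1 / (real K * t)" by linarith
    moreover have "H' K t = (S1 + S2) / t"
      unfolding H'_def S1_def S2_def using t
      by (simp add: sum.distrib add_divide_distrib sum_divide_distrib power2_eq_square mult_ac)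
    ultimately have "H' K t - pi / 2 / t = (S1 + S2 - pi / 2) / t" by (simp only: diff_divide_distrib)
    hence "\<bar>H' K t - pi / 2 / t\<bar> = \<bar>S1 + S2 - pi / 2\<bar> / t" using t by (simp only: abs_divide)
    also have "\<dots> \<le> (t / real K + 1 / (real K * t)) / t"
      using \<open>\<bar>S1 + S2 - pi / 2\<bar> \<le> _\<close> t by (intro divide_right_mono) auto
    also have "\<dots> = (1 + 1 / t\<^sup>2) / real K" using that by (simp add: field_simps power2_eq_square)
    finally show ?thesis .
  qed
  have bound: "\<bar>H K y - pi / 2 * ln y\<bar> \<le> \<bar>y - 1\<bar> * C / real K" if K: "K > 0" for K
  proof -
    define \<phi> where "\<phi> t = H K t - pi / 2 * ln t" for t
    have d\<phi>: "(\<phi> has_real_derivative (H' K t - pi / 2 / t)) (at t)" if "t > 0" for t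
      unfolding \<phi>_def using that K by (auto intro!: derivative_eq_intros der)
    have "\<phi> 1 = 0" by (simp add: \<phi>_def H_def)
    have C: "\<bar>H' K t - pi / 2 / t\<bar> \<le> C / real K" if "min 1 y \<le> t" for t
    proof -
      have t: "t > 0" using that assms by auto
      have "(min 1 y)\<^sup>2 \<le> t\<^sup>2" using that assms by (intro power_mono) auto
      hence "1 / t\<^sup>2 \<le> 1 / (min 1 y)\<^sup>2" using assms t by (intro divide_left_mono) (auto simp: min_def)
      hence "(1 + 1 / t\<^sup>2) / real K \<le> C / real K" unfolding C_def by (intro divide_right_mono) auto
      thus ?thesis using H'_bound[OF t K] by linarith
    qed
    have "\<exists>\<xi>\<ge>min 1 y. \<phi> y - \<phi> 1 = (y - 1) * (H' K \<xi> - pi / 2 / \<xi>)"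
    proof (cases y "1::real" rule: linorder_cases)
      case less
      obtain \<xi> where "y < \<xi>" "\<xi> < 1" "\<phi> 1 - \<phi> y = (1 - y) * (H' K \<xi> - pi / 2 / \<xi>)"
        using MVT2[OF less, of \<phi> "\<lambda>t. H' K t - pi / 2 / t"] d\<phi> assms by force
      moreover from this(3) have "\<phi> y - \<phi> 1 = (y - 1) * (H' K \<xi> - pi / 2 / \<xi>)" by algebra
      ultimately show ?thesis by (intro exI[of _ \<xi>]) auto
    next
      case greater
      obtain \<xi> where "1 < \<xi>" "\<xi> < y" "\<phi> y - \<phi> 1 = (y - 1) * (H' K \<xi> - pi / 2 / \<xi>)"
        using MVT2[OF greater, of \<phi> "\<lambda>t. H' K t - pi / 2 / t"] d\<phi> by force
      thus ?thesis by (intro exI[of _ \<xi>]) auto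
    qed (auto intro: exI[of _ 1])
    then obtain \<xi> where \<xi>: "\<xi> \<ge> min 1 y" "\<phi> y - \<phi> 1 = (y - 1) * (H' K \<xi> - pi / 2 / \<xi>)" by blast
    hence "\<bar>\<phi> y\<bar> = \<bar>y - 1\<bar> * \<bar>H' K \<xi> - pi / 2 / \<xi>\<bar>" using \<open>\<phi> 1 = 0\<close> by (simp add: abs_mult)
    also have "\<dots> \<le> \<bar>y - 1\<bar> * (C / real K)" using C[OF \<xi>(1)] by (intro mult_left_mono) auto
    finally show ?thesis by (simp add: \<phi>_def)
  qed
  have "(\<lambda>K. \<bar>y - 1\<bar> * C / real K) \<longlonglongrightarrow> 0" by real_asymp
  hence "(\<lambda>K. H K y - pi / 2 * ln y) \<longlonglongrightarrow> 0"
    by (rule Lim_null_comparison[rotated]) (use bound in \<open>auto intro!: eventually_sequentiallyI[of 1]\<close>)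
  thus ?thesis unfolding H_def[symmetric] by (simp add: LIM_zero_iff)
qed

section \<open>The logarithm of the Euler product and its change under
  \<open>y -> 1 / y\<close>\<close>

lemma ln_one_minus_sums:
  fixes x :: real
  assumes "0 \<le> x" "x < 1"
  shows "(\<lambda>n. x ^ Suc n / real (Suc n)) sums (- ln (1 - x))"
proof -
  have "summable (\<lambda>n. x ^ Suc n / real (Suc n))"
  proof (rule summable_comparison_test')
    show "summable (\<lambda>n. x ^ n)" using assms by (intro summable_geometric) auto
    show "norm (x ^ Suc n / real (Suc n)) \<le> x ^ n" for n
    proof -
      have "x ^ Suc n / real (Suc n) \<le> x ^ n / 1"
        using assms by (intro frac_le power_decreasing) auto
      thus ?thesis using assms by simp
    qed
  qed
  moreover have "ln (1 - x) = (\<Sum>n. - (x ^ Suc n / real (Suc n)))"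
  proof -
    have "(- 1) ^ n * (1 / real (n + 1)) * (1 - x - 1) ^ Suc n = - (x ^ Suc n / real (Suc n))" for n
    proof -
      have "(1 - x - 1) ^ Suc n = (- 1) ^ Suc n * x ^ Suc n"
        by (simp flip: power_mult_distrib)
      moreover have "(- 1 :: real) ^ n * (- 1) ^ Suc n = - 1" by (simp flip: power_mult_distrib)
      ultimately have "(- 1) ^ n * (1 - x - 1) ^ Suc n = - (x ^ Suc n)"
        by (metis mult.assoc mult_minus1)
      thus ?thesis by (metis (no_types, lifting) Suc_eq_plus1 minus_divide_left mult.assoc mult.commute times_divide_eq_left mult_1)
    qed
    note eq = this
    have "ln (1 - x) = (\<Sum>n. (- 1) ^ n * (1 / real (n + 1)) * (1 - x - 1) ^ Suc n)"
      using assms by (intro ln_series) auto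
    thus ?thesis unfolding eq .
  qed
  ultimately show ?thesis by (simp add: suminf_minus summable_sums)
qed

text \<open>Both series are iterated sums of \<open>q ^ (k m) / k\<close> over
  \<open>k, m \<ge> 1\<close>; the terms are nonnegative, so the order of summation may be
  exchanged.\<close>

lemma ln_euler_product_Lambert:
  fixes q :: real
  assumes "0 < q" "q < 1"
  obtains S where "(\<lambda>m. - ln (1 - q ^ Suc m)) sums S"
    "(\<lambda>k. q ^ Suc k / (1 - q ^ Suc k) / real (Suc k)) sums S"
proof -
  define g where "g = (\<lambda>(k, m). q ^ (Suc k * Suc m) / real (Suc k))"
  have p1: "q ^ Suc k < 1" for k using assms by (intro power_Suc_less_one) auto
  have inner: "((\<lambda>m. g (k, m)) has_sum (q ^ Suc k / (1 - q ^ Suc k) / real (Suc k))) UNIV" for k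
  proof -
    have "(\<lambda>m. (q ^ Suc k) ^ m) sums (1 / (1 - q ^ Suc k))"
      using p1[of k] assms by (intro geometric_sums) (auto simp: power_mult_distrib[symmetric])
    from sums_mult[OF this, of "q ^ Suc k / real (Suc k)"]
    have "(\<lambda>m. g (k, m)) sums (q ^ Suc k / (1 - q ^ Suc k) / real (Suc k))"
      unfolding g_def by (simp add: power_add power_mult field_simps)
    thus ?thesis by (intro sums_nonneg_imp_has_sum) (use assms in \<open>auto simp: g_def\<close>)
  qed
  have inner': "((\<lambda>k. g (k, m)) has_sum (- ln (1 - q ^ Suc m))) UNIV" for m
  proof -
    have "(\<lambda>k. g (k, m)) sums (- ln (1 - q ^ Suc m))"
      using ln_one_minus_sums[OF _ p1[of m]] zero_le_power[of q "Suc m"] assms(1)[THEN less_imp_le]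
      unfolding g_def by (simp only: power_mult[symmetric] mult.commute prod.case)
    thus ?thesis by (intro sums_nonneg_imp_has_sum) (use assms in \<open>auto simp: g_def\<close>)
  qed
  have "(\<lambda>k. q ^ Suc k / (1 - q ^ Suc k) / real (Suc k)) summable_on UNIV"
  proof (rule summable_nonneg_imp_summable_on)
    show "summable (\<lambda>k. q ^ Suc k / (1 - q ^ Suc k) / real (Suc k))"
    proof (rule summable_comparison_test')
      show "summable (\<lambda>k. q ^ k / (1 - q))" using assms by (intro summable_divide summable_geometric) auto
      fix k :: nat
      have "q ^ Suc k \<le> q" using assms power_decreasing[of 1 "Suc k" q] by simp
      hence "q ^ Suc k / (1 - q ^ Suc k) / real (Suc k) \<le> q ^ k / (1 - q) / 1"
        using assms by (intro frac_le power_decreasing) auto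
      thus "norm (q ^ Suc k / (1 - q ^ Suc k) / real (Suc k)) \<le> q ^ k / (1 - q)"
        using assms p1[of k] by auto
    qed
  qed (use assms p1 in \<open>auto simp del: power_Suc simp: less_imp_le intro!: divide_nonneg_nonneg\<close>)
  hence "g summable_on (UNIV \<times> UNIV)"
    by (intro summable_on_SigmaI[OF inner]) (use assms in \<open>auto simp: g_def\<close>)
  then obtain S where S: "(g has_sum S) (UNIV \<times> UNIV)" by (auto simp: summable_on_def)
  have "((\<lambda>k. q ^ Suc k / (1 - q ^ Suc k) / real (Suc k)) has_sum S) UNIV"
    by (rule has_sum_SigmaD[OF S]) (use inner in auto)
  moreover have "((\<lambda>(m, k). g (k, m)) has_sum S) (UNIV \<times> UNIV)"
    using S by (subst (asm) has_sum_swap)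
  hence "((\<lambda>m. - ln (1 - q ^ Suc m)) has_sum S) UNIV"
    by (rule has_sum_SigmaD) (use inner' in auto)
  ultimately show ?thesis by (intro that[of S] has_sum_imp_sums)
qed

text \<open>In \<open>c p = G p / pi + 1 / (2 pi p) - 1 / 2\<close> the constants cancel between
  \<open>y\<close> and \<open>1 / y\<close>, the middle term yields
  \<open>pi / 12 * (1 / y - y)\<close> through the value \<open>pi\<^sup>2 / 6\<close> of the
  inverse square sum, and \<open>G\<close> yields \<open>ln y / 2\<close>.\<close>

lemma ln_euler_product_transformation:
  fixes y :: real
  assumes y: "y > 0"
  shows "(\<Sum>m. ln (1 - exp (- 2 * pi / y) ^ Suc m)) =
         (\<Sum>m. ln (1 - exp (- 2 * pi * y) ^ Suc m)) + ln y / 2 + pi / 12 * (1 / y - y)"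
proof -
  define c where "c x = 1 / (exp (2 * pi * x) - 1)" for x :: real
  define G where "G p = (\<Sum>n. p / (p\<^sup>2 + (real (Suc n))\<^sup>2))" for p :: real
  have c_eq: "c p = G p / pi + 1 / (2 * pi * p) - 1 / 2" if "p > 0" for p
    using sums_unique[OF inverse_exp_minus_one_partial_fractions[OF that]] unfolding c_def G_def
    by (simp add: field_simps)
  have log: "(\<lambda>k. c (real (Suc k) * y) / real (Suc k)) sums (- (\<Sum>m. ln (1 - exp (- 2 * pi * y) ^ Suc m)))"
    if "y > 0" for y
  proof -
    define q where "q = exp (- 2 * pi * y)"
    have q: "0 < q" "q < 1" using that by (auto simp: q_def)
    obtain S where S: "(\<lambda>m. - ln (1 - q ^ Suc m)) sums S"
      "(\<lambda>k. q ^ Suc k / (1 - q ^ Suc k) / real (Suc k)) sums S"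
      using ln_euler_product_Lambert[OF q] by blast
    have "q ^ Suc k / (1 - q ^ Suc k) = c (real (Suc k) * y)" for k
    proof -
      have "exp (2 * pi * (real (Suc k) * y)) = inverse (q ^ Suc k)"
        unfolding q_def exp_of_nat_mult[symmetric] by (simp add: exp_minus[symmetric] algebra_simps)
      moreover have "q ^ Suc k > 0" "q ^ Suc k < 1" using q by (auto intro!: power_Suc_less_one simp del: power_Suc)
      moreover have "Q / (1 - Q) = 1 / (inverse Q - 1)" if "Q > 0" "Q < 1" for Q :: real
        using that by (simp add: field_simps)
      ultimately show ?thesis unfolding c_def by presburger
    qed
    moreover have "S = - (\<Sum>m. ln (1 - q ^ Suc m))"
      using sums_unique[OF sums_minus[OF S(1)]] by simp
    ultimately show ?thesis using S(2) by (simp add: q_def)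
  qed
  define L where "L y = (\<Sum>m. ln (1 - exp (- 2 * pi * y) ^ Suc m))" for y :: real
  have "(\<lambda>k. c (real (Suc k) * y) / real (Suc k) - c (real (Suc k) * (1 / y)) / real (Suc k)) sums (- L y - - L (1 / y))"
    unfolding L_def using y by (intro sums_diff log) auto
  hence lim1: "(\<lambda>K. \<Sum>k=1..K. (c (real k * y) - c (real k / y)) / real k) \<longlonglongrightarrow> L (1 / y) - L y"
    unfolding sums_def
    by (simp add: sum.atLeast1_atMost_eq diff_divide_distrib)
  define T where "T K p = (\<Sum>n. p / (p\<^sup>2 + (real (Suc (n + K)))\<^sup>2))" for p :: real and K :: nat
  have G_split: "G p = (\<Sum>n=1..K. p / (p\<^sup>2 + (real n)\<^sup>2)) + T K p" if "p > 0" for p K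
    unfolding G_def T_def using suminf_split_initial_segment[OF summable_pole_pair[OF that], of K]
    by (simp add: sum.atLeast1_atMost_eq add.commute)
  \<comment> \<open>Divided by \<open>k\<close>, the summand of \<open>G (k y)\<close> is
    \<open>a k n\<close> and that of \<open>G (k / y)\<close> is \<open>a n k\<close>. Over the
    square \<open>k, n \<le> K\<close> the two double sums are transposes of each other and cancel;
    the tails \<open>n > K\<close> remain.\<close>
  have GT: "(\<Sum>k=1..K. (G (real k * y) - G (real k / y)) / real k) =
      (\<Sum>k=1..K. (T K (real k * y) - T K (real k / y)) / real k)" for K
  proof -
    define a where "a k n = y / ((real k)\<^sup>2 * y\<^sup>2 + (real n)\<^sup>2)" for k n :: nat
    have a1: "(real k * y) / ((real k * y)\<^sup>2 + (real n)\<^sup>2) / real k = a k n" if "k > 0" for k n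
      unfolding a_def using that by (simp add: power_mult_distrib)
    have a2: "(real k / y) / ((real k / y)\<^sup>2 + (real n)\<^sup>2) / real k = a n k" if "k > 0" for k n
    proof -
      have "((real k / y)\<^sup>2 + (real n)\<^sup>2) * y\<^sup>2 = (real n)\<^sup>2 * y\<^sup>2 + (real k)\<^sup>2"
        using y by (simp add: algebra_simps power_divide)
      moreover have "(real k / y) / P / real k = y / (P * y\<^sup>2)" for P
        using y that by (simp add: field_simps power2_eq_square)
      ultimately show ?thesis unfolding a_def by simp
    qed
    have "(G (real k * y) - G (real k / y)) / real k = (T K (real k * y) - T K (real k / y)) / real k +
        ((\<Sum>n=1..K. a k n) - (\<Sum>n=1..K. a n k))" if "k \<in> {1..K}" for k
    proof -
      have "(\<Sum>n=1..K. a k n) = (\<Sum>n=1..K. (real k * y) / ((real k * y)\<^sup>2 + (real n)\<^sup>2)) / real k"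
        using that by (subst sum_divide_distrib, intro sum.cong refl) (rule a1[symmetric], simp)
      moreover have "(\<Sum>n=1..K. a n k) = (\<Sum>n=1..K. (real k / y) / ((real k / y)\<^sup>2 + (real n)\<^sup>2)) / real k"
        using that by (subst sum_divide_distrib, intro sum.cong refl) (rule a2[symmetric], simp)
      ultimately show ?thesis using that y
        by (simp add: G_split[of _ K] diff_divide_distrib add_divide_distrib)
    qed
    hence "(\<Sum>k=1..K. (G (real k * y) - G (real k / y)) / real k) =
      (\<Sum>k=1..K. (T K (real k * y) - T K (real k / y)) / real k + ((\<Sum>n=1..K. a k n) - (\<Sum>n=1..K. a n k)))"
      by (intro sum.cong) auto
    also have "\<dots> = (\<Sum>k=1..K. (T K (real k * y) - T K (real k / y)) / real k)"
      using sum.swap[of "\<lambda>k n. a k n" "{1..K}" "{1..K}"] by (simp add: sum.distrib sum_subtractf)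
    finally show ?thesis .
  qed
  \<comment> \<open>The lower bound for the tail is shifted by one index, which costs at most
    \<open>p / K\<^sup>2\<close>.\<close>
  have T_approx: "\<bar>T K p - (pi / 2 - arctan (real K / p))\<bar> \<le> p / (real K)\<^sup>2" if "p > 0" "K > 0" for p K
  proof -
    have "arctan (real (Suc K) / p) - arctan (real K / p) \<le> p / (p\<^sup>2 + (real K)\<^sup>2)"
      using arctan_step_bounds(2)[OF that(1), of "real K"] by (simp add: add.commute)
    also have "\<dots> \<le> p / (real K)\<^sup>2"
      using that by (intro divide_left_mono) (auto intro!: mult_pos_pos add_pos_pos)
    finally show ?thesis
      using suminf_tail_pole_pair_bounds[OF that(1), of K] unfolding T_def abs_le_iff by linarith
  qed
  have lim2: "(\<lambda>K. \<Sum>k=1..K. (G (real k * y) - G (real k / y)) / real k) \<longlonglongrightarrow> pi / 2 * ln y"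
  proof -
    define A where "A K = (\<Sum>k=1..K. (arctan (real K * y / real k) - arctan (real K / (real k * y))) / real k)" for K :: nat
    have bd: "\<bar>(\<Sum>k=1..K. (T K (real k * y) - T K (real k / y)) / real k) - A K\<bar> \<le> (y + 1 / y) / real K" if "K > 0" for K
    proof -
      have "\<bar>(\<Sum>k=1..K. (T K (real k * y) - T K (real k / y)) / real k) - A K\<bar> \<le>
         (\<Sum>k=1..K. \<bar>(T K (real k * y) - T K (real k / y)) / real k - (arctan (real K * y / real k) - arctan (real K / (real k * y))) / real k\<bar>)"
        unfolding A_def sum_subtractf[symmetric] by (rule sum_abs)
      also have "\<dots> \<le> (\<Sum>k=1..K. (y + 1 / y) / (real K)\<^sup>2)"
      proof (rule sum_mono)
        fix k assume k: "k \<in> {1..K}"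
        have "\<bar>T K (real k * y) - (pi / 2 - arctan (real K / (real k * y)))\<bar> \<le> real k * y / (real K)\<^sup>2"
             "\<bar>T K (real k / y) - (pi / 2 - arctan (real K / (real k / y)))\<bar> \<le> real k / y / (real K)\<^sup>2"
          using k y that by (intro T_approx; simp)+
        hence "\<bar>(T K (real k * y) - T K (real k / y)) - (arctan (real K * y / real k) - arctan (real K / (real k * y)))\<bar>
           \<le> real k * y / (real K)\<^sup>2 + real k / y / (real K)\<^sup>2"
          by (simp add: abs_le_iff)
        hence "\<bar>(T K (real k * y) - T K (real k / y)) - (arctan (real K * y / real k) - arctan (real K / (real k * y)))\<bar> / real k
           \<le> (real k * y / (real K)\<^sup>2 + real k / y / (real K)\<^sup>2) / real k"
          by (rule divide_right_mono) simp
        also have "(real k * y / (real K)\<^sup>2 + real k / y / (real K)\<^sup>2) / real k = (y + 1 / y) / (real K)\<^sup>2"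
          using k y that by (simp add: field_simps power2_eq_square)
        finally show "\<bar>(T K (real k * y) - T K (real k / y)) / real k - (arctan (real K * y / real k) - arctan (real K / (real k * y))) / real k\<bar>
           \<le> (y + 1 / y) / (real K)\<^sup>2"
          using k by (simp add: diff_divide_distrib[symmetric])
      qed
      also have "\<dots> = (y + 1 / y) / real K" using that by (simp add: power2_eq_square)
      finally show ?thesis .
    qed
    have lim0: "(\<lambda>K. (y + 1 / y) / real K) \<longlonglongrightarrow> 0" by real_asymp
    have "(\<lambda>K. (\<Sum>k=1..K. (T K (real k * y) - T K (real k / y)) / real k) - A K) \<longlonglongrightarrow> 0"
    proof (rule Lim_null_comparison[OF _ lim0], rule eventually_sequentiallyI[of 1])
      fix K :: nat assume "1 \<le> K"
      thus "norm ((\<Sum>k=1..K. (T K (real k * y) - T K (real k / y)) / real k) - A K) \<le> (y + 1 / y) / real K"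
        unfolding real_norm_def by (intro bd) simp
    qed
    moreover have "A \<longlonglongrightarrow> pi / 2 * ln y" unfolding A_def using sum_arctan_difference_limit[OF y] .
    ultimately have "(\<lambda>K. (\<Sum>k=1..K. (T K (real k * y) - T K (real k / y)) / real k) - A K + A K) \<longlonglongrightarrow> 0 + pi / 2 * ln y"
      by (intro tendsto_add)
    thus ?thesis unfolding GT by (simp only: diff_add_cancel add_0)
  qed
  have lim3: "(\<lambda>K. \<Sum>k=1..K. 1 / (real k)\<^sup>2) \<longlonglongrightarrow> pi\<^sup>2 / 6"
    using inverse_squares_sums unfolding sums_def
    by (simp add: sum.atLeast1_atMost_eq add.commute)
  have "(\<Sum>k=1..K. (c (real k * y) - c (real k / y)) / real k) =
        (\<Sum>k=1..K. (G (real k * y) - G (real k / y)) / real k) / pi + (1 / y - y) / (2 * pi) * (\<Sum>k=1..K. 1 / (real k)\<^sup>2)" for K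
    unfolding sum_divide_distrib sum_distrib_left sum.distrib[symmetric]
  proof (intro sum.cong refl)
    fix k assume "k \<in> {1..K}"
    hence k: "real k > 0" by simp
    have "c (real k * y) - c (real k / y) = (G (real k * y) - G (real k / y)) / pi + (1 / y - y) / (2 * pi) / real k"
      using k y c_eq[of "real k * y"] c_eq[of "real k / y"] by (simp add: diff_divide_distrib mult_ac)
    hence "(c (real k * y) - c (real k / y)) / real k =
        ((G (real k * y) - G (real k / y)) / pi + (1 / y - y) / (2 * pi) / real k) / real k" by (simp only:)
    also have "\<dots> = (G (real k * y) - G (real k / y)) / real k / pi + (1 / y - y) / (2 * pi) * (1 / (real k)\<^sup>2)"
      by (simp add: add_divide_distrib power2_eq_square mult_ac)
    finally show "(c (real k * y) - c (real k / y)) / real k = (G (real k * y) - G (real k / y)) / real k / pi + (1 / y - y) / (2 * pi) * (1 / (real k)\<^sup>2)" .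
  qed
  moreover have "(\<lambda>K. (\<Sum>k=1..K. (G (real k * y) - G (real k / y)) / real k) / pi + (1 / y - y) / (2 * pi) * (\<Sum>k=1..K. 1 / (real k)\<^sup>2))
     \<longlonglongrightarrow> pi / 2 * ln y / pi + (1 / y - y) / (2 * pi) * (pi\<^sup>2 / 6)"
    by (intro tendsto_intros lim2 lim3) simp
  ultimately have "(\<lambda>K. \<Sum>k=1..K. (c (real k * y) - c (real k / y)) / real k)
     \<longlonglongrightarrow> pi / 2 * ln y / pi + (1 / y - y) / (2 * pi) * (pi\<^sup>2 / 6)" by simp
  from LIMSEQ_unique[OF lim1 this] have "L (1 / y) - L y = pi / 2 * ln y / pi + (1 / y - y) / (2 * pi) * (pi\<^sup>2 / 6)" .
  also have "\<dots> = ln y / 2 + pi / 12 * (1 / y - y)" by (simp add: power2_eq_square)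
  finally have "L (1 / y) = L y + ln y / 2 + pi / 12 * (1 / y - y)" by simp
  thus ?thesis unfolding L_def by simp
qed

section \<open>The Dedekind eta function\<close>

text \<open>The distance of a product from 1 is at most that of the product of the
  \<open>1 + |f n - 1|\<close>, hence at most \<open>exp\<close> of a geometric sum, minus 1. The
  explicit form supplies the numerical constants near the cusps.\<close>

lemma norm_prodinf_minus_1_le:
  fixes f :: "nat \<Rightarrow> complex" and C r :: real
  assumes "\<And>n. norm (f n - 1) \<le> C * r ^ Suc n" "0 \<le> r" "r < 1" "0 \<le> C"
  shows "convergent_prod f" "norm (prodinf f - 1) \<le> exp (C * (r / (1 - r))) - 1"
proof -
  have geo: "(\<lambda>n. r ^ Suc n) sums (r / (1 - r))"
    using sums_mult[OF geometric_sums[of r], of r] assms by simp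
  have sm: "summable (\<lambda>n. C * r ^ Suc n)" using geo by (intro summable_mult sums_summable)
  have "summable (\<lambda>n. norm (f n - 1))"
    by (rule summable_comparison_test'[OF sm]) (use assms(1) in auto)
  hence "abs_convergent_prod f" by (rule summable_imp_abs_convergent_prod)
  thus conv: "convergent_prod f" by (rule abs_convergent_prod_imp_convergent_prod)
  have "norm ((\<Prod>n\<le>N. f n) - 1) \<le> exp (C * (r / (1 - r))) - 1" for N
  proof -
    have "norm ((\<Prod>n\<le>N. 1 + (f n - 1)) - 1) \<le> (\<Prod>n\<le>N. 1 + norm (f n - 1)) - 1"
      by (rule norm_prod_minus1_le_prod_minus1)
    also have "(\<Prod>n\<le>N. 1 + norm (f n - 1)) \<le> exp (\<Sum>n\<le>N. norm (f n - 1))"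
      by (rule prod_le_exp_sum) auto
    also have "(\<Sum>n\<le>N. norm (f n - 1)) \<le> (\<Sum>n\<le>N. C * r ^ Suc n)"
      by (rule sum_mono) (rule assms(1))
    also have "\<dots> \<le> (\<Sum>n. C * r ^ Suc n)"
      by (rule sum_le_suminf[OF sm]) (use assms in auto)
    also have "\<dots> = C * (r / (1 - r))" using geo by (intro sums_unique[symmetric] sums_mult)
    finally show ?thesis by simp
  qed
  moreover have "(\<lambda>N. norm ((\<Prod>n\<le>N. f n) - 1)) \<longlonglongrightarrow> norm (prodinf f - 1)"
    by (intro tendsto_intros convergent_prod_LIMSEQ conv)
  ultimately show "norm (prodinf f - 1) \<le> exp (C * (r / (1 - r))) - 1"
    by (intro LIMSEQ_le_const2) auto
qed

text \<open>Euler's function \<open>(q; q)\<close>. It depends on the nome rather than on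
  \<open>t\<close>, as it is also taken at \<open>- q\<close> and at powers of
  \<open>q\<close>.\<close>

definition euler_fun :: "complex \<Rightarrow> complex" where
  "euler_fun q = (\<Prod>n. 1 - q ^ Suc n)"

lemma power_Suc_neq_1:
  fixes q :: complex
  assumes "norm q < 1"
  shows "q ^ Suc n \<noteq> 1"
proof
  assume "q ^ Suc n = 1"
  hence "norm q ^ Suc n = 1" by (metis norm_one norm_power)
  moreover have "norm q ^ Suc n < 1" using assms by (subst power_less_one_iff) auto
  ultimately show False by simp
qed

lemma
  assumes "norm q < 1"
  shows norm_euler_fun_minus_1: "norm (euler_fun q - 1) \<le> exp (norm q / (1 - norm q)) - 1"
    and euler_fun_nonzero: "euler_fun q \<noteq> 0"
    and has_prod_euler_fun: "(\<lambda>n. 1 - q ^ Suc n) has_prod euler_fun q"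
    and LIMSEQ_euler_fun: "(\<lambda>N. \<Prod>n<N. 1 - q ^ Suc n) \<longlonglongrightarrow> euler_fun q"
proof -
  have *: "norm (1 - q ^ Suc n - 1) \<le> 1 * norm q ^ Suc n" for n by (simp add: norm_mult norm_power)
  have c: "convergent_prod (\<lambda>n. 1 - q ^ Suc n)"
    by (rule norm_prodinf_minus_1_le(1)[OF *]) (use assms in auto)
  show "norm (euler_fun q - 1) \<le> exp (norm q / (1 - norm q)) - 1"
    using norm_prodinf_minus_1_le(2)[OF *] assms by (simp add: euler_fun_def)
  show "euler_fun q \<noteq> 0" unfolding euler_fun_def
    using c power_Suc_neq_1[OF assms] by (intro prodinf_nonzero) (metis diff_eq_diff_eq diff_self)+
  show "(\<lambda>n. 1 - q ^ Suc n) has_prod euler_fun q" unfolding euler_fun_def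
    using c by (rule convergent_prod_has_prod)
  have "(\<lambda>N. \<Prod>n\<le>N. 1 - q ^ Suc n) \<longlonglongrightarrow> euler_fun q" unfolding euler_fun_def
    using c by (rule convergent_prod_LIMSEQ)
  thus "(\<lambda>N. \<Prod>n<N. 1 - q ^ Suc n) \<longlonglongrightarrow> euler_fun q"
    by (subst LIMSEQ_lessThan_iff_atMost)
qed

text \<open>A locally uniform limit of polynomials: a closed disc around \<open>x\<close> stays
  within radius \<open>r < 1\<close>, where a geometric series dominates.\<close>

lemma holomorphic_euler_fun: "euler_fun holomorphic_on ball 0 1"
proof (rule holomorphic_uniform_sequence[OF open_ball])
  show "(\<lambda>q. \<Prod>n<N. 1 - q ^ Suc n) holomorphic_on ball 0 1" for N
    by (intro holomorphic_intros)
  fix x :: complex assume x: "x \<in> ball 0 1"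
  define d where "d = (1 - norm x) / 2"
  define r where "r = (1 + norm x) / 2"
  have d: "d > 0" and r: "0 \<le> r" "r < 1" using x by (auto simp: d_def r_def)
  have bd: "norm y \<le> r" if "y \<in> cball x d" for y
  proof -
    have "norm y \<le> norm x + dist x y" using norm_triangle_ineq[of x "y - x"] by (simp add: dist_norm norm_minus_commute)
    thus ?thesis using that by (simp add: d_def r_def field_simps)
  qed
  hence sub: "cball x d \<subseteq> ball 0 1" using r by force
  have "uniformly_convergent_on (cball x d) (\<lambda>N q. \<Prod>n<N. 1 + (- (q ^ Suc n)))"
  proof (rule uniformly_convergent_on_prod)
    have "uniform_limit (cball x d) (\<lambda>N q. \<Sum>n<N. norm (- (q ^ Suc n))) (\<lambda>q. \<Sum>n. norm (- (q ^ Suc n))) sequentially"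
    proof (rule Weierstrass_m_test)
      show "summable (\<lambda>n. r ^ Suc n)" using r by (subst summable_Suc_iff) (auto intro!: summable_geometric)
      fix n q assume "q \<in> cball x d"
      hence "norm q ^ Suc n \<le> r ^ Suc n" using bd by (intro power_mono) auto
      thus "norm (norm (- (q ^ Suc n))) \<le> r ^ Suc n" by (simp add: norm_mult norm_power)
    qed
    thus "uniformly_convergent_on (cball x d) (\<lambda>N q. \<Sum>n<N. norm (- (q ^ Suc n)))"
      by (auto simp: uniformly_convergent_on_def)
  qed (auto intro!: continuous_intros)
  then obtain l where l: "uniform_limit (cball x d) (\<lambda>N q. \<Prod>n<N. 1 + (- (q ^ Suc n))) l sequentially"
    by (auto simp: uniformly_convergent_on_def)
  have "l y = euler_fun y" if "y \<in> cball x d" for y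
  proof (rule LIMSEQ_unique)
    show "(\<lambda>N. \<Prod>n<N. 1 + (- (y ^ Suc n))) \<longlonglongrightarrow> l y" using tendsto_uniform_limitI[OF l that] .
    show "(\<lambda>N. \<Prod>n<N. 1 + (- (y ^ Suc n))) \<longlonglongrightarrow> euler_fun y"
      using LIMSEQ_euler_fun[of y] that sub by auto
  qed
  hence "uniform_limit (cball x d) (\<lambda>N q. \<Prod>n<N. 1 - q ^ Suc n) euler_fun sequentially"
    using l by (subst uniform_limit_cong'[where g = "\<lambda>N q. \<Prod>n<N. 1 + (- (q ^ Suc n))" and i = l]) auto
  with d sub show "\<exists>d>0. cball x d \<subseteq> ball 0 1 \<and> uniform_limit (cball x d) (\<lambda>N q. \<Prod>n<N. 1 - q ^ Suc n) euler_fun sequentially"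
    by blast
qed

lemma euler_fun_of_real:
  fixes q :: real
  assumes "0 < q" "q < 1"
  shows "euler_fun (of_real q) = of_real (exp (\<Sum>m. ln (1 - q ^ Suc m)))"
proof -
  obtain S where S: "(\<lambda>m. - ln (1 - q ^ Suc m)) sums S" using ln_euler_product_Lambert[OF assms] by blast
  have p: "1 - q ^ Suc m > 0" for m using assms power_Suc_less_one[of q m] by simp
  have S': "(\<lambda>m. ln (1 - q ^ Suc m)) sums (- S)" using sums_minus[OF S] by simp
  have "(\<lambda>N. exp (\<Sum>m<N. ln (1 - q ^ Suc m))) \<longlonglongrightarrow> exp (- S)"
    using S' unfolding sums_def by (intro tendsto_exp)
  moreover have "exp (\<Sum>m<N. ln (1 - q ^ Suc m)) = (\<Prod>m<N. 1 - q ^ Suc m)" for N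
    using p by (simp add: exp_sum del: power_Suc)
  ultimately have "(\<lambda>N. \<Prod>m<N. 1 - q ^ Suc m) \<longlonglongrightarrow> exp (- S)" by simp
  hence "(\<lambda>N. complex_of_real (\<Prod>m<N. 1 - q ^ Suc m)) \<longlonglongrightarrow> of_real (exp (- S))" by (rule tendsto_of_real)
  hence "(\<lambda>N. \<Prod>m<N. 1 - complex_of_real q ^ Suc m) \<longlonglongrightarrow> of_real (exp (- S))" by simp
  moreover have "(\<lambda>N. \<Prod>m<N. 1 - complex_of_real q ^ Suc m) \<longlonglongrightarrow> euler_fun (of_real q)"
    using assms by (intro LIMSEQ_euler_fun) auto
  ultimately have "euler_fun (of_real q) = of_real (exp (- S))" by (rule LIMSEQ_unique[rotated])
  thus ?thesis using sums_unique[OF S'] by simp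
qed

definition eta :: "complex \<Rightarrow> complex" where
  "eta t = exp (2 * pi * \<i> * t / 24) * euler_fun (exp (2 * pi * \<i> * t))"

lemma norm_nome_less_1: "Im t > 0 \<Longrightarrow> norm (exp (2 * pi * \<i> * t)) < 1"
  by simp

lemma holomorphic_eta: "eta holomorphic_on {t. Im t > 0}"
proof -
  have "(euler_fun \<circ> (\<lambda>t. exp (2 * pi * \<i> * t))) holomorphic_on {t. Im t > 0}"
    by (rule holomorphic_on_compose_gen[OF _ holomorphic_euler_fun]) (auto intro!: holomorphic_intros)
  thus ?thesis unfolding eta_def[abs_def] comp_def by (intro holomorphic_intros) auto
qed

lemma eta_imaginary:
  fixes y :: real
  assumes "y > 0"
  shows "eta (\<i> * y) = of_real (exp (- pi * y / 12 + (\<Sum>m. ln (1 - exp (- 2 * pi * y) ^ Suc m))))"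
proof -
  have e: "exp (2 * pi * \<i> * (\<i> * y)) = of_real (exp (- 2 * pi * y))"
    "exp (2 * pi * \<i> * (\<i> * y) / 24) = of_real (exp (- pi * y / 12))"
    by (simp_all add: exp_of_real[symmetric] algebra_simps)
  have "euler_fun (of_real (exp (- 2 * pi * y))) = of_real (exp (\<Sum>m. ln (1 - exp (- 2 * pi * y) ^ Suc m)))"
    using assms by (intro euler_fun_of_real) auto
  thus ?thesis unfolding eta_def e by (simp only: exp_add of_real_mult)
qed

text \<open>Both sides are holomorphic on the upper half-plane, where \<open>- \<i> t\<close> has
  positive real part and avoids the branch cut. They agree on the positive imaginary axis, which
  accumulates at \<open>\<i>\<close>, so the identity theorem applies.\<close>

theorem eta_minus_one_over:
  assumes "Im t > 0"
  shows "eta (- 1 / t) = csqrt (- \<i> * t) * eta t"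
proof -
  define f where "f t = eta (- 1 / t) - csqrt (- \<i> * t) * eta t" for t
  let ?H = "{t. Im t > 0}"
  let ?U = "(\<lambda>y. \<i> * complex_of_real y) ` {0<..}"
  have inv: "Im (- 1 / t) > 0" if "Im t > 0" for t
  proof -
    have "Im (- 1 / t) = Im t / (norm t)\<^sup>2" by (simp add: Im_divide cmod_power2)
    moreover have "t \<noteq> 0" using that by auto
    ultimately show ?thesis using that by simp
  qed
  have "f t = 0"
  proof (rule analytic_continuation[where f = f and S = "?H" and U = "?U" and \<xi> = \<i>])
    show "open ?H" by (rule open_halfspace_Im_gt)
    show "connected ?H" by (intro convex_connected convex_halfspace_Im_gt)
    have "(eta \<circ> (\<lambda>t. - 1 / t)) holomorphic_on ?H"
      by (rule holomorphic_on_compose_gen[OF _ holomorphic_eta])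
         (use inv in \<open>auto intro!: holomorphic_intros\<close>)
    moreover have "(\<lambda>t. csqrt (- \<i> * t)) holomorphic_on ?H"
      by (intro holomorphic_intros) (auto simp: complex_nonneg_Reals_iff complex_nonpos_Reals_iff)
    ultimately show "f holomorphic_on ?H" unfolding f_def comp_def
      by (intro holomorphic_intros holomorphic_eta) (auto simp: complex_nonneg_Reals_iff complex_nonpos_Reals_iff)
    show "?U \<subseteq> ?H" by auto
    show "\<i> \<in> ?H" by simp
    show "\<i> islimpt ?U"
    proof (rule islimpt_approachable[THEN iffD2], intro allI impI)
      fix e :: real assume "e > 0"
      have "dist (\<i> * complex_of_real (1 + e / 2)) \<i> = norm (\<i> * complex_of_real (e / 2))"
        by (simp add: dist_norm algebra_simps)
      also have "\<dots> < e" using \<open>e > 0\<close> by (simp only: norm_mult norm_of_real) simp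
      finally show "\<exists>x'\<in>?U. x' \<noteq> \<i> \<and> dist x' \<i> < e"
        using \<open>e > 0\<close> by (intro bexI[of _ "\<i> * complex_of_real (1 + e / 2)"]) (auto simp: complex_eq_iff)
    qed
    show "t \<in> ?H" using assms by simp
    fix z assume "z \<in> ?U"
    then obtain y :: real where y: "y > 0" "z = \<i> * y" by auto
    have m: "- 1 / z = \<i> * complex_of_real (1 / y)" using y by (simp add: field_simps)
    have c: "csqrt (- \<i> * z) = of_real (exp (ln y / 2))"
    proof -
      have "exp (ln y / 2) = sqrt y" using y by (simp add: ln_sqrt[symmetric])
      moreover have "- \<i> * z = complex_of_real y" by (simp add: y)
      ultimately show ?thesis using y by simp
    qed
    \<comment> \<open>The term \<open>pi / 12 * (1 / y - y)\<close> exchanges the exponential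
      prefactors of \<open>eta\<close> at \<open>1 / y\<close> and at \<open>y\<close>; what is left
      is \<open>ln y / 2\<close>, the logarithm of the square root.\<close>
    have aux: "- pi * (1 / y) / 12 + (Z + ln y / 2 + pi / 12 * (1 / y - y)) = ln y / 2 + (- pi * y / 12 + Z)" for Z
      using y by (simp add: field_simps)
    have "- 2 * pi * (1 / y) = - 2 * pi / y" by simp
    hence "eta (- 1 / z) = of_real (exp (- pi * (1 / y) / 12 + (\<Sum>m. ln (1 - exp (- 2 * pi / y) ^ Suc m))))"
      unfolding m using eta_imaginary[of "1 / y"] y by (simp only:) simp
    also have "\<dots> = of_real (exp (ln y / 2 + (- pi * y / 12 + (\<Sum>m. ln (1 - exp (- 2 * pi * y) ^ Suc m)))))"
      unfolding ln_euler_product_transformation[OF y(1)] aux ..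
    also have "\<dots> = csqrt (- \<i> * z) * eta z"
      unfolding c unfolding y(2) eta_imaginary[OF y(1)] by (simp add: exp_add)
    finally show "f z = 0" by (simp add: f_def)
  qed
  thus ?thesis by (simp add: f_def)
qed

text \<open>The factor gained by \<open>eta\<close> is a 24th root of unity, invisible to the
  modulus.\<close>

lemma eta_plus_one_norm: "norm (eta (t + 1)) = norm (eta t)"
proof -
  have "exp (2 * pi * \<i> * (t + 1)) = exp (2 * pi * \<i> * t)"
    by (simp add: ring_distribs exp_add)
  thus ?thesis unfolding eta_def by (simp add: norm_mult)
qed

text \<open>Expresses the value at \<open>- q\<close> through the nomes \<open>q\<close>,
  \<open>q\<^sup>2\<close> and \<open>q ^ 4\<close>, that is, through \<open>eta\<close> at
  \<open>t\<close>, \<open>2 t\<close> and \<open>4 t\<close>.\<close>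

lemma euler_fun_minus:
  assumes "norm q < 1"
  shows "euler_fun (- q) * euler_fun q * euler_fun (q ^ 4) = euler_fun (q\<^sup>2) ^ 3"
proof -
  define P where "P N q = (\<Prod>n<N. 1 - q ^ Suc n)" for N and q :: complex
  \<comment> \<open>The lengths \<open>N\<close> and \<open>2 N\<close> make the identity exact for
    finite products: one step adds an odd power \<open>a\<close> and an even power \<open>b\<close>,
    and \<open>(1 + a) (1 - a) = 1 - a\<^sup>2\<close>.\<close>
  have "P (2 * N) (- q) * P (2 * N) q * P N (q ^ 4) = (P N (q\<^sup>2))\<^sup>2 * P (2 * N) (q\<^sup>2)" for N
  proof (induction N)
    case (Suc N)
    define a where "a = q ^ (2 * N + 1)"
    define b where "b = q ^ (2 * N + 2)"
    have 1: "P (2 * Suc N) (- q) = P (2 * N) (- q) * ((1 + a) * (1 - b))"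
      unfolding P_def a_def b_def by (simp add: power_minus_odd)
    have 2: "P (2 * Suc N) q = P (2 * N) q * ((1 - a) * (1 - b))"
      unfolding P_def a_def b_def by simp
    have "(q ^ 4) ^ Suc N = b\<^sup>2" "(q\<^sup>2) ^ Suc N = b" "(q\<^sup>2) ^ (2 * N + 1) = a\<^sup>2" "(q\<^sup>2) ^ (2 * N + 2) = b\<^sup>2"
      unfolding a_def b_def power_mult[symmetric] by (rule arg_cong[where f = "\<lambda>n. q ^ n"], simp)+
    note pw = this
    have 3: "P (Suc N) (q ^ 4) = P N (q ^ 4) * (1 - b\<^sup>2)"
      unfolding P_def pw(1)[symmetric] by simp
    have 4: "P (Suc N) (q\<^sup>2) = P N (q\<^sup>2) * (1 - b)"
      unfolding P_def pw(2)[symmetric] by simp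
    have 5: "P (2 * Suc N) (q\<^sup>2) = P (2 * N) (q\<^sup>2) * ((1 - a\<^sup>2) * (1 - b\<^sup>2))"
      unfolding P_def pw(3,4)[symmetric] by simp
    have "P (2 * Suc N) (- q) * P (2 * Suc N) q * P (Suc N) (q ^ 4) =
       (P (2 * N) (- q) * P (2 * N) q * P N (q ^ 4)) * ((1 - a\<^sup>2) * (1 - b)\<^sup>2 * (1 - b\<^sup>2))"
      unfolding 1 2 3 by algebra
    also have "\<dots> = (P (Suc N) (q\<^sup>2))\<^sup>2 * P (2 * Suc N) (q\<^sup>2)"
      unfolding Suc.IH 4 5 by algebra
    finally show ?case .
  qed (simp add: P_def)
  moreover have lim: "(\<lambda>N. P N x) \<longlonglongrightarrow> euler_fun x" if "norm x < 1" for x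
    unfolding P_def by (rule LIMSEQ_euler_fun[OF that])
  have lim2: "(\<lambda>N. P (2 * N) x) \<longlonglongrightarrow> euler_fun x" if "norm x < 1" for x
    by (rule LIMSEQ_subseq_LIMSEQ[OF lim[OF that], unfolded comp_def]) (simp add: strict_mono_def)
  have q2: "norm (q\<^sup>2) < 1" and q4: "norm (q ^ 4) < 1"
    using assms by (auto simp: norm_power power_less_one_iff)
  have "(\<lambda>N. P (2 * N) (- q) * P (2 * N) q * P N (q ^ 4)) \<longlonglongrightarrow> euler_fun (- q) * euler_fun q * euler_fun (q ^ 4)"
    by (intro tendsto_intros lim lim2) (use assms q4 in auto)
  moreover have "(\<lambda>N. (P N (q\<^sup>2))\<^sup>2 * P (2 * N) (q\<^sup>2)) \<longlonglongrightarrow> (euler_fun (q\<^sup>2))\<^sup>2 * euler_fun (q\<^sup>2)"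
    by (intro tendsto_intros lim lim2 q2)
  ultimately have "euler_fun (- q) * euler_fun q * euler_fun (q ^ 4) = (euler_fun (q\<^sup>2))\<^sup>2 * euler_fun (q\<^sup>2)"
    using LIMSEQ_unique by auto
  thus ?thesis by (simp add: power2_eq_square power3_eq_cube)
qed

section \<open>The generating function of the crank parity\<close>

text \<open>Induction on \<open>A\<close>: a multiset over \<open>insert a A\<close> is a
  multiplicity of \<open>a\<close> together with a multiset over \<open>A\<close>, and the
  multiplicity contributes a geometric series. The version with norms is carried along because it
  supplies the absolute summability of the complex double sum.\<close>

lemma has_sum_multisets_finite_support:
  fixes w :: "nat \<Rightarrow> complex"
  assumes "finite A" "\<And>k. k \<in> A \<Longrightarrow> norm (w k) < 1"
  shows "((\<lambda>L. \<Prod>k\<in>#L. w k) has_sum (\<Prod>k\<in>A. 1 / (1 - w k))) {L. set_mset L \<subseteq> A} \<and>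
         ((\<lambda>L. \<Prod>k\<in>#L. norm (w k)) has_sum (\<Prod>k\<in>A. 1 / (1 - norm (w k)))) {L. set_mset L \<subseteq> A}"
  using assms
proof (induction A rule: finite_induct)
  case empty
  have "{L. set_mset L \<subseteq> ({} :: nat set)} = {{#}}" by auto
  thus ?case by (simp add: has_sum_finite_iff)
next
  case (insert a A)
  define X where "X = {L. set_mset L \<subseteq> A}"
  define h where "h = (\<lambda>(j :: nat, L). replicate_mset j a + L)"
  have bij: "bij_betw h (UNIV \<times> X) {L. set_mset L \<subseteq> insert a A}"
  proof (rule bij_betwI[where g = "\<lambda>L. (count L a, filter_mset (\<lambda>k. k \<noteq> a) L)"])
    fix p :: "nat \<times> nat multiset" assume "p \<in> UNIV \<times> X"
    then obtain j L where p: "p = (j, L)" "set_mset L \<subseteq> A" by (auto simp: X_def)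
    have "count L a = 0" using p insert.hyps by (auto simp: not_in_iff[symmetric])
    moreover have "filter_mset (\<lambda>k. k \<noteq> a) L = L"
      using p insert.hyps by (auto simp: filter_mset_eq_conv)
    moreover have "filter_mset (\<lambda>k. k \<noteq> a) (replicate_mset j a) = {#}"
      by (simp add: filter_mset_eq_conv)
    ultimately show "(count (h p) a, filter_mset (\<lambda>k. k \<noteq> a) (h p)) = p" by (simp add: p h_def)
  next
    fix L assume "L \<in> {L. set_mset L \<subseteq> insert a A}"
    show "h (count L a, filter_mset (\<lambda>k. k \<noteq> a) L) = L"
      by (rule multiset_eqI) (auto simp: h_def)
  qed (auto simp: h_def X_def split: if_splits)
  have wa: "norm (w a) < 1" using insert.prems by simp
  have IH: "((\<lambda>L. \<Prod>k\<in>#L. w k) has_sum (\<Prod>k\<in>A. 1 / (1 - w k))) X"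
     "((\<lambda>L. \<Prod>k\<in>#L. norm (w k)) has_sum (\<Prod>k\<in>A. 1 / (1 - norm (w k)))) X"
    using insert.IH insert.prems unfolding X_def by auto
  have geoC: "((\<lambda>j. w a ^ j) has_sum (1 / (1 - w a))) UNIV"
    by (rule norm_summable_imp_has_sum) (use wa in \<open>auto simp: norm_power intro!: summable_geometric geometric_sums\<close>)
  have geoR: "((\<lambda>j. norm (w a) ^ j) has_sum (1 / (1 - norm (w a)))) UNIV"
    by (rule norm_summable_imp_has_sum) (use wa in \<open>auto intro!: summable_geometric geometric_sums\<close>)
  have nn: "(\<Prod>k\<in>#L. norm (w k)) \<ge> 0" for L by (induction L) auto
  have nW: "norm (\<Prod>k\<in>#L. w k) = (\<Prod>k\<in>#L. norm (w k))" for L by (induction L) (auto simp: norm_mult)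
  have innR: "((\<lambda>L. (\<lambda>(j, L). norm (w a) ^ j * (\<Prod>k\<in>#L. norm (w k))) (j, L)) has_sum
       (norm (w a) ^ j * (\<Prod>k\<in>A. 1 / (1 - norm (w k))))) X" for j
    using has_sum_cmult_right[OF IH(2)] by simp
  have outR: "((\<lambda>j. norm (w a) ^ j * (\<Prod>k\<in>A. 1 / (1 - norm (w k)))) has_sum (1 / (1 - norm (w a)) * (\<Prod>k\<in>A. 1 / (1 - norm (w k))))) UNIV"
    using has_sum_cmult_left[OF geoR] by simp
  have smR: "(\<lambda>(j, L). norm (w a) ^ j * (\<Prod>k\<in>#L. norm (w k))) summable_on (UNIV \<times> X)"
    by (rule summable_on_SigmaI[OF innR has_sum_imp_summable[OF outR]]) (auto intro!: mult_nonneg_nonneg nn)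
  have resR: "((\<lambda>(j, L). norm (w a) ^ j * (\<Prod>k\<in>#L. norm (w k))) has_sum (1 / (1 - norm (w a)) * (\<Prod>k\<in>A. 1 / (1 - norm (w k))))) (UNIV \<times> X)"
    by (rule has_sum_SigmaI[OF innR outR smR])
  have innC: "((\<lambda>L. (\<lambda>(j, L). w a ^ j * (\<Prod>k\<in>#L. w k)) (j, L)) has_sum
       (w a ^ j * (\<Prod>k\<in>A. 1 / (1 - w k)))) X" for j
    using has_sum_cmult_right[OF IH(1)] by simp
  have outC: "((\<lambda>j. w a ^ j * (\<Prod>k\<in>A. 1 / (1 - w k))) has_sum (1 / (1 - w a) * (\<Prod>k\<in>A. 1 / (1 - w k)))) UNIV"
    using has_sum_cmult_left[OF geoC] by simp
  have smC: "(\<lambda>(j, L). w a ^ j * (\<Prod>k\<in>#L. w k)) summable_on (UNIV \<times> X)"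
  proof (rule abs_summable_summable)
    show "(\<lambda>p. norm (case p of (j, L) \<Rightarrow> w a ^ j * (\<Prod>k\<in>#L. w k))) summable_on (UNIV \<times> X)"
      using smR by (simp add: case_prod_unfold norm_mult norm_power nW)
  qed
  have resC: "((\<lambda>(j, L). w a ^ j * (\<Prod>k\<in>#L. w k)) has_sum (1 / (1 - w a) * (\<Prod>k\<in>A. 1 / (1 - w k)))) (UNIV \<times> X)"
    by (rule has_sum_SigmaI[OF innC outC smC])
  have "((\<lambda>L. \<Prod>k\<in>#L. w k) has_sum (1 / (1 - w a) * (\<Prod>k\<in>A. 1 / (1 - w k)))) {L. set_mset L \<subseteq> insert a A}"
    using resC unfolding has_sum_reindex_bij_betw[OF bij, symmetric]
    by (simp add: h_def case_prod_unfold image_replicate_mset)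
  moreover have "((\<lambda>L. \<Prod>k\<in>#L. norm (w k)) has_sum (1 / (1 - norm (w a)) * (\<Prod>k\<in>A. 1 / (1 - norm (w k))))) {L. set_mset L \<subseteq> insert a A}"
    using resR unfolding has_sum_reindex_bij_betw[OF bij, symmetric]
    by (simp add: h_def case_prod_unfold image_replicate_mset)
  ultimately show ?case using insert.hyps by simp
qed

text \<open>Exhaustion of an infinite \<open>A\<close> by its parts up to \<open>N\<close>: every
  finite set of multisets lies in one stage \<open>X N\<close>. The bound \<open>B\<close> on the
  absolute sums of all stages gives summability, and the limit of the stage values is the
  total.\<close>

lemma has_sum_multisets_supported:
  fixes w :: "nat \<Rightarrow> complex" and B :: real
  assumes "\<And>k. k \<in> A \<Longrightarrow> norm (w k) < 1"
    and B: "\<And>N. (\<Prod>k\<in>A \<inter> {..N}. 1 / (1 - norm (w k))) \<le> B"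
    and lim: "(\<lambda>N. \<Prod>k\<in>A \<inter> {..N}. 1 / (1 - w k)) \<longlonglongrightarrow> P"
  shows "(\<lambda>L. norm (\<Prod>k\<in>#L. w k)) summable_on {L. set_mset L \<subseteq> A}"
    and "((\<lambda>L. \<Prod>k\<in>#L. w k) has_sum P) {L. set_mset L \<subseteq> A}"
proof -
  define X where "X N = {L. set_mset L \<subseteq> A \<inter> {..N}}" for N
  define XX where "XX = {L. set_mset L \<subseteq> A}"
  define W where "W L = (\<Prod>k\<in>#L. w k)" for L
  have nW: "norm (W L) = (\<Prod>k\<in>#L. norm (w k))" for L unfolding W_def by (induction L) (auto simp: norm_mult)
  have hs: "(W has_sum (\<Prod>k\<in>A \<inter> {..N}. 1 / (1 - w k))) (X N)"
     "((\<lambda>L. norm (W L)) has_sum (\<Prod>k\<in>A \<inter> {..N}. 1 / (1 - norm (w k)))) (X N)" for N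
    using has_sum_multisets_finite_support[of "A \<inter> {..N}" w] assms(1) unfolding X_def nW by (auto simp: W_def[abs_def])
  have XN: "\<exists>N. \<forall>M\<ge>N. F \<subseteq> X M" if F: "finite F" "F \<subseteq> XX" for F
  proof -
    have "finite (\<Union>L\<in>F. set_mset L)" using F by auto
    then obtain N where "(\<Union>L\<in>F. set_mset L) \<subseteq> {..N}" by (meson finite_nat_iff_bounded_le)
    hence "set_mset L \<subseteq> {..M}" if "L \<in> F" "M \<ge> N" for L M
      using that by (meson UN_upper atMost_subset_iff subset_trans)
    thus ?thesis using F(2) unfolding X_def XX_def by blast
  qed
  have sm: "(\<lambda>L. norm (W L)) summable_on XX"
  proof (rule nonneg_bdd_above_summable_on)
    show "bdd_above (sum (\<lambda>L. norm (W L)) ` {F. F \<subseteq> XX \<and> finite F})"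
    proof (rule bdd_aboveI2[of _ _ B])
      fix F assume "F \<in> {F. F \<subseteq> XX \<and> finite F}"
      then obtain N where "finite F" "F \<subseteq> X N" using XN[of F] by auto
      hence "sum (\<lambda>L. norm (W L)) F \<le> (\<Prod>k\<in>A \<inter> {..N}. 1 / (1 - norm (w k)))"
        by (intro finite_sum_le_has_sum[OF hs(2)]) auto
      also have "\<dots> \<le> B" by (rule B)
      finally show "sum (\<lambda>L. norm (W L)) F \<le> B" .
    qed
  qed auto
  thus "(\<lambda>L. norm (\<Prod>k\<in>#L. w k)) summable_on {L. set_mset L \<subseteq> A}" by (simp add: W_def XX_def)
  from sm have "W summable_on XX" by (rule abs_summable_summable)
  then obtain S where S: "(W has_sum S) XX" by (auto simp: summable_on_def)
  have "(\<lambda>N. \<Prod>k\<in>A \<inter> {..N}. 1 / (1 - w k)) \<longlonglongrightarrow> S"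
  proof (rule LIMSEQ_I)
    fix e :: real assume e: "e > 0"
    hence "eventually (\<lambda>F. dist (sum W F) S < e / 2) (finite_subsets_at_top XX)"
      using S unfolding has_sum_def by (intro tendstoD) auto
    then obtain F0 where "finite F0 \<and> F0 \<subseteq> XX \<and> (\<forall>F. finite F \<and> F0 \<subseteq> F \<and> F \<subseteq> XX \<longrightarrow> dist (sum W F) S < e / 2)"
      unfolding eventually_finite_subsets_at_top ..
    hence F0: "finite F0" "F0 \<subseteq> XX"
      "\<And>F. finite F \<Longrightarrow> F0 \<subseteq> F \<Longrightarrow> F \<subseteq> XX \<Longrightarrow> dist (sum W F) S < e / 2"
      by simp_all
    from XN[OF F0(1,2)] obtain N where N: "\<forall>M\<ge>N. F0 \<subseteq> X M" ..
    show "\<exists>no. \<forall>n\<ge>no. norm ((\<Prod>k\<in>A \<inter> {..n}. 1 / (1 - w k)) - S) < e"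
    proof (intro exI allI impI)
      fix M assume M: "M \<ge> N"
      \<comment> \<open>The stage sum is a limit of finite sums over sets between \<open>F0\<close>
        and \<open>X M\<close>, all within \<open>e / 2\<close> of \<open>S\<close>.\<close>
      have "norm ((\<Prod>k\<in>A \<inter> {..M}. 1 / (1 - w k)) - S) \<le> e / 2"
      proof (rule tendsto_upperbound)
        show "((\<lambda>F. norm (sum W F - S)) \<longlongrightarrow> norm ((\<Prod>k\<in>A \<inter> {..M}. 1 / (1 - w k)) - S)) (finite_subsets_at_top (X M))"
          using hs(1)[of M] unfolding has_sum_def by (intro tendsto_intros)
        show "eventually (\<lambda>F. norm (sum W F - S) \<le> e / 2) (finite_subsets_at_top (X M))"
          unfolding eventually_finite_subsets_at_top
        proof (intro exI[of _ F0] conjI allI impI)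
          fix F assume "finite F \<and> F0 \<subseteq> F \<and> F \<subseteq> X M"
          moreover have "X M \<subseteq> XX" by (auto simp: X_def XX_def)
          ultimately have "dist (sum W F) S < e / 2" by (intro F0(3)) (blast+)
          thus "norm (sum W F - S) \<le> e / 2" by (simp add: dist_norm)
        qed (use F0(1) N[rule_format, OF M] in auto)
      qed simp
      thus "norm ((\<Prod>k\<in>A \<inter> {..M}. 1 / (1 - w k)) - S) < e" using e by simp
    qed
  qed
  hence "S = P" using lim LIMSEQ_unique by blast
  thus "((\<lambda>L. \<Prod>k\<in>#L. w k) has_sum P) {L. set_mset L \<subseteq> A}" using S by (simp add: W_def[abs_def] XX_def)
qed

text \<open>The instances \<open>t = 0\<close> and \<open>t = - q\<close> of the q-binomial theorem, with \<open>s = - t / q\<close>.\<close>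

lemma q_binomial_functional_equation:
  fixes q s :: complex
  assumes q: "norm q < 1"
    and bd: "\<And>j. norm (\<Prod>k=1..j. (1 + s * q ^ k) / (1 - q ^ k)) \<le> K"
  defines "a \<equiv> \<lambda>j. (\<Prod>k=1..j. (1 + s * q ^ k) / (1 - q ^ k))"
  assumes lim: "(\<lambda>N. \<Prod>i<N. (1 - s * q ^ (i + 2)) / (1 + q ^ (i + 1))) \<longlonglongrightarrow> P"
  shows "(\<lambda>j. a j * (- q) ^ j) sums P"
proof -
  have sm: "summable (\<lambda>j. a j * x ^ j)" if "norm x < 1" for x
  proof (rule summable_comparison_test')
    show "summable (\<lambda>j. K * norm x ^ j)" using that by (intro summable_mult summable_geometric) auto
    show "norm (a j * x ^ j) \<le> K * norm x ^ j" for j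
      using bd[of j] by (auto simp: a_def norm_mult norm_power intro!: mult_right_mono)
  qed
  define A where "A x = (\<Sum>j. a j * x ^ j)" for x
  have A: "(\<lambda>j. a j * x ^ j) sums A x" if "norm x < 1" for x
    unfolding A_def using sm[OF that] by (rule summable_sums)
  have a0: "a 0 = 1" by (simp add: a_def)
  have aS: "a (Suc j) * (1 - q ^ Suc j) = a j * (1 + s * q ^ Suc j)" for j
  proof -
    have "1 - q ^ Suc j \<noteq> 0" using power_Suc_neq_1[OF q, of j] by (metis eq_iff_diff_eq_0)
    thus ?thesis by (simp add: a_def del: power_Suc)
  qed
  \<comment> \<open>The recurrence \<open>aS\<close> of the coefficients, read as a relation between
    \<open>A x\<close> and \<open>A (q x)\<close>.\<close>
  have fe: "(1 - x) * A x = (1 + s * q * x) * A (q * x)" if x: "norm x < 1" for x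
  proof -
    have qx: "norm (q * x) < 1" using mult_strict_mono[of "norm q" 1 "norm x" 1] q x by (simp add: norm_mult)
    have "(\<lambda>j. a j * x ^ j - a j * (q * x) ^ j) sums (A x - A (q * x))"
      by (intro sums_diff A x qx)
    hence "(\<lambda>j. a (Suc j) * x ^ Suc j - a (Suc j) * (q * x) ^ Suc j) sums (A x - A (q * x))"
      by (subst sums_Suc_iff) simp
    also have "(\<lambda>j. a (Suc j) * x ^ Suc j - a (Suc j) * (q * x) ^ Suc j) =
               (\<lambda>j. x * (a j * x ^ j) + s * q * x * (a j * (q * x) ^ j))"
    proof
      fix j
      have "a (Suc j) * x ^ Suc j - a (Suc j) * (q * x) ^ Suc j = (a (Suc j) * (1 - q ^ Suc j)) * x ^ Suc j"
        by (simp add: power_mult_distrib algebra_simps)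
      also have "\<dots> = x * (a j * x ^ j) + s * q * x * (a j * (q * x) ^ j)"
        unfolding aS by (simp add: power_mult_distrib algebra_simps)
      finally show "a (Suc j) * x ^ Suc j - a (Suc j) * (q * x) ^ Suc j = x * (a j * x ^ j) + s * q * x * (a j * (q * x) ^ j)" .
    qed
    finally have "(\<lambda>j. x * (a j * x ^ j) + s * q * x * (a j * (q * x) ^ j)) sums (A x - A (q * x))" .
    moreover have "(\<lambda>j. x * (a j * x ^ j) + s * q * x * (a j * (q * x) ^ j)) sums (x * A x + s * q * x * A (q * x))"
      by (intro sums_add sums_mult A x qx)
    ultimately have "A x - A (q * x) = x * A x + s * q * x * A (q * x)" by (rule sums_unique2)
    thus ?thesis by (simp add: algebra_simps)
  qed
  have nq: "norm (- (q ^ Suc N)) < 1" for N using q by (simp add: norm_power power_less_one_iff del: power_Suc)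
  \<comment> \<open>The functional equation at \<open>x = - (q ^ (i + 1))\<close> for successive
    \<open>i\<close>; the arguments shrink to 0, where \<open>A\<close> is continuous with value
    1.\<close>
  have iter: "A (- q) = (\<Prod>i<N. (1 - s * q ^ (i + 2)) / (1 + q ^ (i + 1))) * A (- (q ^ Suc N))" for N
  proof (induction N)
    case (Suc N)
    have div: "v = s / u * w" if "u \<noteq> 0" "u * v = s * w" for u v s w :: complex
      using that by (simp add: field_simps)
    have nz: "1 + q ^ Suc N \<noteq> 0"
    proof
      assume "1 + q ^ Suc N = 0"
      hence "- (q ^ Suc N) = 1" by (metis add.inverse_unique minus_minus)
      hence "norm (- (q ^ Suc N)) = 1" by (simp only: norm_one)
      thus False using nq[of N] by simp
    qed
    have "(1 + q ^ Suc N) * A (- (q ^ Suc N)) = (1 - s * q ^ (N + 2)) * A (- (q ^ Suc (Suc N)))"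
      using fe[OF nq[of N]] by (simp add: algebra_simps)
    hence "A (- (q ^ Suc N)) = (1 - s * q ^ (N + 2)) / (1 + q ^ (N + 1)) * A (- (q ^ Suc (Suc N)))"
      using div[OF nz] by (simp only: Suc_eq_plus1)
    thus ?case unfolding Suc.IH by (simp only: prod.lessThan_Suc mult.assoc)
  qed simp
  have cA: "isCont A 0"
    unfolding A_def using sm[of "1/2"] by (intro isCont_powser[of _ "1/2"]) auto
  have "(\<lambda>N. - (q ^ Suc N)) \<longlonglongrightarrow> - 0"
    using LIMSEQ_Suc[OF LIMSEQ_power_zero[OF q]] by (rule tendsto_minus)
  hence "(\<lambda>N. - (q ^ Suc N)) \<longlonglongrightarrow> 0" by (simp only: minus_zero)
  hence "(\<lambda>N. A (- (q ^ Suc N))) \<longlonglongrightarrow> A 0"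
    by (rule isCont_tendsto_compose[OF cA])
  moreover have "A 0 = 1" unfolding A_def using powser_zero[of a] a0 by simp
  ultimately have "(\<lambda>N. (\<Prod>i<N. (1 - s * q ^ (i + 2)) / (1 + q ^ (i + 1))) * A (- (q ^ Suc N))) \<longlonglongrightarrow> P * 1"
    using lim by (intro tendsto_mult) (simp_all only:)
  hence "(\<lambda>N. A (- q)) \<longlonglongrightarrow> P" unfolding iter[symmetric] by simp
  hence "A (- q) = P" by (simp add: LIMSEQ_const_iff)
  thus ?thesis using A[of "- q"] q by simp
qed

text \<open>The power of \<open>- 1\<close> with exponent \<open>crank L\<close>; the crank may be
  negative, so its parity is tested instead.\<close>

definition crank_sign :: "nat multiset \<Rightarrow> complex" where
  "crank_sign L = (if even (crank L) then 1 else - 1)"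

lemma sum_crank_sign: "(\<Sum>L\<in>partitions n. crank_sign L) = of_real (real (M0 n) - real (M1 n))"
proof -
  have "(\<Sum>L\<in>partitions n. crank_sign L) =
      (\<Sum>L | L \<in> partitions n \<and> even (crank L). 1) + (\<Sum>L | L \<in> partitions n \<and> odd (crank L). - 1)"
  proof -
    have "partitions n = {L \<in> partitions n. even (crank L)} \<union> {L \<in> partitions n. odd (crank L)}" by auto
    hence "(\<Sum>L\<in>partitions n. crank_sign L) = (\<Sum>L\<in>{L \<in> partitions n. even (crank L)} \<union> {L \<in> partitions n. odd (crank L)}. crank_sign L)"
      by simp
    also have "\<dots> = (\<Sum>L | L \<in> partitions n \<and> even (crank L). crank_sign L) + (\<Sum>L | L \<in> partitions n \<and> odd (crank L). crank_sign L)"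
      by (rule sum.union_disjoint) (auto simp: finite_partitions)
    also have "(\<Sum>L | L \<in> partitions n \<and> even (crank L). crank_sign L) = (\<Sum>L | L \<in> partitions n \<and> even (crank L). 1)"
      by (rule sum.cong) (auto simp: crank_sign_def)
    also have "(\<Sum>L | L \<in> partitions n \<and> odd (crank L). crank_sign L) = (\<Sum>L | L \<in> partitions n \<and> odd (crank L). - 1)"
      by (rule sum.cong) (auto simp: crank_sign_def)
    finally show ?thesis .
  qed
  thus ?thesis by (simp add: M0_def M1_def)
qed

lemma prod_mset_power_eq: "(\<Prod>k\<in>#L. q ^ k) = (q :: complex) ^ sum_mset L"
  by (induction L) (auto simp: power_add)

text \<open>Modulo 2 the crank is the sum of the number of ones and the number of parts above
  \<open>j\<close>. Its sign splits into one factor \<open>- 1\<close> for each of the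
  \<open>j\<close> ones, which turns \<open>q ^ j\<close> into \<open>(- q) ^ j\<close>, and one for
  each part above \<open>j\<close>; the signed weight is thus multiplicative over the parts.\<close>

lemma crank_sign_with_ones:
  assumes "j \<ge> 1" "set_mset L \<subseteq> {2..}"
  shows "crank_sign (replicate_mset j 1 + L) * q ^ sum_mset (replicate_mset j 1 + L) =
    (- q) ^ j * (\<Prod>k\<in>#L. if k > j then - (q ^ k) else q ^ k)"
proof -
  define K where "K = replicate_mset j 1 + L"
  define s where "s = size (filter_mset (\<lambda>k. k > j) L)"
  have "count L 1 = 0" using assms(2) by (auto simp: count_eq_zero_iff)
  hence ones: "ones K = j" by (simp add: K_def ones_def)
  have "filter_mset (\<lambda>k. k > j) (replicate_mset j 1) = {#}" using assms(1)
    by (auto simp: multiset_eq_iff)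
  hence "num_larger K = s" unfolding num_larger_def ones by (simp add: K_def s_def)
  moreover have "K \<noteq> {#}" using assms(1) by (cases j) (auto simp: K_def)
  ultimately have "crank K = int s - int j" using ones assms(1) by (simp add: crank_def)
  hence "crank_sign K = (- 1) ^ (s + j)" by (simp add: crank_sign_def)
  moreover have "(\<Prod>k\<in>#L. if k > j then - (q ^ k) else q ^ k) = (- 1) ^ s * q ^ sum_mset L"
    unfolding s_def by (induction L) (auto simp: power_add)
  moreover have "sum_mset K = j + sum_mset L" by (simp add: K_def)
  ultimately show ?thesis unfolding K_def[symmetric]
    by (simp add: power_add power_minus[of q])
qed

text \<open>The crank is the largest part \<open>m\<close> itself, so the whole sign sits in that
  part; \<open>L\<close> holds the others.\<close>

lemma crank_sign_without_ones:
  assumes "m \<ge> 2" "set_mset L \<subseteq> {2..m}"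
  shows "crank_sign (add_mset m L) * q ^ sum_mset (add_mset m L) = (- q) ^ m * (\<Prod>k\<in>#L. q ^ k)"
proof -
  have "count L 1 = 0" using assms(2) by (auto simp: count_eq_zero_iff)
  hence "ones (add_mset m L) = 0" using assms(1) by (simp add: ones_def)
  moreover have "Max (insert m (set_mset L)) = m" using assms by (intro Max_eqI) auto
  ultimately have "crank (add_mset m L) = int m" by (simp add: crank_def)
  hence "crank_sign (add_mset m L) = (- 1) ^ m" by (simp add: crank_sign_def)
  thus ?thesis by (simp add: power_add power_minus[of q] prod_mset_power_eq)
qed

section \<open>Sums of crank signs over partitions, sorted by the ones and by the largest
  part\<close>

lemma
  assumes q: "norm q < 1"
  shows LIMSEQ_prod_1_minus: "(\<lambda>N. \<Prod>k=1..N. 1 - q ^ k) \<longlonglongrightarrow> euler_fun q"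
    and LIMSEQ_prod_1_plus: "(\<lambda>N. \<Prod>k=1..N. 1 + q ^ k) \<longlonglongrightarrow> euler_fun (q\<^sup>2) / euler_fun q"
proof -
  have lim: "(\<lambda>N. \<Prod>k=1..N. 1 - q ^ k) \<longlonglongrightarrow> euler_fun q" if "norm q < 1" for q
    using LIMSEQ_euler_fun[OF that] by (simp add: prod.atLeast1_atMost_eq)
  show "(\<lambda>N. \<Prod>k=1..N. 1 - q ^ k) \<longlonglongrightarrow> euler_fun q" by (rule lim[OF q])
  have q2: "norm (q\<^sup>2) < 1" using q by (simp add: norm_power power_less_one_iff)
  have "(\<lambda>N. (\<Prod>k=1..N. 1 - (q\<^sup>2) ^ k) / (\<Prod>k=1..N. 1 - q ^ k)) \<longlonglongrightarrow> euler_fun (q\<^sup>2) / euler_fun q"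
    by (intro tendsto_divide lim q q2 euler_fun_nonzero)
  moreover have "(\<Prod>k=1..N. 1 - (q\<^sup>2) ^ k) / (\<Prod>k=1..N. 1 - q ^ k) = (\<Prod>k=1..N. 1 + q ^ k)" for N
    unfolding prod_dividef[symmetric]
  proof (rule prod.cong[OF refl])
    fix k assume "k \<in> {1..N}"
    hence "1 - q ^ k \<noteq> 0" using power_Suc_neq_1[OF q, of "k - 1"] by auto
    moreover have "1 - (q\<^sup>2) ^ k = (1 + q ^ k) * (1 - q ^ k)"
      by (simp add: power_mult[symmetric] mult.commute[of 2] power_mult power2_eq_square algebra_simps)
    ultimately show "(1 - (q\<^sup>2) ^ k) / (1 - q ^ k) = 1 + q ^ k" by simp
  qed
  ultimately show "(\<lambda>N. \<Prod>k=1..N. 1 + q ^ k) \<longlonglongrightarrow> euler_fun (q\<^sup>2) / euler_fun q" by simp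
qed

lemma partition_product_bounded:
  fixes r :: real
  assumes "0 \<le> r" "r < 1"
  obtains B where "\<And>N A. A \<subseteq> {1..} \<Longrightarrow> (\<Prod>k\<in>A \<inter> {..N}. 1 / (1 - r ^ k)) \<le> B"
proof -
  have nr: "norm (complex_of_real r) < 1" using assms by simp
  have "(\<lambda>N. inverse (\<Prod>k=1..N. 1 - complex_of_real r ^ k)) \<longlonglongrightarrow> inverse (euler_fun r)"
    by (intro tendsto_inverse LIMSEQ_prod_1_minus euler_fun_nonzero nr)
  hence "Bseq (\<lambda>N. inverse (\<Prod>k=1..N. 1 - complex_of_real r ^ k))" by (rule convergent_imp_Bseq[OF convergentI])
  then obtain B where B: "\<And>N. norm (inverse (\<Prod>k=1..N. 1 - complex_of_real r ^ k)) \<le> B" by (auto simp: Bseq_def)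
  have lt: "r ^ k < 1" if "k \<ge> 1" for k using assms that by (subst power_less_one_iff) auto
  have "(\<Prod>k\<in>A \<inter> {..N}. 1 / (1 - r ^ k)) \<le> B" if A: "A \<subseteq> {1..}" for N A
  proof -
    have f1: "1 \<le> 1 / (1 - r ^ k)" if "k \<ge> 1" for k using lt[OF that] assms by (simp add: field_simps)
    have "(\<Prod>k\<in>A \<inter> {..N}. 1 / (1 - r ^ k)) \<le> (\<Prod>k\<in>{1..N}. 1 / (1 - r ^ k))"
    proof (rule prod_mono2)
      show "A \<inter> {..N} \<subseteq> {1..N}" using A by auto
      show "1 \<le> 1 / (1 - r ^ b)" if "b \<in> {1..N} - A \<inter> {..N}" for b using that by (intro f1) auto
      show "0 \<le> 1 / (1 - r ^ a)" if "a \<in> A \<inter> {..N}" for a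
        using f1[of a] that A by (metis IntD1 atLeast_iff order.trans subsetD zero_le_one)
    qed auto
    also have "\<dots> = norm (inverse (\<Prod>k=1..N. 1 - complex_of_real r ^ k))"
    proof -
      have "(\<Prod>k=1..N. 1 - complex_of_real r ^ k) = of_real (\<Prod>k=1..N. 1 - r ^ k)" by simp
      moreover have "(\<Prod>k=1..N. 1 - r ^ k) > 0" using lt by (intro prod_pos) auto
      moreover have "(\<Prod>k\<in>{1..N}. 1 / (1 - r ^ k)) = inverse (\<Prod>k=1..N. 1 - r ^ k)"
        by (simp add: prod_dividef inverse_eq_divide)
      ultimately show ?thesis by (simp only: norm_inverse norm_of_real abs_of_pos)
    qed
    also have "\<dots> \<le> B" by (rule B)
    finally show ?thesis .
  qed
  thus ?thesis using that by blast
qed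

lemma has_sum_weighted_partitions:
  fixes q :: complex and w :: "nat \<Rightarrow> complex"
  assumes "norm q < 1" "A \<subseteq> {1..}" "\<And>k. norm (w k) = norm q ^ k"
    and "(\<lambda>N. \<Prod>k\<in>A \<inter> {..N}. 1 / (1 - w k)) \<longlonglongrightarrow> P"
  shows "(\<lambda>L. norm (\<Prod>k\<in>#L. w k)) summable_on {L. set_mset L \<subseteq> A}"
    and "((\<lambda>L. \<Prod>k\<in>#L. w k) has_sum P) {L. set_mset L \<subseteq> A}"
proof -
  obtain B where B: "\<And>N A. A \<subseteq> {1..} \<Longrightarrow> (\<Prod>k\<in>A \<inter> {..N}. 1 / (1 - norm q ^ k)) \<le> B"
    using partition_product_bounded[of "norm q"] assms(1) by auto
  have lt: "norm (w k) < 1" if "k \<in> A" for k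
    using assms(1,2) that unfolding assms(3) by (subst power_less_one_iff) auto
  have B': "(\<Prod>k\<in>A \<inter> {..N}. 1 / (1 - norm (w k))) \<le> B" for N
    unfolding assms(3) by (rule B[OF assms(2)])
  show "(\<lambda>L. norm (\<Prod>k\<in>#L. w k)) summable_on {L. set_mset L \<subseteq> A}"
       "((\<lambda>L. \<Prod>k\<in>#L. w k) has_sum P) {L. set_mset L \<subseteq> A}"
    by (rule has_sum_multisets_supported[OF lt B' assms(4)]; assumption)+
qed

text \<open>Here \<open>m\<close> is the product of all \<open>1 + q ^ k\<close>. A part
  \<open>k \<ge> 2\<close> has the factor \<open>1 / (1 - q ^ k)\<close> up to \<open>j\<close> and
  \<open>1 / (1 + q ^ k)\<close> beyond. Completing the second product to all \<open>k\<close>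
  leaves the coefficients of the q-binomial series with \<open>s = 1\<close>; the factor
  \<open>1 - q\<close> removes the part 1.\<close>

lemma has_sum_crank_sign_with_ones:
  fixes q :: complex
  assumes q: "norm q < 1" and j: "j \<ge> 1"
  defines "m \<equiv> euler_fun (q\<^sup>2) / euler_fun q"
  shows "((\<lambda>L. crank_sign (replicate_mset j 1 + L) * q ^ sum_mset (replicate_mset j 1 + L)) has_sum
     ((1 - q) / m * ((\<Prod>k=1..j. (1 + 1 * q ^ k) / (1 - q ^ k)) * (- q) ^ j))) {L. set_mset L \<subseteq> {2..}}"
proof -
  define w where "w k = (if k > j then - (q ^ k) else q ^ k)" for k
  define a where "a = (\<Prod>k=1..j. (1 + 1 * q ^ k) / (1 - q ^ k))"
  have q2: "norm (q\<^sup>2) < 1" using q by (simp add: norm_power power_less_one_iff)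
  have m0: "m \<noteq> 0" using euler_fun_nonzero[OF q] euler_fun_nonzero[OF q2] by (simp add: m_def)
  have nz: "1 - q ^ k \<noteq> 0" "1 + q ^ k \<noteq> 0" if "k \<ge> 1" for k
  proof -
    have "norm (q ^ k) < 1" using q that by (simp add: norm_power power_less_one_iff)
    thus "1 - q ^ k \<noteq> 0" "1 + q ^ k \<noteq> 0" by (auto simp: add_eq_0_iff)
  qed
  have eq: "(\<Prod>k\<in>{2..} \<inter> {..N}. 1 / (1 - w k)) = (1 - q) * a * inverse (\<Prod>k=1..N. 1 + q ^ k)" if N: "N \<ge> j" for N
  proof -
    have "{1..N} = insert 1 ({2..} \<inter> {..N})" using N j by auto
    hence "(\<Prod>k=1..N. 1 / (1 - w k)) = 1 / (1 - w 1) * (\<Prod>k\<in>{2..} \<inter> {..N}. 1 / (1 - w k))" by simp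
    moreover have "w 1 = q" using j by (simp add: w_def)
    ultimately have "(\<Prod>k\<in>{2..} \<inter> {..N}. 1 / (1 - w k)) = (1 - q) * (\<Prod>k=1..N. 1 / (1 - w k))"
      using nz(1)[of 1] by simp
    also have "(\<Prod>k=1..N. 1 / (1 - w k)) = (\<Prod>k=1..N. (if k \<in> {1..j} then (1 + 1 * q ^ k) / (1 - q ^ k) else 1) * inverse (1 + q ^ k))"
      by (rule prod.cong[OF refl]) (use nz in \<open>auto simp: w_def inverse_eq_divide\<close>)
    also have "\<dots> = (\<Prod>k=1..N. if k \<in> {1..j} then (1 + 1 * q ^ k) / (1 - q ^ k) else 1) * inverse (\<Prod>k=1..N. 1 + q ^ k)"
      by (simp only: prod.distrib prod_inversef[unfolded comp_def])
    also have "(\<Prod>k=1..N. if k \<in> {1..j} then (1 + 1 * q ^ k) / (1 - q ^ k) else 1) = (\<Prod>k\<in>{1..N} \<inter> {1..j}. (1 + 1 * q ^ k) / (1 - q ^ k))"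
      by (rule prod.inter_restrict[symmetric]) simp
    also have "{1..N} \<inter> {1..j} = {1..j}" using N by auto
    finally show ?thesis by (simp add: a_def mult.assoc)
  qed
  have lim: "(\<lambda>N. \<Prod>k\<in>{2..} \<inter> {..N}. 1 / (1 - w k)) \<longlonglongrightarrow> (1 - q) * a * inverse m"
  proof (rule Lim_transform_eventually)
    show "(\<lambda>N. (1 - q) * a * inverse (\<Prod>k=1..N. 1 + q ^ k)) \<longlonglongrightarrow> (1 - q) * a * inverse m"
      unfolding m_def by (intro tendsto_intros LIMSEQ_prod_1_plus q) (use m0 in \<open>simp add: m_def\<close>)
    show "eventually (\<lambda>N. (1 - q) * a * inverse (\<Prod>k=1..N. 1 + q ^ k) = (\<Prod>k\<in>{2..} \<inter> {..N}. 1 / (1 - w k))) sequentially"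
      using eq by (intro eventually_sequentiallyI[of j]) simp
  qed
  have "((\<lambda>L. \<Prod>k\<in>#L. w k) has_sum ((1 - q) * a * inverse m)) {L. set_mset L \<subseteq> {2..}}"
    by (rule has_sum_weighted_partitions(2)[OF q _ _ lim]) (auto simp: w_def norm_power)
  from has_sum_cmult_right[OF this, of "(- q) ^ j"]
  have "((\<lambda>L. (- q) ^ j * (\<Prod>k\<in>#L. w k)) has_sum ((1 - q) / m * (a * (- q) ^ j))) {L. set_mset L \<subseteq> {2..}}"
    by (simp add: divide_inverse mult_ac)
  also have "?this \<longleftrightarrow> ((\<lambda>L. crank_sign (replicate_mset j 1 + L) * q ^ sum_mset (replicate_mset j 1 + L)) has_sum
     ((1 - q) / m * (a * (- q) ^ j))) {L. set_mset L \<subseteq> {2..}}"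
    unfolding w_def by (intro has_sum_cong crank_sign_with_ones[symmetric] j) auto
  finally show ?thesis unfolding a_def .
qed

text \<open>The multisets are sorted by their largest part \<open>k\<close>. Removing one copy of it
  leaves parts in \<open>{2..k}\<close>, so the fibres give the q-binomial series with
  \<open>s = 0\<close>, except at \<open>k = 0\<close> and \<open>k = 1\<close>.\<close>

lemma crank_sign_without_ones_value:
  fixes q :: complex
  assumes q: "norm q < 1"
  defines "m \<equiv> euler_fun (q\<^sup>2) / euler_fun q"
  assumes S: "((\<lambda>L. crank_sign L * q ^ sum_mset L) has_sum S) {L. set_mset L \<subseteq> {2..}}"
  shows "S = (1 - q) / m + 2 * q"
proof -
  define X where "X = {L :: nat multiset. set_mset L \<subseteq> {2..}}"
  define g where "g L = crank_sign L * q ^ sum_mset L" for L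
  \<comment> \<open>The empty multiset has no maximum and forms the fibre over 0; the fibre over 1
    is empty, since all parts are at least 2.\<close>
  define D where "D k = {L \<in> X. (if L = {#} then 0 else Max (set_mset L)) = k}" for k
  define b where "b k = (\<Prod>i=1..k. (1 + 0 * q ^ i) / (1 - q ^ i))" for k
  define c where "c k = (if k = 0 then 1 else if k = 1 then 0 else (1 - q) * (b k * (- q) ^ k))" for k
  have q2: "norm (q\<^sup>2) < 1" using q by (simp add: norm_power power_less_one_iff)
  have m0: "m \<noteq> 0" using euler_fun_nonzero[OF q] euler_fun_nonzero[OF q2] by (simp add: m_def)
  have q1: "1 - q \<noteq> 0" using q by auto
  have fib: "(g has_sum c k) (D k)" for k
  proof -
    consider "k = 0" | "k = 1" | "k \<ge> 2" by linarith
    thus ?thesis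
    proof cases
      case 1
      have "D k = {{#}}"
      proof -
        have "False" if "L \<in> X" "L \<noteq> {#}" "Max (set_mset L) = 0" for L
        proof -
          have "Max (set_mset L) \<in> set_mset L" using that by (intro Max_in) auto
          thus False using that unfolding X_def by auto
        qed
        thus ?thesis using 1 by (auto simp: D_def X_def)
      qed
      moreover have "(g has_sum g {#}) {{#}}" by (intro has_sum_finiteI) simp_all
      moreover have "g {#} = c k" using 1 by (simp add: c_def g_def crank_sign_def crank_def)
      ultimately show ?thesis by simp
    next
      case 2
      have "D k = {}"
      proof -
        have "False" if "L \<in> X" "L \<noteq> {#}" "Max (set_mset L) = 1" for L
        proof -
          have "Max (set_mset L) \<in> set_mset L" using that by (intro Max_in) auto
          thus False using that unfolding X_def by auto
        qed
        thus ?thesis using 2 by (auto simp: D_def)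
      qed
      thus ?thesis using 2 by (simp add: c_def)
    next
      case 3
      have bij: "bij_betw (add_mset k) {L. set_mset L \<subseteq> {2..k}} (D k)"
      proof (rule bij_betwI[where g = "\<lambda>L. L - {#k#}"])
        show "add_mset k \<in> {L. set_mset L \<subseteq> {2..k}} \<rightarrow> D k"
        proof
          fix L assume L: "L \<in> {L. set_mset L \<subseteq> {2..k}}"
          hence "Max (insert k (set_mset L)) = k" by (intro Max_eqI) auto
          thus "add_mset k L \<in> D k" using L 3 by (auto simp: D_def X_def)
        qed
        have kin: "k \<in># L \<and> set_mset L \<subseteq> {2..k}" if "L \<in> D k" for L
        proof -
          have "L \<noteq> {#}" "Max (set_mset L) = k" "set_mset L \<subseteq> {2..}" using that 3 by (auto simp: D_def X_def split: if_splits)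
          thus ?thesis using Max_in[of "set_mset L"] Max_ge[of "set_mset L"] by auto
        qed
        show "(\<lambda>L. L - {#k#}) \<in> D k \<rightarrow> {L. set_mset L \<subseteq> {2..k}}"
          using kin by (auto dest: in_diffD)
        show "add_mset k (L - {#k#}) = L" if "L \<in> D k" for L using kin[OF that] by simp
      qed simp
      have lt: "norm (q ^ i) < 1" if "i \<in> {2..k}" for i using q that by (simp add: norm_power power_less_one_iff)
      have "((\<lambda>L. \<Prod>i\<in>#L. q ^ i) has_sum (\<Prod>i\<in>{2..k}. 1 / (1 - q ^ i))) {L. set_mset L \<subseteq> {2..k}}"
        using has_sum_multisets_finite_support[of "{2..k}" "\<lambda>i. q ^ i"] lt by blast
      hence "((\<lambda>L. (- q) ^ k * (\<Prod>i\<in>#L. q ^ i)) has_sum ((- q) ^ k * (\<Prod>i\<in>{2..k}. 1 / (1 - q ^ i)))) {L. set_mset L \<subseteq> {2..k}}"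
        by (rule has_sum_cmult_right)
      also have "?this \<longleftrightarrow> ((\<lambda>L. g (add_mset k L)) has_sum ((- q) ^ k * (\<Prod>i\<in>{2..k}. 1 / (1 - q ^ i)))) {L. set_mset L \<subseteq> {2..k}}"
        unfolding g_def by (intro has_sum_cong crank_sign_without_ones[symmetric] 3) auto
      also have "\<dots> \<longleftrightarrow> (g has_sum ((- q) ^ k * (\<Prod>i\<in>{2..k}. 1 / (1 - q ^ i)))) (D k)"
        by (rule has_sum_reindex_bij_betw[OF bij])
      also have "(- q) ^ k * (\<Prod>i\<in>{2..k}. 1 / (1 - q ^ i)) = c k"
      proof -
        have "{1..k} = insert 1 {2..k}" using 3 by auto
        hence "b k = 1 / (1 - q) * (\<Prod>i\<in>{2..k}. 1 / (1 - q ^ i))" by (simp add: b_def)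
        thus ?thesis using 3 q1 by (simp add: c_def mult_ac)
      qed
      finally show ?thesis .
    qed
  qed
  have "bij_betw snd (Sigma UNIV D) X"
    by (rule bij_betwI[where g = "\<lambda>L. (if L = {#} then 0 else Max (set_mset L), L)"]) (auto simp: D_def split: if_splits)
  from has_sum_reindex_bij_betw[OF this, of g S] S
  have "((\<lambda>p. g (snd p)) has_sum S) (Sigma UNIV D)" by (simp add: g_def[abs_def] X_def)
  hence "(c has_sum S) UNIV" by (rule has_sum_SigmaD) (use fib in simp)
  hence cS: "c sums S" by (rule has_sum_imp_sums)
  have b_lim: "b \<longlonglongrightarrow> inverse (euler_fun q)"
  proof -
    have "b = (\<lambda>N. inverse (\<Prod>k=1..N. 1 - q ^ k))"
      by (auto simp: b_def fun_eq_iff prod_dividef inverse_eq_divide)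
    thus ?thesis by (simp only:) (intro tendsto_inverse LIMSEQ_prod_1_minus euler_fun_nonzero q)
  qed
  then obtain K where K: "\<And>j. norm (b j) \<le> K" using convergent_imp_Bseq[OF convergentI[OF b_lim]] by (auto simp: Bseq_def)
  have "(\<lambda>j. b j * (- q) ^ j) sums inverse m"
    unfolding b_def
  proof (rule q_binomial_functional_equation[OF q K[unfolded b_def]])
    have "(\<lambda>N. inverse (\<Prod>k=1..N. 1 + q ^ k)) \<longlonglongrightarrow> inverse m"
      unfolding m_def by (intro tendsto_inverse LIMSEQ_prod_1_plus q m0[unfolded m_def])
    moreover have "inverse (\<Prod>k=1..N. 1 + q ^ k) = (\<Prod>i<N. (1 - 0 * q ^ (i + 2)) / (1 + q ^ (i + 1)))" for N
      by (simp add: prod.atLeast1_atMost_eq prod_dividef inverse_eq_divide)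
    ultimately show "(\<lambda>N. \<Prod>i<N. (1 - 0 * q ^ (i + 2)) / (1 + q ^ (i + 1))) \<longlonglongrightarrow> inverse m" by simp
  qed
  from sums_mult[OF this, of "1 - q"] have s1: "(\<lambda>j. (1 - q) * (b j * (- q) ^ j)) sums ((1 - q) / m)"
    by (simp add: divide_inverse)
  \<comment> \<open>The origin of the correction \<open>2 q\<close>: at \<open>k = 0\<close> the
    series has \<open>1 - q\<close> in place of 1, and at \<open>k = 1\<close> it has
    \<open>- q\<close> in place of 0. Each of the two places is corrected by
    \<open>q\<close>.\<close>
  have "(\<lambda>k. if k \<in> {0, 1} then q else 0) sums (\<Sum>k\<in>{0, 1 :: nat}. q)" by (rule sums_If_finite_set) simp
  from sums_add[OF s1 this] have "(\<lambda>k. (1 - q) * (b k * (- q) ^ k) + (if k \<in> {0, 1} then q else 0)) sums ((1 - q) / m + 2 * q)"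
    by simp
  moreover have "(1 - q) * (b k * (- q) ^ k) + (if k \<in> {0, 1} then q else 0) = c k" for k
    using q1 by (auto simp: c_def b_def)
  ultimately have "c sums ((1 - q) / m + 2 * q)" by simp
  with cS show ?thesis by (rule sums_unique2)
qed

text \<open>The partitions are sorted by their number \<open>j\<close> of ones. Apart from
  \<open>2 q\<close>, the value \<open>T 0\<close> for partitions without ones is the term
  \<open>j = 0\<close> of the series found for \<open>j \<ge> 1\<close>, so one application of the
  q-binomial theorem with \<open>s = 1\<close> sums over all \<open>j\<close>.\<close>

theorem crank_parity_generating_function:
  fixes q :: complex
  assumes q: "norm q < 1"
  shows "(\<lambda>n. of_real (real (M0 n) - real (M1 n)) * q ^ n) sums (euler_fun q ^ 3 / euler_fun (q\<^sup>2) ^ 2 + 2 * q)"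
proof -
  define PP where "PP = {L :: nat multiset. set_mset L \<subseteq> {1..}}"
  define X where "X = {L :: nat multiset. set_mset L \<subseteq> {2..}}"
  define g where "g L = crank_sign L * q ^ sum_mset L" for L
  define m where "m = euler_fun (q\<^sup>2) / euler_fun q"
  define a where "a k = (\<Prod>i=1..k. (1 + 1 * q ^ i) / (1 - q ^ i))" for k
  have q2: "norm (q\<^sup>2) < 1" using q by (simp add: norm_power power_less_one_iff)
  have e0: "euler_fun q \<noteq> 0" "euler_fun (q\<^sup>2) \<noteq> 0" using euler_fun_nonzero[OF q] euler_fun_nonzero[OF q2] .
  have m0: "m \<noteq> 0" using e0 by (simp add: m_def)
  have q1: "1 - q \<noteq> 0" using q by auto
  have lim1: "(\<lambda>N. \<Prod>k\<in>{1..} \<inter> {..N}. 1 / (1 - q ^ k)) \<longlonglongrightarrow> inverse (euler_fun q)"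
  proof -
    have "(\<Prod>k\<in>{1..} \<inter> {..N}. 1 / (1 - q ^ k)) = inverse (\<Prod>k=1..N. 1 - q ^ k)" for N
    proof -
      have "{1..} \<inter> {..N} = {1..N}" by auto
      thus ?thesis by (simp add: prod_dividef inverse_eq_divide)
    qed
    thus ?thesis by (simp only:) (intro tendsto_inverse LIMSEQ_prod_1_minus euler_fun_nonzero q)
  qed
  have "(\<lambda>L. norm (\<Prod>k\<in>#L. q ^ k)) summable_on PP" unfolding PP_def
    by (rule has_sum_weighted_partitions(1)[OF q _ _ lim1]) (auto simp: norm_power)
  \<comment> \<open>Signs do not affect norms, so absolute summability comes from the unsigned
    partition series.\<close>
  moreover have "norm (\<Prod>k\<in>#L. q ^ k) = norm (g L)" for L
    by (auto simp: g_def norm_mult crank_sign_def prod_mset_power_eq)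
  ultimately have "(\<lambda>L. norm (g L)) summable_on PP" by simp
  hence "g summable_on PP" by (rule abs_summable_summable)
  then obtain S where S: "(g has_sum S) PP" by (auto simp: summable_on_def)
  \<comment> \<open>Sorting by the size \<open>n\<close> identifies the coefficients; the bijection
    \<open>h\<close> below sorts the same sum by the number of ones.\<close>
  have "bij_betw snd (Sigma UNIV partitions) PP"
    by (rule bij_betwI[where g = "\<lambda>L. (sum_mset L, L)"])
       (auto simp: partitions_def PP_def Suc_le_eq intro!: gr0I)
  from has_sum_reindex_bij_betw[OF this, of g S] S
  have "((\<lambda>p. g (snd p)) has_sum S) (Sigma UNIV partitions)" by simp
  hence "((\<lambda>n. of_real (real (M0 n) - real (M1 n)) * q ^ n) has_sum S) UNIV"
  proof (rule has_sum_SigmaD)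
    fix n
    have "(\<Sum>L\<in>partitions n. g L) = (\<Sum>L\<in>partitions n. crank_sign L * q ^ n)"
      by (rule sum.cong) (auto simp: g_def partitions_def)
    also have "\<dots> = of_real (real (M0 n) - real (M1 n)) * q ^ n"
      by (simp add: sum_distrib_right[symmetric] sum_crank_sign)
    finally show "((\<lambda>y. g (snd (n, y))) has_sum (of_real (real (M0 n) - real (M1 n)) * q ^ n)) (partitions n)"
      by (intro has_sum_finiteI finite_partitions) simp
  qed
  hence sums: "(\<lambda>n. of_real (real (M0 n) - real (M1 n)) * q ^ n) sums S" by (rule has_sum_imp_sums)
  define h where "h = (\<lambda>(j :: nat, L). replicate_mset j (1::nat) + L)"
  have bijh: "bij_betw h (UNIV \<times> X) PP"
  proof (rule bij_betwI[where g = "\<lambda>L. (count L 1, filter_mset (\<lambda>k. k \<noteq> 1) L)"])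
    fix p :: "nat \<times> nat multiset" assume "p \<in> UNIV \<times> X"
    then obtain j L where p: "p = (j, L)" "set_mset L \<subseteq> {2..}" by (auto simp: X_def)
    have "count L 1 = 0" using p by (auto simp: count_eq_zero_iff)
    moreover have "filter_mset (\<lambda>k. k \<noteq> 1) L = L"
      using p by (auto simp: filter_mset_eq_conv)
    moreover have "filter_mset (\<lambda>k. k \<noteq> 1) (replicate_mset j (1::nat)) = {#}"
      by (simp add: filter_mset_eq_conv)
    ultimately show "(count (h p) 1, filter_mset (\<lambda>k. k \<noteq> 1) (h p)) = p" by (simp add: p h_def)
  next
    fix L assume "L \<in> PP"
    show "h (count L 1, filter_mset (\<lambda>k. k \<noteq> 1) L) = L"
      by (rule multiset_eqI) (auto simp: h_def)
  next
    show "h \<in> UNIV \<times> X \<rightarrow> PP" by (fastforce simp: h_def X_def PP_def split: if_splits)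
    show "(\<lambda>L. (count L 1, filter_mset (\<lambda>k. k \<noteq> 1) L)) \<in> PP \<rightarrow> UNIV \<times> X"
      by (fastforce simp: X_def PP_def)
  qed
  have Sh: "((\<lambda>p. g (h p)) has_sum S) (UNIV \<times> X)"
    using has_sum_reindex_bij_betw[OF bijh, of g S] S by simp
  define T where "T j = (\<Sum>\<^sub>\<infinity>L\<in>X. g (h (j, L)))" for j
  have inner: "((\<lambda>L. g (h (j, L))) has_sum T j) X" for j
    unfolding T_def
  proof (rule has_sum_infsum)
    have "(\<lambda>p. g (h p)) summable_on (UNIV \<times> X)" using Sh by (rule has_sum_imp_summable)
    thus "(\<lambda>L. g (h (j, L))) summable_on X"
      using summable_on_SigmaD1[of "\<lambda>j L. g (h (j, L))" UNIV "\<lambda>_. X" j] by (simp add: case_prod_unfold)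
  qed
  have "(T has_sum S) UNIV" by (rule has_sum_SigmaD[OF Sh inner])
  hence TS: "T sums S" by (rule has_sum_imp_sums)
  have T0: "T 0 = (1 - q) / m + 2 * q" unfolding m_def
    by (rule crank_sign_without_ones_value[OF q]) (use inner[of 0] in \<open>simp add: g_def h_def X_def\<close>)
  have Tj: "T j = (1 - q) / m * (a j * (- q) ^ j)" if "j \<ge> 1" for j
  proof (rule has_sum_unique[OF inner])
    show "((\<lambda>L. g (h (j, L))) has_sum ((1 - q) / m * (a j * (- q) ^ j))) X"
      using has_sum_crank_sign_with_ones[OF q that] unfolding g_def h_def X_def m_def a_def by simp
  qed
  have a_lim: "a \<longlonglongrightarrow> m / euler_fun q"
  proof -
    have "a = (\<lambda>N. (\<Prod>k=1..N. 1 + q ^ k) / (\<Prod>k=1..N. 1 - q ^ k))"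
      by (auto simp: a_def fun_eq_iff prod_dividef)
    thus ?thesis unfolding m_def by (simp only:) (intro tendsto_divide LIMSEQ_prod_1_plus LIMSEQ_prod_1_minus e0 q)
  qed
  then obtain K where K: "\<And>j. norm (a j) \<le> K" using convergent_imp_Bseq[OF convergentI[OF a_lim]] by (auto simp: Bseq_def)
  have "(\<lambda>j. a j * (- q) ^ j) sums (euler_fun q / (1 - q) / m)"
    unfolding a_def
  proof (rule q_binomial_functional_equation[OF q K[unfolded a_def]])
    have "(\<lambda>N. (\<Prod>k=1..Suc N. 1 - q ^ k) / (1 - q) / (\<Prod>k=1..N. 1 + q ^ k)) \<longlonglongrightarrow> euler_fun q / (1 - q) / m"
      unfolding m_def by (intro tendsto_intros LIMSEQ_Suc[OF LIMSEQ_prod_1_minus] LIMSEQ_prod_1_plus q q1 m0[unfolded m_def])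
    moreover have "(\<Prod>k=1..Suc N. 1 - q ^ k) / (1 - q) / (\<Prod>k=1..N. 1 + q ^ k) = (\<Prod>i<N. (1 - 1 * q ^ (i + 2)) / (1 + q ^ (i + 1)))" for N
    proof -
      have "(\<Prod>k=1..Suc N. 1 - q ^ k) = (1 - q) * (\<Prod>i<N. 1 - q ^ (i + 2))"
        unfolding One_nat_def prod.atLeast1_atMost_eq prod.lessThan_Suc_shift by simp
      moreover have "(\<Prod>k=1..N. 1 + q ^ k) = (\<Prod>i<N. 1 + q ^ (i + 1))"
        by (simp add: prod.atLeast1_atMost_eq)
      ultimately show ?thesis using q1 by (simp add: prod_dividef)
    qed
    ultimately show "(\<lambda>N. \<Prod>i<N. (1 - 1 * q ^ (i + 2)) / (1 + q ^ (i + 1))) \<longlonglongrightarrow> euler_fun q / (1 - q) / m" by simp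
  qed
  from sums_mult[OF this, of "(1 - q) / m"] have s1: "(\<lambda>j. (1 - q) / m * (a j * (- q) ^ j)) sums (euler_fun q / m ^ 2)"
    using q1 by (simp add: power2_eq_square)
  have "(\<lambda>k. if k \<in> {0} then 2 * q else 0) sums (\<Sum>k\<in>{0 :: nat}. 2 * q)" by (rule sums_If_finite_set) simp
  from sums_add[OF s1 this] have "(\<lambda>j. (1 - q) / m * (a j * (- q) ^ j) + (if j \<in> {0} then 2 * q else 0)) sums (euler_fun q / m ^ 2 + 2 * q)"
    by simp
  moreover have "(1 - q) / m * (a j * (- q) ^ j) + (if j \<in> {0} then 2 * q else 0) = T j" for j
    using T0 Tj[of j] by (cases "j = 0") (auto simp: a_def)
  ultimately have "T sums (euler_fun q / m ^ 2 + 2 * q)" by simp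
  with TS have "S = euler_fun q / m ^ 2 + 2 * q" by (rule sums_unique2)
  also have "euler_fun q / m ^ 2 = euler_fun q ^ 3 / euler_fun (q\<^sup>2) ^ 2"
    using e0 by (simp add: m_def field_simps power2_eq_square power3_eq_cube)
  finally show ?thesis using sums by simp
qed

section \<open>The eta quotient and its bound on the minor arcs\<close>

text \<open>Machin's formula; the crude bound \<open>arctan (1 / 5) \<ge> 5 / 26\<close> already
  gives \<open>pi > 3\<close>.\<close>

lemma pi_bounds: "3 < pi" "pi \<le> 16 / 5"
proof -
  have m: "pi = 16 * arctan (1 / 5) - 4 * arctan (1 / 239)" using machin by simp
  have "5 / 26 \<le> arctan (1 / 5)" using arctan_step_bounds(1)[of 5 0] by simp
  moreover have "arctan (1 / 239) \<le> 1 / 239" "arctan (1 / 5) \<le> 1 / 5" by (intro arctan_le_self; simp)+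
  moreover have "0 \<le> arctan (1 / 239)" by simp
  ultimately show "3 < pi" "pi \<le> 16 / 5" unfolding m by linarith+
qed

lemma csqrt_of_real_mult:
  assumes "r > 0"
  shows "csqrt (of_real r * z) = of_real (sqrt r) * csqrt z"
proof (rule csqrt_unique)
  show "(of_real (sqrt r) * csqrt z)\<^sup>2 = of_real r * z"
    using assms by (simp add: power_mult_distrib flip: of_real_power)
  show "0 < Re (of_real (sqrt r) * csqrt z) \<or> Re (of_real (sqrt r) * csqrt z) = 0 \<and> 0 \<le> Im (of_real (sqrt r) * csqrt z)"
    using assms csqrt_principal[of z] by auto
qed

lemma norm_csqrt: "norm (csqrt z) = sqrt (norm z)"
  by (metis norm_power power2_csqrt real_sqrt_unique norm_ge_zero)

lemma Im_minus_one_over: "Im (- 1 / z) = Im z / (norm z)\<^sup>2"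
  by (simp add: Im_divide cmod_power2)

text \<open>The product of \<open>(1 - q ^ k) / (1 + q ^ k)\<^sup>2\<close>, because
  \<open>1 + q ^ k\<close> is \<open>(1 - q ^ (2 k)) / (1 - q ^ k)\<close>.\<close>

definition crank_product :: "complex \<Rightarrow> complex" where
  "crank_product q = euler_fun q ^ 3 / euler_fun (q\<^sup>2) ^ 2"

text \<open>A form of weight 1/2. The map \<open>t -> - 1 / (4 t)\<close> exchanges the roles of
  \<open>eta t\<close> and \<open>eta (4 t)\<close> and keeps that of
  \<open>eta (2 t)\<close>.\<close>

definition crank_eta :: "complex \<Rightarrow> complex" where
  "crank_eta t = eta (2 * t) ^ 7 / (eta t * eta (4 * t)) ^ 3"

lemma crank_product_minus_1_bound:
  assumes "norm q \<le> 1 / 4"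
  shows "norm (crank_product q - 1) \<le> exp (8 * norm q) - 1"
proof -
  define f where "f n = (1 - q ^ Suc n) / (1 + q ^ Suc n)\<^sup>2" for n
  have q: "norm q < 1" using assms by simp
  have q2: "norm (q\<^sup>2) < 1" using q by (simp add: norm_power power_less_one_iff)
  have small: "norm (q ^ Suc n) \<le> 1 / 4" for n
  proof -
    have "norm q ^ Suc n \<le> norm q ^ 1" using q by (intro power_decreasing) auto
    thus ?thesis using assms by (simp add: norm_power norm_mult)
  qed
  have "(\<lambda>n. (1 - q ^ Suc n) ^ 3 / (1 - (q\<^sup>2) ^ Suc n) ^ 2) has_prod crank_product q"
    unfolding crank_product_def by (intro has_prod_divide has_prod_power has_prod_euler_fun q q2)
  also have "(\<lambda>n. (1 - q ^ Suc n) ^ 3 / (1 - (q\<^sup>2) ^ Suc n) ^ 2) = f"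
  proof
    fix n
    define a where "a = q ^ Suc n"
    have "1 - a \<noteq> 0" using power_Suc_neq_1[OF q, of n] by (auto simp: a_def)
    moreover have "(q\<^sup>2) ^ Suc n = a\<^sup>2" unfolding a_def power_mult[symmetric] by (simp only: mult.commute)
    moreover have "(1 - a) ^ 3 / (1 - a\<^sup>2) ^ 2 = (1 - a) / (1 + a)\<^sup>2" if "1 - a \<noteq> 0"
    proof -
      have "(1 - a) ^ 3 / (1 - a\<^sup>2) ^ 2 = ((1 - a)\<^sup>2 * (1 - a)) / ((1 - a)\<^sup>2 * (1 + a)\<^sup>2)"
        by (rule arg_cong2[where f = "(/)"]) algebra+
      thus ?thesis using that by simp
    qed
    ultimately show "(1 - q ^ Suc n) ^ 3 / (1 - (q\<^sup>2) ^ Suc n) ^ 2 = f n"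
      unfolding f_def a_def[symmetric] by simp
  qed
  finally have P: "crank_product q = prodinf f" by (simp add: has_prod_iff)
  \<comment> \<open>For \<open>|a| \<le> 1 / 4\<close> the factor is at most
    \<open>(13 / 4) / (3 / 4)\<^sup>2 < 6\<close>; the geometric series costs another
    \<open>4 / 3\<close>, whence the 8 in the exponent.\<close>
  have f: "norm (f n - 1) \<le> 6 * norm q ^ Suc n" for n
  proof -
    define a where "a = q ^ Suc n"
    have a: "norm a \<le> 1 / 4" using small[of n] by (simp add: a_def)
    have "3 / 4 \<le> norm (1 + a)" using a norm_triangle_ineq2[of 1 "- a"] by simp
    hence le: "(3 / 4)\<^sup>2 \<le> (norm (1 + a))\<^sup>2" by (intro power_mono) auto
    hence nz: "(1 + a)\<^sup>2 \<noteq> 0" by (auto simp: power2_eq_square)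
    have "f n - 1 = - (a * (3 + a)) / (1 + a)\<^sup>2"
    proof -
      have "(1 - a) - (1 + a)\<^sup>2 = - (a * (3 + a))" by algebra
      moreover have "f n - 1 = ((1 - a) - (1 + a)\<^sup>2) / (1 + a)\<^sup>2"
        unfolding f_def a_def[symmetric] diff_divide_distrib using nz by simp
      ultimately show ?thesis by (simp only:)
    qed
    hence "norm (f n - 1) = norm a * norm (3 + a) / (norm (1 + a))\<^sup>2"
      by (simp add: norm_divide norm_mult norm_power)
    also have "\<dots> \<le> norm a * (13 / 4) / (3 / 4)\<^sup>2"
      using le a norm_triangle_ineq[of 3 a] by (intro frac_le mult_left_mono) (auto intro!: mult_nonneg_nonneg)
    also have "\<dots> \<le> 6 * norm a" by (simp add: power2_eq_square)
    finally show ?thesis by (simp add: a_def norm_power norm_mult)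
  qed
  have "norm (prodinf f - 1) \<le> exp (6 * (norm q / (1 - norm q))) - 1"
    by (rule norm_prodinf_minus_1_le(2)[OF f]) (use q in auto)
  also have "6 * (norm q / (1 - norm q)) \<le> 6 * (norm q / (3 / 4))"
    using assms by (intro mult_left_mono divide_left_mono) (auto intro!: mult_pos_pos)
  hence "exp (6 * (norm q / (1 - norm q))) - 1 \<le> exp (8 * norm q) - 1" by simp
  finally show ?thesis unfolding P .
qed

lemma crank_product_eta:
  assumes "Im t > 0"
  shows "crank_product (- exp (2 * pi * \<i> * t)) = exp (2 * pi * \<i> * t / 24) * crank_eta t"
proof -
  define Q where "Q = exp (2 * pi * \<i> * t)"
  define r where "r = exp (2 * pi * \<i> * t / 24)"
  have Q: "norm Q < 1" using norm_nome_less_1[OF assms] by (simp add: Q_def)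
  have Q2: "norm (Q\<^sup>2) < 1" and Q4: "norm (Q ^ 4) < 1" using Q by (auto simp: norm_power power_less_one_iff)
  have nz: "euler_fun Q \<noteq> 0" "euler_fun (Q\<^sup>2) \<noteq> 0" "euler_fun (Q ^ 4) \<noteq> 0"
    using euler_fun_nonzero Q Q2 Q4 by auto
  have r0: "r \<noteq> 0" by (simp add: r_def)
  have e1: "eta t = r * euler_fun Q" by (simp add: eta_def r_def Q_def)
  have e2: "eta (2 * t) = r ^ 2 * euler_fun (Q\<^sup>2)"
    by (simp add: eta_def r_def Q_def algebra_simps flip: exp_of_nat_mult)
  have e4: "eta (4 * t) = r ^ 4 * euler_fun (Q ^ 4)"
    by (simp add: eta_def r_def Q_def algebra_simps flip: exp_of_nat_mult)
  have "euler_fun (- Q) * (euler_fun Q * euler_fun (Q ^ 4)) = euler_fun (Q\<^sup>2) ^ 3"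
    using euler_fun_minus[OF Q] by (simp add: mult.assoc)
  hence "euler_fun (- Q) = euler_fun (Q\<^sup>2) ^ 3 / (euler_fun Q * euler_fun (Q ^ 4))"
    using nz by (simp add: field_simps)
  hence "crank_product (- Q) = (euler_fun (Q\<^sup>2) ^ 3 / (euler_fun Q * euler_fun (Q ^ 4))) ^ 3 / euler_fun (Q\<^sup>2) ^ 2"
    by (simp add: crank_product_def)
  also have "\<dots> = euler_fun (Q\<^sup>2) ^ 7 / (euler_fun Q * euler_fun (Q ^ 4)) ^ 3"
  proof -
    have "(A ^ 3 / B) ^ 3 / A ^ 2 = A ^ 7 / B ^ 3" if "A \<noteq> 0" for A B :: complex
    proof -
      have "(A ^ 3 / B) ^ 3 / A ^ 2 = (A ^ 2 * A ^ 7) / (A ^ 2 * B ^ 3)"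
        by (simp add: power_divide flip: power_mult power_add)
      also have "\<dots> = A ^ 7 / B ^ 3" using that by (intro nonzero_mult_divide_mult_cancel_left) simp
      finally show ?thesis .
    qed
    thus ?thesis using nz by blast
  qed
  also have "\<dots> = r * crank_eta t"
  proof -
    \<comment> \<open>In units of \<open>r\<close> the prefactors of the eta quotient have exponent
      \<open>7 * 2 - 3 * (1 + 4) = - 1\<close>, which the additional factor \<open>r\<close>
      cancels.\<close>
    have "r * crank_eta t = (r ^ 15 * euler_fun (Q\<^sup>2) ^ 7) / (r ^ 15 * (euler_fun Q * euler_fun (Q ^ 4)) ^ 3)"
      unfolding crank_eta_def e1 e2 e4 times_divide_eq_right
      by (rule arg_cong2[where f = "(/)"]) algebra+
    thus ?thesis using r0 by simp
  qed
  finally show ?thesis unfolding Q_def r_def .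
qed

lemma norm_crank_eta:
  assumes "Im t > 0"
  shows "norm (crank_eta t) = exp (pi * Im t / 12) * norm (crank_product (- exp (2 * pi * \<i> * t)))"
proof -
  have "norm (exp (2 * pi * \<i> * t / 24)) = exp (- (pi * Im t / 12))" by (simp add: mult.commute)
  thus ?thesis unfolding crank_product_eta[OF assms] norm_mult by (simp only: mult.assoc[symmetric] exp_add[symmetric]) simp
qed

text \<open>With \<open>w = csqrt (- \<i> t)\<close> the square roots combine to
  \<open>(sqrt 2 w) ^ 7 / (2 w\<^sup>2) ^ 3 = sqrt 2 w\<close>.\<close>

lemma crank_eta_transformation:
  assumes "Im t > 0"
  shows "crank_eta (- 1 / (4 * t)) = csqrt (- (2 * \<i> * t)) * crank_eta t"
proof -
  define w where "w = csqrt (- \<i> * t)"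
  have t: "t \<noteq> 0" using assms by auto
  have w: "w \<noteq> 0" using t by (simp add: w_def)
  have a: "eta (2 * (- 1 / (4 * t))) = of_real (sqrt 2) * w * eta (2 * t)"
  proof -
    have "2 * (- 1 / (4 * t)) = - 1 / (2 * t)" using t by (simp add: field_simps)
    moreover have "csqrt (- \<i> * (2 * t)) = of_real (sqrt 2) * w"
      unfolding w_def using csqrt_of_real_mult[of 2 "- \<i> * t"] by (simp add: mult_ac)
    ultimately show ?thesis using eta_minus_one_over[of "2 * t"] assms by simp
  qed
  have b: "eta (- 1 / (4 * t)) = 2 * w * eta (4 * t)"
  proof -
    have "csqrt (- \<i> * (4 * t)) = 2 * w"
      unfolding w_def using csqrt_of_real_mult[of 4 "- \<i> * t"] by (simp add: mult_ac)
    thus ?thesis using eta_minus_one_over[of "4 * t"] assms by simp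
  qed
  have c: "eta (4 * (- 1 / (4 * t))) = w * eta t"
    using eta_minus_one_over[of t] assms t by (simp add: w_def)
  have s: "complex_of_real (sqrt 2) ^ 2 = 2" by (simp flip: of_real_power)
  have "csqrt (- (2 * \<i> * t)) = of_real (sqrt 2) * w"
    unfolding w_def using csqrt_of_real_mult[of 2 "- \<i> * t"] by (simp add: mult_ac)
  moreover have "crank_eta (- 1 / (4 * t)) = (8 * w ^ 6 * (of_real (sqrt 2) * w * eta (2 * t) ^ 7)) / (8 * w ^ 6 * (eta t * eta (4 * t)) ^ 3)"
    unfolding crank_eta_def a b c
  proof (rule arg_cong2[where f = "(/)"])
    have "complex_of_real (sqrt 2) ^ 7 = (complex_of_real (sqrt 2) ^ 2) ^ 3 * of_real (sqrt 2)" by algebra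
    hence s7: "complex_of_real (sqrt 2) ^ 7 = 8 * of_real (sqrt 2)" unfolding s by simp
    show "(of_real (sqrt 2) * w * eta (2 * t)) ^ 7 = 8 * w ^ 6 * (of_real (sqrt 2) * w * eta (2 * t) ^ 7)"
      unfolding power_mult_distrib s7 by algebra
    show "(2 * w * eta (4 * t) * (w * eta t)) ^ 3 = 8 * w ^ 6 * (eta t * eta (4 * t)) ^ 3" by algebra
  qed
  ultimately show ?thesis unfolding crank_eta_def using w by simp
qed

lemma norm_crank_eta_plus_1:
  "norm (crank_eta (t + 1)) = norm (crank_eta t)"
proof -
  have "norm (eta (t + of_nat n)) = norm (eta t)" for n t
    by (induction n) (use eta_plus_one_norm in \<open>auto simp: add.assoc[symmetric] add.commute[of 1]\<close>)
  from this[of "2 * t" 2] this[of "4 * t" 4] show ?thesis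
    by (simp add: crank_eta_def norm_mult norm_divide norm_power ring_distribs eta_plus_one_norm)
qed

text \<open>The variable \<open>u = 2 t\<close> turns \<open>- 1 / (4 t)\<close> into
  \<open>- 1 / u\<close>; the exponent 1/4 is half of the weight 1/2.\<close>

definition invariant_crank :: "complex \<Rightarrow> real" where
  "invariant_crank u = Im u powr (1/4) * norm (crank_eta (u / 2))"

lemma invariant_crank_plus_2: "invariant_crank (u + 2) = invariant_crank u"
  using norm_crank_eta_plus_1[of "u / 2"] by (simp add: invariant_crank_def add_divide_distrib)

lemma invariant_crank_shift: "invariant_crank (u + 2 * of_int k) = invariant_crank u"
proof (induction k rule: int_induct[where k = 0])
  case (step1 i)
  show ?case using invariant_crank_plus_2[of "u + 2 * of_int i"] step1 by (simp add: algebra_simps)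
next
  case (step2 i)
  show ?case using invariant_crank_plus_2[of "u + 2 * of_int (i - 1)"] step2 by (simp add: algebra_simps)
qed simp

text \<open>The imaginary part is divided by \<open>|u|\<^sup>2\<close>, and its power 1/4 cancels
  the factor \<open>sqrt |u|\<close> of the transformation formula.\<close>

lemma invariant_crank_inversion:
  assumes "Im u > 0"
  shows "invariant_crank (- 1 / u) = invariant_crank u"
proof -
  have u: "norm u > 0" using assms by auto
  have h: "(- 1 / u) / 2 = - 1 / (4 * (u / 2))" by simp
  have e: "crank_eta ((- 1 / u) / 2) = csqrt (- (2 * \<i> * (u / 2))) * crank_eta (u / 2)"
    unfolding h by (rule crank_eta_transformation) (use assms in simp)
  have "norm (csqrt (- (2 * \<i> * (u / 2)))) = norm u powr (1/2)"
    using u by (simp add: norm_csqrt norm_mult powr_half_sqrt)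
  hence "norm (crank_eta ((- 1 / u) / 2)) = norm u powr (1/2) * norm (crank_eta (u / 2))"
    unfolding e norm_mult by (simp only:)
  moreover have "Im (- 1 / u) powr (1/4) * norm u powr (1/2) = Im u powr (1/4)"
  proof -
    have "((norm u)\<^sup>2) powr (1/4) = norm u powr (1/2)"
      using u by (simp add: powr_powr flip: powr_numeral)
    thus ?thesis using u assms unfolding Im_minus_one_over by (simp add: powr_divide)
  qed
  ultimately show ?thesis by (simp add: invariant_crank_def mult.assoc[symmetric])
qed

lemma exp_half_pi_ge: "4 \<le> exp (pi / 2)"
proof -
  have "2 \<le> 1 + 3 / 4 + (3 / 4)\<^sup>2 / (2 :: real)" by (simp add: power2_eq_square)
  also have "\<dots> \<le> exp (3 / 4)" by (rule exp_lower_Taylor_quadratic) simp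
  also have "\<dots> \<le> exp (pi / 4)" using pi_bounds by simp
  finally have "2\<^sup>2 \<le> (exp (pi / 4))\<^sup>2" by (intro power_mono) auto
  thus ?thesis by (simp flip: exp_double)
qed

text \<open>From height 1/2 on the nome has modulus at most 1/4, so the product is at most
  \<open>exp 2 \<le> 8\<close> and all growth comes from its exponential prefactor.\<close>

lemma invariant_crank_high:
  assumes "Im u \<ge> 1 / 2"
  shows "invariant_crank u \<le> 8 * (Im u powr (1/4) * exp (pi * Im u / 24))"
proof -
  define Q where "Q = exp (2 * pi * \<i> * (u / 2))"
  have "norm Q = exp (- (pi * Im u))" by (simp add: Q_def)
  also have "\<dots> \<le> exp (- (pi / 2))" using assms by simp
  also have "\<dots> \<le> 1 / 4" using exp_half_pi_ge by (simp add: exp_minus field_simps)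
  finally have Q: "norm Q \<le> 1 / 4" .
  have "norm (crank_product (- Q)) \<le> norm (crank_product (- Q) - 1) + 1"
    using norm_triangle_ineq[of "crank_product (- Q) - 1" 1] by simp
  also have "\<dots> \<le> exp (8 * norm (- Q))" using crank_product_minus_1_bound[of "- Q"] Q by simp
  also have "\<dots> \<le> exp 2" using Q by simp
  also have "exp 2 = (exp 1)\<^sup>2" by (simp flip: exp_double)
  also have "\<dots> \<le> (2.8 :: real)\<^sup>2" using e_less_272 by (intro power_mono) auto
  also have "\<dots> \<le> (8 :: real)" by (simp add: power2_eq_square)
  finally have b: "norm (crank_product (- Q)) \<le> 8" .
  have "norm (crank_eta (u / 2)) = exp (pi * Im u / 24) * norm (crank_product (- Q))"
    using norm_crank_eta[of "u / 2"] assms by (simp add: Q_def)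
  also have "\<dots> \<le> exp (pi * Im u / 24) * 8" using b by (intro mult_left_mono) auto
  finally have "Im u powr (1/4) * norm (crank_eta (u / 2)) \<le> Im u powr (1/4) * (exp (pi * Im u / 24) * 8)"
    by (intro mult_left_mono) auto
  thus ?thesis by (simp add: invariant_crank_def mult_ac)
qed

text \<open>A shift of \<open>t\<close> by one half changes the sign of the nome, so the quotient of
  \<open>crank_product\<close> becomes one of two values of \<open>eta\<close>. The shift moves the
  cusps \<open>u = 1\<close> and \<open>u = - 1\<close> to 0, where
  \<open>eta_minus_one_over\<close> applies.\<close>

lemma norm_crank_eta_shifted:
  assumes "Im t > 0" "\<sigma> = 1 \<or> \<sigma> = - 1"
  shows "norm (crank_eta t) = norm (eta (t - \<sigma> / 2)) ^ 3 / norm (eta (2 * (t - \<sigma> / 2))) ^ 2"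
proof -
  define Q where "Q = exp (2 * pi * \<i> * t)"
  define \<tau> where "\<tau> = t - \<sigma> / 2"
  have "exp (2 * pi * \<i> * \<tau>) = Q * exp (- (\<sigma> * (pi * \<i>)))"
    by (simp add: Q_def \<tau>_def algebra_simps flip: exp_add)
  also have "exp (- (\<sigma> * (pi * \<i>))) = - 1" using assms(2) by (auto simp: exp_minus)
  finally have e: "exp (2 * pi * \<i> * \<tau>) = - Q" by simp
  have e2: "exp (2 * pi * \<i> * (2 * \<tau>)) = (- Q)\<^sup>2"
    unfolding e[symmetric] by (simp add: algebra_simps flip: exp_double)
  have Im: "Im \<tau> = Im t" using assms(2) by (auto simp: \<tau>_def)
  have n1: "norm (eta \<tau>) = exp (- (pi * Im t / 12)) * norm (euler_fun (- Q))"
    unfolding eta_def e by (simp add: norm_mult Im mult.commute)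
  have n2: "norm (eta (2 * \<tau>)) = exp (- (pi * Im t / 6)) * norm (euler_fun ((- Q)\<^sup>2))"
    unfolding eta_def e2 by (simp add: norm_mult Im mult.commute)
  define r where "r = exp (- (pi * Im t / 12))"
  have r: "r \<noteq> 0" by (simp add: r_def)
  have r2: "exp (- (pi * Im t / 6)) = r ^ 2" by (simp add: r_def flip: exp_double)
  have r3: "exp (pi * Im t / 12) = inverse r" by (simp add: r_def exp_minus)
  have "norm (crank_eta t) = inverse r * (norm (euler_fun (- Q)) ^ 3 / norm (euler_fun ((- Q)\<^sup>2)) ^ 2)"
    unfolding norm_crank_eta[OF assms(1)] r3 Q_def[symmetric] crank_product_def by (simp add: norm_divide norm_power)
  also have "\<dots> = (r * norm (euler_fun (- Q))) ^ 3 / (r ^ 2 * norm (euler_fun ((- Q)\<^sup>2))) ^ 2"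
  proof -
    have "inverse r * (A ^ 3 / B ^ 2) = (r * A) ^ 3 / (r ^ 2 * B) ^ 2" for A B :: real
    proof -
      have "(r * A) ^ 3 / (r ^ 2 * B) ^ 2 = (r ^ 3 * A ^ 3) / (r ^ 3 * (r * B ^ 2))"
        by (rule arg_cong2[where f = "(/)"]) algebra+
      also have "\<dots> = A ^ 3 / (r * B ^ 2)" using r by simp
      finally show ?thesis by (simp add: field_simps)
    qed
    thus ?thesis .
  qed
  finally show ?thesis unfolding n1[folded r_def, symmetric] n2[unfolded r2, symmetric] \<tau>_def .
qed

text \<open>Such a point is close to 1 or \<open>- 1\<close>, and \<open>w = - 1 / (u - s)\<close>
  sends it to height \<open>v \<ge> 1\<close>. There \<open>eta (2 w) ^ 3 / eta w ^ 2\<close> has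
  order \<open>6 - 2 = 4\<close> in units of \<open>exp (- pi v / 12)\<close>, a decay that
  outweighs the factor \<open>v powr (1/4)\<close>.\<close>

lemma invariant_crank_near_odd_cusp:
  assumes "Im u > 0" "Im u < 1 / 2" "norm u \<ge> 1" "\<bar>Re u\<bar> \<le> 1"
  shows "invariant_crank u \<le> 8"
proof -
  define s where "s = sgn (Re u)"
  define p where "p = u - of_real s"
  define w where "w = - 1 / p"
  define v where "v = Im w"
  have "1 \<le> (Re u)\<^sup>2 + (Im u)\<^sup>2" using assms(3) by (metis cmod_power2 one_le_power)
  moreover have "(Im u)\<^sup>2 < (1/2)\<^sup>2" using assms(1,2) by (intro power_strict_mono) auto
  ultimately have re: "(Re u)\<^sup>2 > 3 / 4" by (simp add: power2_eq_square)
  hence "Re u \<noteq> 0" by auto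
  hence s: "s = 1 \<or> s = - 1" by (auto simp: s_def sgn_if)
  have s1: "\<bar>Re u\<bar> = s * Re u" by (auto simp: s_def sgn_if)
  define a where "a = 1 - \<bar>Re u\<bar>"
  define b where "b = Im u"
  have p_norm: "(norm p)\<^sup>2 = a\<^sup>2 + b\<^sup>2"
  proof -
    have "(Re p)\<^sup>2 = a\<^sup>2" using s s1 by (auto simp: p_def a_def power2_eq_square algebra_simps)
    thus ?thesis unfolding cmod_power2 by (simp add: p_def b_def)
  qed
  have Imp: "Im p = b" by (simp add: p_def b_def)
  have ab: "0 \<le> a" "a < 1 / 2" "0 < b" "b < 1 / 2" "1 \<le> (1 - a)\<^sup>2 + b\<^sup>2"
  proof -
    show "0 \<le> a" "0 < b" "b < 1 / 2" using assms by (auto simp: a_def b_def)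
    show "1 \<le> (1 - a)\<^sup>2 + b\<^sup>2" using \<open>1 \<le> (Re u)\<^sup>2 + (Im u)\<^sup>2\<close> by (simp add: a_def b_def)
    show "a < 1 / 2"
    proof (rule ccontr)
      assume "\<not> a < 1 / 2"
      hence "\<bar>Re u\<bar> \<le> 1 / 2" by (simp add: a_def)
      hence "\<bar>Re u\<bar>\<^sup>2 \<le> (1 / 2)\<^sup>2" by (intro power_mono) auto
      thus False using re by (simp add: power2_eq_square)
    qed
  qed
  \<comment> \<open>This is \<open>Im w \<ge> 1\<close>. The condition \<open>|u| \<ge> 1\<close>
    forces \<open>a\<^sup>2 \<le> b\<^sup>2\<close>, and
    \<open>b\<^sup>2 \<le> b / 2\<close>.\<close>
  have "a\<^sup>2 + b\<^sup>2 \<le> b"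
  proof -
    have "b\<^sup>2 \<ge> 2 * a - a\<^sup>2" using ab(5) by (simp add: power2_eq_square algebra_simps)
    moreover have "a\<^sup>2 \<le> a / 2" using mult_left_mono[of a "1/2" a] ab(1,2) by (simp add: power2_eq_square)
    ultimately have "a\<^sup>2 \<le> b\<^sup>2" using ab(1) by linarith
    moreover have "b\<^sup>2 \<le> b / 2" using mult_left_mono[of b "1/2" b] ab(3,4) by (simp add: power2_eq_square)
    ultimately show ?thesis by linarith
  qed
  moreover have p0: "norm p > 0" using Imp ab(3) by auto
  ultimately have v: "v \<ge> 1" unfolding v_def w_def Im_minus_one_over Imp p_norm[symmetric]
    by (simp add: field_simps)
  have w0: "norm w > 0" using v by (auto simp: v_def)
  have pw: "p = - 1 / w" using p0 by (simp add: w_def)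
  have Imu: "Im u = v / (norm w)\<^sup>2"
    using Imp unfolding pw Im_minus_one_over by (simp add: b_def v_def)
  define \<tau> where "\<tau> = u / 2 - of_real s / 2"
  have tau: "\<tau> = - 1 / (2 * w)" "2 * \<tau> = - 1 / w"
  proof -
    have "\<tau> = p / 2" by (simp add: \<tau>_def p_def diff_divide_distrib)
    thus "\<tau> = - 1 / (2 * w)" "2 * \<tau> = - 1 / w" unfolding pw by simp_all
  qed
  define c :: complex where "c = of_real s"
  have c: "c = 1 \<or> c = - 1" using s by (auto simp: c_def)
  have n: "norm (crank_eta (u / 2)) = norm (eta \<tau>) ^ 3 / norm (eta (2 * \<tau>)) ^ 2"
    using norm_crank_eta_shifted[OF _ c, of "u / 2"] assms(1) by (simp add: \<tau>_def c_def)
  define W where "W = exp (2 * pi * \<i> * w)"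
  have nW: "norm W = exp (- (2 * pi * v))" by (simp add: W_def v_def)
  have "norm W \<le> exp (- pi)" using v pi_bounds unfolding nW by simp
  also have "exp (- pi) = inverse ((exp (pi / 2))\<^sup>2)" by (simp add: exp_minus flip: exp_double)
  also have "\<dots> \<le> inverse (4\<^sup>2)" using exp_half_pi_ge by (intro le_imp_inverse_le power_mono) auto
  finally have W: "norm W \<le> 1 / 16" by simp
  have E: "norm (euler_fun q - 1) \<le> 1 / 10" if "norm q \<le> 1 / 16" for q
  proof -
    have "norm (euler_fun q - 1) \<le> exp (norm q / (1 - norm q)) - 1"
      using that by (intro norm_euler_fun_minus_1) simp
    also have "norm q / (1 - norm q) \<le> (1 / 16) / (15 / 16)" using that by (intro frac_le) auto
    hence "exp (norm q / (1 - norm q)) \<le> exp (1 / 15)" by simp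
    also have "exp (1 / 15) \<le> 1 + 1 / 15 + (1 / 15 :: real)\<^sup>2" by (rule exp_bound) auto
    finally show ?thesis by (simp add: power2_eq_square)
  qed
  have W2: "norm (W\<^sup>2) \<le> 1 / 16"
    using W mult_mono[of "norm W" "1/16" "norm W" 1] by (simp add: norm_power norm_mult power2_eq_square)
  have E2: "norm (euler_fun (W\<^sup>2)) \<le> 11 / 10"
    using E[OF W2] norm_triangle_ineq[of "euler_fun (W\<^sup>2) - 1" 1] by simp
  have E1: "norm (euler_fun W) \<ge> 9 / 10"
    using E[OF W] norm_triangle_ineq[of "1 - euler_fun W" "euler_fun W"] by (simp add: norm_minus_commute)
  have eW: "norm (eta w) = exp (- (pi * v / 12)) * norm (euler_fun W)"
    unfolding eta_def W_def by (simp add: norm_mult v_def mult.commute)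
  have "exp (2 * pi * \<i> * (2 * w)) = W\<^sup>2" unfolding W_def by (simp add: algebra_simps flip: exp_double)
  hence eW2: "norm (eta (2 * w)) = exp (- (pi * v / 6)) * norm (euler_fun (W\<^sup>2))"
    unfolding eta_def by (simp add: norm_mult v_def mult.commute)
  have t1: "norm (eta \<tau>) = sqrt (2 * norm w) * norm (eta (2 * w))"
    unfolding tau using eta_minus_one_over[of "2 * w"] v by (simp add: v_def norm_mult norm_csqrt)
  have t2: "norm (eta (2 * \<tau>)) = sqrt (norm w) * norm (eta w)"
    unfolding tau using eta_minus_one_over[of w] v by (simp add: v_def norm_mult norm_csqrt)
  define r where "r = sqrt (norm w)"
  have r0: "r > 0" using w0 by (auto simp: r_def)
  define x where "x = exp (- (pi * v / 12))"
  have x0: "x > 0" and x2: "exp (- (pi * v / 6)) = x\<^sup>2" by (auto simp: x_def simp flip: exp_double)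
  have "norm (crank_eta (u / 2)) = (sqrt 2 * r * (x\<^sup>2 * norm (euler_fun (W\<^sup>2)))) ^ 3 / (r * (x * norm (euler_fun W))) ^ 2"
    unfolding n t1 t2 eW eW2 x2 x_def[symmetric] by (simp add: r_def real_sqrt_mult)
  also have "\<dots> \<le> (sqrt 2 * r * (x\<^sup>2 * (11 / 10))) ^ 3 / (r * (x * (9 / 10))) ^ 2"
    using E1 E2 r0 x0 by (intro frac_le power_mono mult_left_mono) auto
  also have "\<dots> = (sqrt 2) ^ 3 * ((11 / 10) ^ 3 / (9 / 10) ^ 2) * r * x ^ 4"
    using r0 x0 by (simp add: field_simps power2_eq_square power3_eq_cube power4_eq_xxxx)
  also have "\<dots> \<le> 8 * r * x ^ 4"
  proof -
    have "sqrt 2 \<le> 3 / 2" by (rule real_le_lsqrt) (auto simp: power2_eq_square)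
    hence "(sqrt 2) ^ 3 \<le> (3 / 2) ^ 3" by (intro power_mono) auto
    hence "(sqrt 2) ^ 3 * ((11 / 10) ^ 3 / (9 / 10) ^ 2) \<le> 8" by (simp add: power2_eq_square power3_eq_cube)
    thus ?thesis using r0 x0 by (intro mult_right_mono) auto
  qed
  finally have bd: "norm (crank_eta (u / 2)) \<le> 8 * r * x ^ 4" .
  have "Im u powr (1/4) = v powr (1/4) / r"
  proof -
    have "((norm w)\<^sup>2) powr (1/4) = r" using w0 unfolding r_def by (simp add: powr_powr powr_half_sqrt flip: powr_numeral)
    thus ?thesis using v w0 unfolding Imu by (simp add: powr_divide)
  qed
  moreover have "v powr (1/4) * x ^ 4 \<le> 1"
  proof -
    have "v powr (1/4) \<le> v powr 1" using v by (intro powr_mono) auto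
    also have "v powr 1 = v" using v by simp
    also have "v \<le> exp v" using exp_ge_add_one_self[of v] by linarith
    finally have "v powr (1/4) \<le> exp v" .
    moreover have "x ^ 4 = exp (- (pi * v / 3))" unfolding x_def by (simp flip: exp_of_nat_mult)
    moreover have "v \<le> pi * v / 3" using v pi_bounds by (simp add: field_simps)
    hence "exp (- (pi * v / 3)) \<le> exp (- v)" by simp
    ultimately have "v powr (1/4) * x ^ 4 \<le> exp v * exp (- v)" by (intro mult_mono) auto
    thus ?thesis by (simp flip: exp_add)
  qed
  moreover have "invariant_crank u \<le> Im u powr (1/4) * (8 * r * x ^ 4)"
    unfolding invariant_crank_def by (intro mult_left_mono bd) auto
  moreover have "v powr (1/4) / r * (8 * r * x ^ 4) = 8 * (v powr (1/4) * x ^ 4)" using r0 by simp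
  ultimately show ?thesis by (simp only:)
qed

section \<open>Reduction to the fundamental domain\<close>

lemma exists_even_shift: "\<exists>k :: int. \<bar>x - 2 * of_int k\<bar> \<le> (1 :: real)"
proof
  have "\<bar>of_int (round (x / 2)) - x / 2\<bar> \<le> 1 / 2" by (rule of_int_round_abs_le)
  thus "\<bar>x - 2 * of_int (round (x / 2))\<bar> \<le> 1" unfolding abs_le_iff by linarith
qed

text \<open>Imaginary parts \<open>Im u / |c u + d|\<^sup>2\<close> that are not below
  \<open>Im u\<close> come from these pairs; their finiteness provides a largest imaginary part in
  an orbit.\<close>

lemma finite_small_lattice_values:
  assumes "Im u > 0"
  shows "finite {(c :: int, d :: int). norm (of_int c * u + of_int d) \<le> 1}"
proof (rule finite_subset)
  define B where "B = \<lceil>1 / Im u\<rceil>"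
  define D where "D = \<lceil>1 + B * \<bar>Re u\<bar>\<rceil>"
  show "{(c :: int, d :: int). norm (of_int c * u + of_int d) \<le> 1} \<subseteq> {-B..B} \<times> {-D..D}"
  proof safe
    fix c d :: int assume le: "norm (of_int c * u + of_int d) \<le> 1"
    have "\<bar>of_int c * Im u\<bar> \<le> 1" using abs_Im_le_cmod[of "of_int c * u + of_int d"] le by simp
    hence "\<bar>real_of_int c\<bar> \<le> 1 / Im u" using assms by (simp add: abs_mult field_simps)
    also have "\<dots> \<le> of_int B" unfolding B_def by (rule le_of_int_ceiling)
    finally have c: "\<bar>real_of_int c\<bar> \<le> of_int B" .
    hence "\<bar>c\<bar> \<le> B" by linarith
    have "\<bar>of_int c * Re u + of_int d\<bar> \<le> 1" using abs_Re_le_cmod[of "of_int c * u + of_int d"] le by simp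
    moreover have "\<bar>of_int c * Re u\<bar> \<le> of_int B * \<bar>Re u\<bar>" unfolding abs_mult using c by (intro mult_right_mono) auto
    ultimately have "\<bar>real_of_int d\<bar> \<le> 1 + of_int B * \<bar>Re u\<bar>" by linarith
    also have "\<dots> \<le> of_int D" unfolding D_def by (rule le_of_int_ceiling)
    finally have "\<bar>d\<bar> \<le> D" by linarith
    from \<open>\<bar>c\<bar> \<le> B\<close> \<open>\<bar>d\<bar> \<le> D\<close> show "c \<in> {-B..B}" "d \<in> {-D..D}" by auto
  qed
qed auto

text \<open>
  Under \<open>u \<mapsto> u + 2\<close> and \<open>u \<mapsto> - 1 / u\<close> every point can be moved to a point of its orbit with
  largest imaginary part, which then lies in the domain \<open>|Re u| \<le> 1\<close>, \<open>|u| \<ge> 1\<close>. The imaginary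
  parts occurring in the orbit of \<open>z\<close> are of the form \<open>Im z / |c z + d|\<^sup>2\<close> with \<open>c + d\<close> odd.
\<close>

lemma invariant_crank_bound:
  assumes z: "Im z > 0" and Y: "Y \<ge> 1"
    and bd: "\<And>c d :: int. odd (c + d) \<Longrightarrow> Im z \<le> Y * (norm (of_int c * z + of_int d))\<^sup>2"
  shows "invariant_crank z \<le> 8 * (Y powr (1/4) * exp (pi * Y / 24))"
proof -
  \<comment> \<open>The orbit enters through what both maps preserve:
    \<open>u = (a z + b) / (c z + d)\<close> with odd row sums, and the resulting imaginary part.
    The shift adds \<open>2 k\<close> times the lower row to the upper one; the inversion exchanges
    the rows up to sign.\<close>
  define orb where "orb u \<longleftrightarrow> Im u > 0 \<and> invariant_crank u = invariant_crank z \<and>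
     (\<exists>a b c d :: int. odd (a + b) \<and> odd (c + d) \<and> u * (of_int c * z + of_int d) = of_int a * z + of_int b \<and>
        Im u * (norm (of_int c * z + of_int d))\<^sup>2 = Im z)" for u
  have orb_z: "orb z" unfolding orb_def using z
    by (intro conjI exI[of _ 1] exI[of _ 0] refl) simp_all
  have orb_shift: "orb (u + 2 * of_int k)" if u: "orb u" for u k
  proof -
    from u obtain a b c d :: int where "Im u > 0" "invariant_crank u = invariant_crank z"
      and abcd: "odd (a + b)" "odd (c + d)" "u * (of_int c * z + of_int d) = of_int a * z + of_int b"
        "Im u * (norm (of_int c * z + of_int d))\<^sup>2 = Im z" unfolding orb_def by blast
    have "odd ((a + 2 * k * c) + (b + 2 * k * d))" using abcd by simp
    moreover have "(u + 2 * of_int k) * (of_int c * z + of_int d) = of_int (a + 2 * k * c) * z + of_int (b + 2 * k * d)"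
      using abcd(3) by (simp add: algebra_simps)
    moreover have "Im (u + 2 * of_int k) = Im u" by simp
    ultimately show ?thesis unfolding orb_def invariant_crank_shift
      using \<open>Im u > 0\<close> \<open>invariant_crank u = invariant_crank z\<close> abcd(2,4) by metis
  qed
  have orb_inv: "orb (- 1 / u)" if u: "orb u" for u
  proof -
    from u obtain a b c d :: int where Im: "Im u > 0" and G: "invariant_crank u = invariant_crank z"
      and abcd: "odd (a + b)" "odd (c + d)" "u * (of_int c * z + of_int d) = of_int a * z + of_int b"
        "Im u * (norm (of_int c * z + of_int d))\<^sup>2 = Im z" unfolding orb_def by blast
    have u0: "u \<noteq> 0" using Im by auto
    have Im': "Im (- 1 / u) > 0" unfolding Im_minus_one_over using Im u0 by simp
    have "odd (- c + - d)" using abcd by simp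
    moreover have "(- 1 / u) * (of_int a * z + of_int b) = of_int (- c) * z + of_int (- d)"
      unfolding abcd(3)[symmetric] using u0 by simp
    moreover have "Im (- 1 / u) * (norm (of_int a * z + of_int b))\<^sup>2 = Im z"
      unfolding abcd(3)[symmetric] abcd(4)[symmetric] Im_minus_one_over using u0
      by (simp add: norm_mult power_mult_distrib)
    ultimately show ?thesis unfolding orb_def
      using Im' G invariant_crank_inversion[OF Im] abcd(1) by metis
  qed
  have val: "\<exists>c d :: int. odd (c + d) \<and> of_int c * z + of_int d \<noteq> 0 \<and> Im u = Im z / (norm (of_int c * z + of_int d))\<^sup>2" if "orb u" for u
  proof -
    from that obtain c d :: int where "odd (c + d)" and e: "Im u * (norm (of_int c * z + of_int d))\<^sup>2 = Im z"
      unfolding orb_def by blast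
    moreover have "norm (of_int c * z + of_int d) \<noteq> 0"
    proof
      assume "norm (of_int c * z + of_int d) = 0"
      with e z show False by simp
    qed
    ultimately show ?thesis by (intro exI[of _ c] exI[of _ d]) (auto simp: field_simps)
  qed
  define V where "V = {Im u | u. orb u \<and> Im u \<ge> Im z}"
  have "V \<subseteq> (\<lambda>(c, d). Im z / (norm (of_int c * z + of_int d))\<^sup>2) ` {(c :: int, d :: int). norm (of_int c * z + of_int d) \<le> 1}"
  proof
    fix v assume "v \<in> V"
    then obtain u where u: "v = Im u" "orb u" "Im u \<ge> Im z" by (auto simp: V_def)
    obtain c d :: int where cd: "of_int c * z + of_int d \<noteq> 0" "Im u = Im z / (norm (of_int c * z + of_int d))\<^sup>2"
      using val[OF u(2)] by blast
    have "(norm (of_int c * z + of_int d))\<^sup>2 \<le> 1\<^sup>2"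
      using u(3) z cd by (simp add: field_simps)
    hence "norm (of_int c * z + of_int d) \<le> 1" by (rule power2_le_imp_le) simp
    thus "v \<in> (\<lambda>(c, d). Im z / (norm (of_int c * z + of_int d))\<^sup>2) ` {(c :: int, d :: int). norm (of_int c * z + of_int d) \<le> 1}"
      using u(1) cd(2) by (intro image_eqI[of _ _ "(c, d)"]) auto
  qed
  hence fin: "finite V" by (rule finite_subset) (intro finite_imageI finite_small_lattice_values z)
  have ne: "V \<noteq> {}" using orb_z by (auto simp: V_def)
  have "Max V \<in> V" by (rule Max_in[OF fin ne])
  then obtain w where w: "orb w" "Im w \<ge> Im z" "Im w = Max V" by (auto simp: V_def)
  obtain k :: int where k: "\<bar>Re w - 2 * of_int k\<bar> \<le> 1" using exists_even_shift by blast
  define u where "u = w + 2 * of_int (- k)"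
  have u: "orb u" "Im u = Max V" "\<bar>Re u\<bar> \<le> 1"
    using orb_shift[OF w(1), of "- k"] w k by (auto simp: u_def)
  have pos: "Im u > 0" using u(1) by (simp add: orb_def)
  \<comment> \<open>Otherwise the inversion would raise the maximal imaginary part.\<close>
  have nu: "norm u \<ge> 1"
  proof (rule ccontr)
    assume "\<not> norm u \<ge> 1"
    moreover have "norm u > 0" using pos by auto
    ultimately have "(norm u)\<^sup>2 < 1" "(norm u)\<^sup>2 > 0" by (auto simp: power_less_one_iff)
    hence "Im (- 1 / u) > Im u" unfolding Im_minus_one_over using pos by (simp add: field_simps)
    moreover have "Im (- 1 / u) \<in> V" using orb_inv[OF u(1)] \<open>Im (- 1 / u) > Im u\<close> u(2) w unfolding V_def by fastforce
    hence "Im (- 1 / u) \<le> Max V" by (rule Max_ge[OF fin])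
    ultimately show False using u(2) by simp
  qed
  have "Im u \<le> Y"
  proof -
    obtain c d :: int where cd: "odd (c + d)" "of_int c * z + of_int d \<noteq> 0" "Im u = Im z / (norm (of_int c * z + of_int d))\<^sup>2"
      using val[OF u(1)] by blast
    have "(norm (of_int c * z + of_int d))\<^sup>2 > 0" using cd(2) by simp
    thus ?thesis using bd[OF cd(1)] unfolding cd(3) by (simp add: pos_divide_le_eq)
  qed
  have Y1: "1 \<le> Y powr (1/4) * exp (pi * Y / 24)"
  proof -
    have "1 * 1 \<le> Y powr (1/4) * exp (pi * Y / 24)"
      using Y by (intro mult_mono) (auto simp: ge_one_powr_ge_zero)
    thus ?thesis by simp
  qed
  have "invariant_crank z = invariant_crank u" using u(1) by (simp add: orb_def)
  also have "\<dots> \<le> 8 * (Y powr (1/4) * exp (pi * Y / 24))"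
  proof (cases "Im u \<ge> 1 / 2")
    case True
    have "invariant_crank u \<le> 8 * (Im u powr (1/4) * exp (pi * Im u / 24))" by (rule invariant_crank_high[OF True])
    also have "\<dots> \<le> 8 * (Y powr (1/4) * exp (pi * Y / 24))"
      using \<open>Im u \<le> Y\<close> pos by (intro mult_left_mono mult_mono powr_mono2) auto
    finally show ?thesis .
  next
    case False
    hence "invariant_crank u \<le> 8" using pos nu u(3) by (intro invariant_crank_near_odd_cusp) auto
    thus ?thesis using Y1 by linarith
  qed
  finally show ?thesis .
qed

text \<open>With \<open>z = 2 t\<close> and \<open>Y = 1 / (8 y)\<close> the hypothesis of
  \<open>invariant_crank_bound\<close> reads \<open>16 y\<^sup>2 \<le> |c z + d|\<^sup>2\<close>.
  The pair with \<open>|c| = 1\<close>, \<open>d = 0\<close> uses \<open>|x| \<ge> sqrt 3 y\<close>.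
  For \<open>|c| \<ge> 2\<close> the imaginary part suffices, and for \<open>|c| = 1\<close> parity
  makes a nonzero \<open>d\<close> even, while \<open>|2 x| \<le> 1\<close>.\<close>

lemma norm_crank_eta_minor_arc:
  fixes x y :: real
  assumes y: "0 < y" "y \<le> 1 / 8" and x: "\<bar>x\<bar> \<le> 1 / 2" "3 * y\<^sup>2 \<le> x\<^sup>2"
  shows "norm (crank_eta (Complex x y)) \<le> 4 / sqrt y * exp (pi / (192 * y))"
proof -
  define z where "z = Complex (2 * x) (2 * y)"
  define Y where "Y = 1 / (8 * y)"
  have Y: "Y \<ge> 1" using y by (simp add: Y_def field_simps)
  have "invariant_crank z \<le> 8 * (Y powr (1/4) * exp (pi * Y / 24))"
  proof (rule invariant_crank_bound[OF _ Y])
    show "Im z > 0" using y by (simp add: z_def)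
    fix c d :: int assume cd: "odd (c + d)"
    have n: "(norm (of_int c * z + of_int d))\<^sup>2 = (2 * of_int c * x + of_int d)\<^sup>2 + 4 * (of_int c)\<^sup>2 * y\<^sup>2"
      unfolding cmod_power2 by (simp add: z_def power2_eq_square algebra_simps)
    have "16 * y\<^sup>2 \<le> (2 * of_int c * x + of_int d)\<^sup>2 + 4 * (of_int c)\<^sup>2 * y\<^sup>2"
    proof -
      have y16: "16 * y\<^sup>2 \<le> 1"
        using power_mono[of y "1/8" 2] y by (simp add: power2_eq_square)
      consider "c = 0" | "\<bar>c\<bar> \<ge> 2" | "\<bar>c\<bar> = 1" "d = 0" | "\<bar>c\<bar> = 1" "d \<noteq> 0" by linarith
      thus ?thesis
      proof cases
        case 1
        hence "d \<noteq> 0" using cd by auto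
        hence "\<bar>d\<bar> \<ge> 1" by linarith
        hence "1 \<le> \<bar>real_of_int d\<bar>" by linarith
        hence "1 \<le> (real_of_int d)\<^sup>2" using power_mono[of 1 "\<bar>real_of_int d\<bar>" 2] by simp
        thus ?thesis using 1 y16 by simp
      next
        case 2
        hence "2 \<le> \<bar>real_of_int c\<bar>" by linarith
        hence "4 \<le> (real_of_int c)\<^sup>2" using power_mono[of 2 "\<bar>real_of_int c\<bar>" 2] by simp
        hence "4 * 4 * y\<^sup>2 \<le> 4 * (real_of_int c)\<^sup>2 * y\<^sup>2" by (intro mult_right_mono) auto
        thus ?thesis using zero_le_power2[of "2 * of_int c * x + of_int d"] by linarith
      next
        case 3
        hence "(real_of_int c)\<^sup>2 = 1" by (auto simp: abs_if split: if_splits)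
        thus ?thesis using 3 x(2) by (simp add: power_mult_distrib)
      next
        case 4
        have "\<bar>d\<bar> \<ge> 2"
        proof (rule ccontr)
          assume "\<not> \<bar>d\<bar> \<ge> 2"
          hence "d = 1 \<or> d = - 1" using 4 by linarith
          moreover have "c = 1 \<or> c = - 1" using 4 by linarith
          ultimately show False using cd by auto
        qed
        hence "2 \<le> \<bar>real_of_int d\<bar>" by linarith
        moreover have "\<bar>real_of_int c\<bar> = 1" using 4(1) by linarith
        hence "\<bar>2 * of_int c * x\<bar> \<le> 1" using x(1) by (simp add: abs_mult)
        ultimately have "1 \<le> \<bar>2 * of_int c * x + of_int d\<bar>" by linarith
        hence "1 \<le> (2 * of_int c * x + of_int d)\<^sup>2" using power_mono[of 1 "\<bar>2 * of_int c * x + of_int d\<bar>" 2] by simp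
        moreover have "0 \<le> 4 * (real_of_int c)\<^sup>2 * y\<^sup>2" by simp
        ultimately show ?thesis using y16 by linarith
      qed
    qed
    hence "Y * (16 * y\<^sup>2) \<le> Y * (norm (of_int c * z + of_int d))\<^sup>2" unfolding n
      using Y by (intro mult_left_mono) auto
    moreover have "Y * (16 * y\<^sup>2) = Im z" using y by (simp add: Y_def z_def power2_eq_square)
    ultimately show "Im z \<le> Y * (norm (of_int c * z + of_int d))\<^sup>2" by simp
  qed
  moreover have "z / 2 = Complex x y" by (simp add: z_def complex_eq_iff)
  ultimately have "(2 * y) powr (1/4) * norm (crank_eta (Complex x y)) \<le> 8 * (Y powr (1/4) * exp (pi * Y / 24))"
    by (simp add: invariant_crank_def z_def)
  hence "norm (crank_eta (Complex x y)) \<le> 8 * (Y powr (1/4) / (2 * y) powr (1/4)) * exp (pi * Y / 24)"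
    using y by (simp add: field_simps)
  \<comment> \<open>Since \<open>Y / (2 y) = 1 / (4 y)\<^sup>2\<close>; the factor 8 thus becomes
    \<open>4 / sqrt y\<close>.\<close>
  also have "Y powr (1/4) / (2 * y) powr (1/4) = 1 / (2 * sqrt y)"
  proof -
    have "Y powr (1/4) / (2 * y) powr (1/4) = (1 / (4 * y)\<^sup>2) powr (1/4)"
      using y unfolding Y_def by (subst powr_divide[symmetric]) (auto simp: power2_eq_square)
    also have "\<dots> = 1 / (4 * y) powr (1/2)"
    proof -
      have "k\<^sup>2 powr (1/4) = k powr (1/2)" if "k > 0" for k :: real
        using that by (simp add: powr_powr flip: powr_numeral)
      from this[of "4 * y"] show ?thesis using y by (simp only: powr_divide powr_one_eq_one)
    qed
    also have "(4 * y) powr (1/2) = 2 * sqrt y" using y by (simp add: powr_half_sqrt real_sqrt_mult)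
    finally show ?thesis .
  qed
  also have "pi * Y / 24 = pi / (192 * y)" by (simp add: Y_def)
  finally show ?thesis by simp
qed

section \<open>The saddle point integral\<close>

lemma gaussian_has_integral_shift:
  "((\<lambda>x::real. exp (- (x + t)\<^sup>2)) has_integral sqrt pi) UNIV"
proof -
  have "has_bochner_integral lborel (\<lambda>x::real. exp (- x\<^sup>2)) (sqrt pi / 2 + sqrt pi / 2)"
    using has_bochner_integral_even_function[OF gaussian_moment_0] by simp
  hence "has_bochner_integral lborel (\<lambda>x::real. exp (- (t + 1 * x)\<^sup>2)) (sqrt pi /\<^sub>R \<bar>1\<bar>)"
    by (subst (asm) lborel_has_bochner_integral_real_affine_iff[where c = 1 and t = t]) simp_all
  hence "has_bochner_integral lborel (\<lambda>x::real. exp (- (x + t)\<^sup>2)) (sqrt pi)"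
    by (simp add: add.commute)
  thus ?thesis using has_integral_integral_real[of "\<lambda>x::real. exp (- (x + t)\<^sup>2)"]
    by (simp add: has_bochner_integral_iff)
qed

text \<open>For \<open>s \<ge> b \<ge> 0\<close> one has
  \<open>s\<^sup>2 \<ge> b\<^sup>2 + (s - b)\<^sup>2\<close>, so each tail is at most
  \<open>exp (- b\<^sup>2)\<close> times a full Gaussian integral shifted by
  \<open>b\<close>.\<close>

lemma truncated_gaussian_bound:
  fixes b :: real
  assumes b: "b \<ge> 0" and K: "((\<lambda>s. exp (- s\<^sup>2)) has_integral K) {-b..b}"
  shows "\<bar>sqrt pi - K\<bar> \<le> 2 * sqrt pi * exp (- b\<^sup>2)"
proof -
  have g: "((\<lambda>x::real. exp (- x\<^sup>2)) has_integral sqrt pi) UNIV"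
    using gaussian_has_integral_shift[of 0] by simp
  have "K \<le> sqrt pi"
    by (rule has_integral_subset_le[OF _ K g]) auto
  moreover have "sqrt pi \<le> K + exp (- b\<^sup>2) * (sqrt pi + sqrt pi)"
  proof (rule has_integral_le[OF g])
    have "((\<lambda>s. if s \<in> {-b..b} then exp (- s\<^sup>2) else 0) has_integral K) UNIV"
      using K by (subst has_integral_restrict_UNIV)
    thus "((\<lambda>s. (if s \<in> {-b..b} then exp (- s\<^sup>2) else 0) + exp (- b\<^sup>2) * (exp (- (s + - b)\<^sup>2) + exp (- (s + b)\<^sup>2)))
        has_integral (K + exp (- b\<^sup>2) * (sqrt pi + sqrt pi))) UNIV"
      by (intro has_integral_add has_integral_mult_right gaussian_has_integral_shift)
    fix s :: real
    consider "s \<in> {-b..b}" | "s > b" | "s < - b" by fastforce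
    thus "exp (- s\<^sup>2) \<le> (if s \<in> {-b..b} then exp (- s\<^sup>2) else 0) + exp (- b\<^sup>2) * (exp (- (s + - b)\<^sup>2) + exp (- (s + b)\<^sup>2))"
    proof cases
      case 2
      have "0 \<le> b * (s - b)" using 2 b by (intro mult_nonneg_nonneg) auto
      hence "exp (- s\<^sup>2) \<le> exp (- b\<^sup>2 + - (s + - b)\<^sup>2)" by (simp add: power2_eq_square algebra_simps)
      also have "\<dots> = exp (- b\<^sup>2) * exp (- (s + - b)\<^sup>2)" by (rule exp_add)
      also have "\<dots> \<le> exp (- b\<^sup>2) * (exp (- (s + - b)\<^sup>2) + exp (- (s + b)\<^sup>2))" by (intro mult_left_mono) auto
      finally show ?thesis using 2 by simp
    next
      case 3
      have "0 \<le> b * (- s - b)" using 3 b by (intro mult_nonneg_nonneg) auto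
      hence "exp (- s\<^sup>2) \<le> exp (- b\<^sup>2 + - (s + b)\<^sup>2)" by (simp add: power2_eq_square algebra_simps)
      also have "\<dots> = exp (- b\<^sup>2) * exp (- (s + b)\<^sup>2)" by (rule exp_add)
      also have "\<dots> \<le> exp (- b\<^sup>2) * (exp (- (s + - b)\<^sup>2) + exp (- (s + b)\<^sup>2))" by (intro mult_left_mono) auto
      finally show ?thesis using 3 by simp
    qed auto
  qed
  ultimately show ?thesis by (simp add: abs_le_iff algebra_simps)
qed

text \<open>A multiple of the imaginary error function, up to a constant. It is entire, so the
  substitutions in the saddle point integral need only its values at the endpoints; along the
  imaginary axis its derivative is the Gaussian.\<close>

lemma exp_square_primitive:
  obtains D :: "complex \<Rightarrow> complex" where
    "\<And>p. (D has_field_derivative exp (p\<^sup>2)) (at p)"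
    "\<And>b::real. b \<ge> 0 \<Longrightarrow> \<exists>K. D (\<i> * b) - D (- (\<i> * b)) = \<i> * of_real K \<and> \<bar>sqrt pi - K\<bar> \<le> 2 * sqrt pi * exp (- b\<^sup>2)"
proof -
  have "(\<lambda>p. exp (p\<^sup>2)) holomorphic_on UNIV" by (intro holomorphic_intros)
  from holomorphic_convex_primitive'[OF convex_UNIV open_UNIV this]
  obtain D :: "complex \<Rightarrow> complex" where D: "\<And>p. (D has_field_derivative exp (p\<^sup>2)) (at p)" by auto
  have "\<exists>K. D (\<i> * b) - D (- (\<i> * b)) = \<i> * of_real K \<and> \<bar>sqrt pi - K\<bar> \<le> 2 * sqrt pi * exp (- b\<^sup>2)"
    if b: "b \<ge> 0" for b :: real
  proof -
    have "((\<lambda>s. \<i> * of_real (exp (- s\<^sup>2))) has_integral (D (\<i> * of_real b) - D (\<i> * of_real (- b)))) {- b..b}"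
    proof (rule fundamental_theorem_of_calculus)
      fix s assume "s \<in> {- b..b}"
      have "((\<lambda>s. D (\<i> * s)) has_field_derivative (exp ((\<i> * of_real s)\<^sup>2) * \<i>)) (at (of_real s))"
        by (rule DERIV_chain'[OF _ D]) (auto intro!: derivative_eq_intros)
      hence "((\<lambda>s. D (\<i> * of_real s)) has_vector_derivative (\<i> * exp ((\<i> * of_real s)\<^sup>2))) (at s)"
        using has_vector_derivative_real_field[of "\<lambda>s. D (\<i> * s)"] by (simp add: mult.commute)
      moreover have "exp ((\<i> * of_real s)\<^sup>2) = complex_of_real (exp (- s\<^sup>2))"
        by (simp add: power_mult_distrib exp_of_real[symmetric])
      ultimately show "((\<lambda>s. D (\<i> * of_real s)) has_vector_derivative (\<i> * of_real (exp (- s\<^sup>2)))) (at s within {- b..b})"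
        by (simp add: has_vector_derivative_at_within)
    qed (use b in auto)
    moreover obtain K where K: "((\<lambda>s. exp (- s\<^sup>2)) has_integral K) {-b..b}"
    proof -
      have "(\<lambda>s::real. exp (- s\<^sup>2)) integrable_on {-b..b}"
        by (intro integrable_continuous_real continuous_intros)
      thus ?thesis using that by (auto simp: integrable_on_def)
    qed
    hence "((\<lambda>s. \<i> * of_real (exp (- s\<^sup>2))) has_integral (\<i> * of_real K)) {- b..b}"
      by (intro has_integral_mult_right has_integral_of_real)
    ultimately have "D (\<i> * of_real b) - D (\<i> * of_real (- b)) = \<i> * of_real K" by (rule has_integral_unique)
    thus ?thesis using truncated_gaussian_bound[OF b K] by auto
  qed
  thus ?thesis using that D by blast
qed

text \<open>
  For \<open>a z + b / z\<close> with \<open>b = 4 a y\<^sup>2\<close>, put \<open>w = sqrt z\<close>, \<open>p = sqrt a w - sqrt b / w\<close> and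
  \<open>m = sqrt a w + sqrt b / w\<close>, so that \<open>a z + b / z = p\<^sup>2 + 2 sqrt (a b) = m\<^sup>2 - 2 sqrt (a b)\<close> and
  \<open>2 sqrt a dw = dp + dm\<close>. The endpoints \<open>y \<plusminus> \<i> sqrt 3 y\<close> have modulus \<open>2 y = sqrt (b / a)\<close>, which makes
  \<open>m\<close> equal and \<open>p\<close> purely imaginary there.
\<close>

lemma saddle_point_integral:
  fixes a y :: real
  assumes a: "a > 0" and y: "y > 0"
  obtains I where
    "((\<lambda>x. exp (a * (y - \<i> * x) + 4 * a * y\<^sup>2 / (y - \<i> * x)) / csqrt (2 * (y - \<i> * x))) has_integral I) {- (sqrt 3 * y)..sqrt 3 * y}"
    "norm (I - of_real (sqrt pi / sqrt (2 * a) * exp (4 * a * y))) \<le> 2 * sqrt pi / sqrt (2 * a) * exp (2 * a * y)"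
proof -
  obtain D where D: "\<And>p. (D has_field_derivative exp (p\<^sup>2)) (at p)"
    and DK: "\<And>b::real. b \<ge> 0 \<Longrightarrow> \<exists>K. D (\<i> * b) - D (- (\<i> * b)) = \<i> * of_real K \<and> \<bar>sqrt pi - K\<bar> \<le> 2 * sqrt pi * exp (- b\<^sup>2)"
    using exp_square_primitive by blast
  define r where "r = sqrt a"
  have r: "r > 0" "r\<^sup>2 = a" using a by (auto simp: r_def)
  \<comment> \<open>With \<open>b = 4 a y\<^sup>2\<close> the coefficient \<open>2 r y\<close> is
    \<open>sqrt b\<close>, hence \<open>2 sqrt (a b) = 4 a y\<close>.\<close>
  define P where "P z = r * csqrt z - 2 * r * y / csqrt z" for z :: complex
  define M where "M z = r * csqrt z + 2 * r * y / csqrt z" for z :: complex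
  \<comment> \<open>The factor \<open>\<i>\<close> compensates \<open>dz = - \<i> dx\<close> along
    the segment.\<close>
  define \<Phi> where "\<Phi> z = \<i> * sqrt 2 / (2 * r) * (exp (4 * a * y) * D (P z) + exp (- (4 * a * y)) * D (M z))" for z :: complex
  define f where "f z = exp (a * z + 4 * a * y\<^sup>2 / z) / csqrt (2 * z)" for z :: complex
  have der: "(\<Phi> has_field_derivative (\<i> * f z)) (at z)" if z: "Re z > 0" for z :: complex
  proof -
    define w where "w = csqrt z"
    have z0: "z \<noteq> 0" using z by auto
    have w: "w \<noteq> 0" "w\<^sup>2 = z" using z0 by (auto simp: w_def)
    have nn: "z \<notin> \<real>\<^sub>\<le>\<^sub>0" using z by (auto simp: complex_nonpos_Reals_iff)
    have dw: "(csqrt has_field_derivative inverse (2 * w)) (at z)"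
      unfolding w_def using nn by (rule has_field_derivative_csqrt)
    have dP: "(P has_field_derivative (r + 2 * r * y / w\<^sup>2) * inverse (2 * w)) (at z)"
      unfolding P_def using w(1) dw nn
      by (auto intro!: derivative_eq_intros simp: w_def[symmetric] field_simps power2_eq_square)
    have dM: "(M has_field_derivative (r - 2 * r * y / w\<^sup>2) * inverse (2 * w)) (at z)"
      unfolding M_def using w(1) dw nn
      by (auto intro!: derivative_eq_intros simp: w_def[symmetric] field_simps power2_eq_square)
    have d\<Phi>: "(\<Phi> has_field_derivative (\<i> * sqrt 2 / (2 * r) * (exp (4 * a * y) * (exp ((P z)\<^sup>2) * ((r + 2 * r * y / w\<^sup>2) * inverse (2 * w)))
        + exp (- (4 * a * y)) * (exp ((M z)\<^sup>2) * ((r - 2 * r * y / w\<^sup>2) * inverse (2 * w)))))) (at z)"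
      unfolding \<Phi>_def by (intro DERIV_cmult DERIV_add DERIV_chain'[OF dP D] DERIV_chain'[OF dM D])
    define e where "e = exp (a * z + 4 * a * y\<^sup>2 / z)"
    have a': "complex_of_real a = of_real r ^ 2" using r by (simp flip: of_real_power)
    have PM: "P z = r * w - 2 * r * y / w" "M z = r * w + 2 * r * y / w"
      by (simp_all add: P_def M_def w_def)
    have eqs: "4 * a * y + (P z)\<^sup>2 = a * z + 4 * a * y\<^sup>2 / z" "- (4 * a * y) + (M z)\<^sup>2 = a * z + 4 * a * y\<^sup>2 / z"
      unfolding PM unfolding w(2)[symmetric] a' of_real_minus of_real_mult of_real_power of_real_numeral
      using w(1) by (simp_all add: field_simps power2_eq_square)
    have e: "exp (4 * a * y) * exp ((P z)\<^sup>2) = e" "exp (- (4 * a * y)) * exp ((M z)\<^sup>2) = e"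
      unfolding e_def exp_of_real[symmetric] exp_add[symmetric] eqs by (rule refl)+
    have "exp (4 * a * y) * (exp ((P z)\<^sup>2) * ((r + 2 * r * y / w\<^sup>2) * inverse (2 * w)))
        + exp (- (4 * a * y)) * (exp ((M z)\<^sup>2) * ((r - 2 * r * y / w\<^sup>2) * inverse (2 * w))) = e * (r / w)"
      unfolding mult.assoc[symmetric, of _ "exp (_\<^sup>2)"] e using w by (simp add: field_simps)
    moreover have "\<i> * sqrt 2 / (2 * r) * (e * (r / w)) = \<i> * f z"
    proof -
      have "csqrt (2 * z) = sqrt 2 * w" unfolding w_def using csqrt_of_real_mult[of 2 z] by simp
      moreover have "complex_of_real (sqrt 2) * of_real (sqrt 2) = 2" by (simp flip: of_real_mult)
      ultimately show ?thesis unfolding f_def e_def[symmetric] using r w by (simp add: field_simps)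
    qed
    ultimately show ?thesis using d\<Phi> by simp
  qed
  define \<delta> where "\<delta> = sqrt 3 * y"
  have \<delta>: "\<delta> > 0" "\<delta>\<^sup>2 = 3 * y\<^sup>2" using y by (auto simp: \<delta>_def power_mult_distrib)
  define Z where "Z x = complex_of_real y - \<i> * of_real x" for x
  have int: "((\<lambda>x. f (Z x)) has_integral (\<Phi> (Z \<delta>) - \<Phi> (Z (- \<delta>)))) {- \<delta>..\<delta>}"
  proof (rule fundamental_theorem_of_calculus)
    fix x assume "x \<in> {- \<delta>..\<delta>}"
    have "((\<lambda>x. \<Phi> (complex_of_real y - \<i> * x)) has_field_derivative (\<i> * f (Z x) * (- \<i>))) (at (of_real x))"
      unfolding Z_def by (rule DERIV_chain'[OF _ der]) (use y in \<open>auto intro!: derivative_eq_intros\<close>)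
    hence "((\<lambda>x. \<Phi> (complex_of_real y - \<i> * x)) has_field_derivative f (Z x)) (at (of_real x) within UNIV)"
      by (rule DERIV_cong) (simp add: complex_eq_iff)
    from has_vector_derivative_real_field[OF this]
    show "((\<lambda>x. \<Phi> (Z x)) has_vector_derivative f (Z x)) (at x within {- \<delta>..\<delta>})"
      unfolding Z_def by (simp add: has_vector_derivative_at_within)
  qed (use \<delta> in auto)
  define w where "w = csqrt (Z (- \<delta>))"
  define \<beta> where "\<beta> = 2 * r * Im w"
  have Zc: "Z \<delta> = cnj (Z (- \<delta>))" by (simp add: Z_def)
  have nn: "Z (- \<delta>) \<notin> \<real>\<^sub>\<le>\<^sub>0" using y by (auto simp: Z_def complex_nonpos_Reals_iff)
  have wc: "csqrt (Z \<delta>) = cnj w" unfolding Zc w_def using nn by (rule cnj_csqrt[symmetric])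
  have nZ: "norm (Z (- \<delta>)) = 2 * y"
  proof -
    have "(norm (Z (- \<delta>)))\<^sup>2 = (2 * y)\<^sup>2" using \<delta> by (simp add: cmod_power2 Z_def power_mult_distrib)
    thus ?thesis by (rule power2_eq_imp_eq) (use y in auto)
  qed
  have w2: "w\<^sup>2 = Z (- \<delta>)" by (simp add: w_def)
  have ww: "w * cnj w = of_real (2 * y)"
  proof -
    have "(norm w)\<^sup>2 = 2 * y" using nZ unfolding w2[symmetric] by (simp add: norm_power)
    thus ?thesis by (simp only: complex_norm_square[symmetric] of_real_power)
  qed
  have w0: "w \<noteq> 0" using ww y by auto
  have "Re (w\<^sup>2) = y" unfolding w2 by (simp add: Z_def)
  hence "(Re w)\<^sup>2 - (Im w)\<^sup>2 = y" by (simp add: power2_eq_square)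
  moreover have "(Re w)\<^sup>2 + (Im w)\<^sup>2 = 2 * y"
    using arg_cong[OF ww, of Re] by (simp add: power2_eq_square)
  ultimately have Imw: "(Im w)\<^sup>2 = y / 2" by simp
  have "Im w \<ge> 0"
  proof -
    have "Im (w\<^sup>2) > 0" unfolding w2 using \<delta> by (simp add: Z_def)
    hence "2 * (Re w * Im w) > 0" by (simp add: power2_eq_square mult.commute)
    moreover have "Re w \<ge> 0" unfolding w_def using csqrt_principal[of "Z (- \<delta>)"] by auto
    ultimately show ?thesis by (smt (verit) mult_nonneg_nonpos)
  qed
  hence \<beta>: "\<beta> \<ge> 0" "\<beta>\<^sup>2 = 2 * a * y" using r Imw by (auto simp: \<beta>_def power_mult_distrib)
  \<comment> \<open>As \<open>|w|\<^sup>2 = 2 y\<close>, the second terms of \<open>P\<close> and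
    \<open>M\<close> are the conjugates of the first. At the endpoints \<open>P\<close> is therefore
    plus or minus \<open>2 r \<i> Im w\<close>, and \<open>M\<close> is \<open>2 r Re w\<close> at
    both.\<close>
  have q: "2 * r * y / w = r * cnj w" "2 * r * y / cnj w = r * w"
    using ww w0 by (auto simp: field_simps)
  have diff: "w - cnj w = \<i> * (2 * Im w)" by (simp add: complex_eq_iff)
  have P1: "P (Z (- \<delta>)) = \<i> * \<beta>" "P (Z \<delta>) = - (\<i> * \<beta>)"
    unfolding P_def wc w_def[symmetric] q \<beta>_def using diff by (auto simp: algebra_simps complex_eq_iff)
  have M1: "M (Z (- \<delta>)) = M (Z \<delta>)"
    unfolding M_def wc w_def[symmetric] q by (simp add: add.commute)
  obtain K where K: "D (\<i> * \<beta>) - D (- (\<i> * \<beta>)) = \<i> * of_real K" "\<bar>sqrt pi - K\<bar> \<le> 2 * sqrt pi * exp (- \<beta>\<^sup>2)"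
    using DK[OF \<beta>(1)] by blast
  have "\<Phi> (Z \<delta>) - \<Phi> (Z (- \<delta>)) = - (\<i> * sqrt 2 / (2 * r) * exp (4 * a * y) * (D (\<i> * \<beta>) - D (- (\<i> * \<beta>))))"
  proof -
    have "c * (e * A + X) - c * (e * B + X) = - (c * e * (B - A))" for c e A B X :: complex by algebra
    thus ?thesis unfolding \<Phi>_def P1 M1 by blast
  qed
  also have "\<dots> = of_real (K / sqrt (2 * a) * exp (4 * a * y))"
  proof -
    have "sqrt (2 * a) = sqrt 2 * r" by (simp add: real_sqrt_mult r_def)
    moreover have "sqrt 2 / (2 * r) = 1 / (sqrt 2 * r)" using r(1) by (simp add: field_simps)
    ultimately have "K / sqrt (2 * a) * exp (4 * a * y) = sqrt 2 / (2 * r) * exp (4 * a * y) * K" by simp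
    thus ?thesis unfolding K(1) by (simp add: exp_of_real[symmetric] mult_ac)
  qed
  finally have val: "\<Phi> (Z \<delta>) - \<Phi> (Z (- \<delta>)) = of_real (K / sqrt (2 * a) * exp (4 * a * y))" .
  show ?thesis
  proof (rule that)
    show "((\<lambda>x. exp (a * (y - \<i> * x) + 4 * a * y\<^sup>2 / (y - \<i> * x)) / csqrt (2 * (y - \<i> * x))) has_integral of_real (K / sqrt (2 * a) * exp (4 * a * y))) {- (sqrt 3 * y)..sqrt 3 * y}"
      using int[unfolded val] unfolding f_def Z_def \<delta>_def by simp
    have "norm (of_real (K / sqrt (2 * a) * exp (4 * a * y)) - complex_of_real (sqrt pi / sqrt (2 * a) * exp (4 * a * y))) =
       \<bar>K / sqrt (2 * a) * exp (4 * a * y) - sqrt pi / sqrt (2 * a) * exp (4 * a * y)\<bar>"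
      by (simp only: of_real_diff[symmetric] norm_of_real)
    also have "K / sqrt (2 * a) * exp (4 * a * y) - sqrt pi / sqrt (2 * a) * exp (4 * a * y) = - ((sqrt pi - K) * (exp (4 * a * y) / sqrt (2 * a)))"
      by (simp add: left_diff_distrib diff_divide_distrib)
    also have "\<bar>\<dots>\<bar> = \<bar>sqrt pi - K\<bar> * (exp (4 * a * y) / sqrt (2 * a))"
      using a by (simp add: abs_mult)
    also have "\<dots> \<le> (2 * sqrt pi * exp (- \<beta>\<^sup>2)) * (exp (4 * a * y) / sqrt (2 * a))"
      using K(2) a by (intro mult_right_mono) auto
    also have "\<dots> = 2 * sqrt pi / sqrt (2 * a) * (exp (4 * a * y) * exp (- \<beta>\<^sup>2))" by simp
    \<comment> \<open>The truncation gains \<open>\<beta>\<^sup>2 = 2 a y\<close>, which halves the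
      exponent of the main term.\<close>
    also have "exp (4 * a * y) * exp (- \<beta>\<^sup>2) = exp (2 * a * y)" unfolding \<beta>(2) by (simp flip: exp_add)
    finally show "norm (of_real (K / sqrt (2 * a) * exp (4 * a * y)) - complex_of_real (sqrt pi / sqrt (2 * a) * exp (4 * a * y)))
       \<le> 2 * sqrt pi / sqrt (2 * a) * exp (2 * a * y)" .
  qed
qed

section \<open>Coefficients as integrals over a horizontal segment\<close>

lemma nome_power_integral:
  fixes y :: real and k :: int
  shows "((\<lambda>x. exp (2 * pi * \<i> * of_int k * (of_real x + \<i> * y))) has_integral (if k = 0 then 1 else 0)) {-1/2..1/2}"
proof (cases "k = 0")
  case True
  have "((\<lambda>x::real. 1 :: complex) has_integral (1/2 - (-1/2)) *\<^sub>R 1) {-1/2..1/2}"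
    using has_integral_const_real[of "1::complex" "-1/2" "1/2"] by simp
  thus ?thesis using True by simp
next
  case False
  define c where "c = 2 * pi * \<i> * of_int k"
  have c: "c \<noteq> 0" using False by (simp add: c_def)
  define g where "g x = exp (c * (x + \<i> * y)) / c" for x
  have "((\<lambda>x. exp (c * (of_real x + \<i> * y))) has_integral (g (of_real (1/2)) - g (of_real (-1/2)))) {-1/2..1/2}"
  proof (rule fundamental_theorem_of_calculus)
    fix x :: real
    have "(g has_field_derivative exp (c * (of_real x + \<i> * y))) (at (of_real x))"
      unfolding g_def using c by (auto intro!: derivative_eq_intros)
    from has_vector_derivative_real_field[OF this]
    show "((\<lambda>x. g (of_real x)) has_vector_derivative exp (c * (of_real x + \<i> * y))) (at x within {-1/2..1/2})"
      by (simp add: has_vector_derivative_at_within)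
  qed simp
  moreover have "g (of_real (1/2)) = g (of_real (-1/2))"
  proof -
    have "c * (of_real (1/2) + \<i> * y) = c * (of_real (-1/2) + \<i> * y) + (2 * of_int k * pi) * \<i>"
      by (simp add: c_def algebra_simps)
    thus ?thesis unfolding g_def by (simp only: exp_add exp_integer_2pi Ints_of_int) simp
  qed
  ultimately show ?thesis using False by (simp add: c_def)
qed

text \<open>Cauchy's coefficient formula on the circle of radius \<open>exp (- 2 pi y)\<close>, by
  termwise integration and orthogonality.\<close>

lemma coefficient_integral:
  fixes c :: "nat \<Rightarrow> complex" and f :: "complex \<Rightarrow> complex" and y :: real
  assumes sums: "\<And>q. norm q < 1 \<Longrightarrow> (\<lambda>n. c n * q ^ n) sums f q" and y: "y > 0"
  shows "((\<lambda>x. f (exp (2 * pi * \<i> * (of_real x + \<i> * y))) * exp (- (2 * pi * \<i> * of_nat n * (of_real x + \<i> * y)))) has_integral c n) {-1/2..1/2}"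
proof -
  define Q where "Q x = exp (2 * pi * \<i> * (of_real x + \<i> * y))" for x
  define R where "R x = exp (- (2 * pi * \<i> * of_nat n * (of_real x + \<i> * y)))" for x
  define r where "r = exp (- (2 * pi * y))"
  have r: "0 < r" "r < 1" using y by (auto simp: r_def)
  have nQ: "norm (Q x) = r" for x by (simp add: Q_def r_def)
  have nR: "norm (R x) = exp (2 * pi * n * y)" for x by (simp add: R_def)
  have sm: "summable (\<lambda>k. norm (c k) * r ^ k)"
  proof -
    \<comment> \<open>Convergence at a radius strictly between \<open>r\<close> and 1 gives absolute
      convergence at \<open>r\<close>.\<close>
    define s where "s = (1 + r) / 2"
    have s: "r < s" "s < 1" using r by (auto simp: s_def)
    have "summable (\<lambda>k. c k * of_real s ^ k)" using sums[of "of_real s"] s r by (auto dest: sums_summable)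
    from powser_insidea[OF this, of "of_real r"] s r show ?thesis by (simp add: norm_mult norm_power)
  qed
  have "uniform_limit {-1/2..1/2} (\<lambda>N x. \<Sum>k<N. c k * Q x ^ k * R x) (\<lambda>x. \<Sum>k. c k * Q x ^ k * R x) sequentially"
  proof (rule Weierstrass_m_test)
    show "summable (\<lambda>k. norm (c k) * r ^ k * exp (2 * pi * n * y))" using sm by (rule summable_mult2)
    show "norm (c k * Q x ^ k * R x) \<le> norm (c k) * r ^ k * exp (2 * pi * n * y)" for k x
      by (simp add: norm_mult norm_power nQ nR)
  qed
  moreover have "(\<Sum>k. c k * Q x ^ k * R x) = f (Q x) * R x" for x
    using sums[of "Q x"] nQ[of x] r by (intro sums_unique[symmetric] sums_mult2) auto
  ultimately have u: "uniform_limit {-1/2..1/2} (\<lambda>N x. \<Sum>k<N. c k * Q x ^ k * R x) (\<lambda>x. f (Q x) * R x) sequentially"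
    by simp
  have cont: "continuous_on {-1/2..1/2} (\<lambda>x. \<Sum>k<N. c k * Q x ^ k * R x)" for N
    unfolding Q_def R_def by (intro continuous_intros)
  obtain I J where I: "\<And>N. ((\<lambda>x. \<Sum>k<N. c k * Q x ^ k * R x) has_integral I N) {-1/2..1/2}"
    and J: "((\<lambda>x. f (Q x) * R x) has_integral J) {-1/2..1/2}" and lim: "I \<longlonglongrightarrow> J"
    using uniform_limit_integral[OF u cont] by auto
  have "I N = c n" if "N > n" for N
  proof -
    have "((\<lambda>x. \<Sum>k<N. c k * Q x ^ k * R x) has_integral (\<Sum>k<N. c k * (if int k - int n = 0 then 1 else 0))) {-1/2..1/2}"
    proof (rule has_integral_sum)
      fix k assume "k \<in> {..<N}"
      have "Q x ^ k * R x = exp (2 * pi * \<i> * of_int (int k - int n) * (of_real x + \<i> * y))" for x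
        unfolding Q_def R_def exp_of_nat_mult[symmetric] exp_add[symmetric] by (simp add: algebra_simps)
      thus "((\<lambda>x. c k * Q x ^ k * R x) has_integral c k * (if int k - int n = 0 then 1 else 0)) {-1/2..1/2}"
        using has_integral_mult_right[OF nome_power_integral[of "int k - int n" y], of "c k"] by (simp only: mult.assoc)
    qed simp
    from has_integral_unique[OF I[of N] this]
    have "I N = (\<Sum>k<N. c k * (if int k - int n = 0 then 1 else 0))" .
    also have "\<dots> = (\<Sum>k<N. if k = n then c k else 0)" by (intro sum.cong) auto
    also have "\<dots> = c n" using that by simp
    finally show ?thesis .
  qed
  hence "I \<longlonglongrightarrow> c n" by (intro tendsto_eventually eventually_sequentiallyI[of "Suc n"]) auto
  with lim have "J = c n" by (rule LIMSEQ_unique)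
  thus ?thesis using J by (simp add: Q_def R_def)
qed

section \<open>The asymptotic formula\<close>

text \<open>From \<open>n = 3\<close> on the root is at least \<open>sqrt 71 > 8\<close>, and
  \<open>pi > 3\<close>; for \<open>n \<le> 2\<close> it is at most 7, and
  \<open>7 * 16 / 5 < 24\<close>.\<close>

lemma mu_ge_4_iff: "mu n \<ge> 4 \<longleftrightarrow> n \<ge> 3"
proof
  assume n: "n \<ge> 3"
  have "8 \<le> sqrt (24 * real n - 1)" using n by (intro real_le_rsqrt) (auto simp: power2_eq_square)
  hence "3 * 8 \<le> pi * sqrt (24 * real n - 1)" using pi_bounds by (intro mult_mono) auto
  thus "mu n \<ge> 4" by (simp add: mu_def)
next
  assume mu: "mu n \<ge> 4"
  show "n \<ge> 3"
  proof (rule ccontr)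
    assume "\<not> n \<ge> 3"
    hence "sqrt (24 * real n - 1) \<le> sqrt 49" by (intro real_sqrt_le_mono) auto
    also have "sqrt 49 = sqrt (7\<^sup>2)" by (simp add: power2_eq_square)
    also have "\<dots> = 7" by (rule real_sqrt_pow2_iff[THEN iffD2, unfolded real_sqrt_power[symmetric]]) simp
    finally have "pi * sqrt (24 * real n - 1) \<le> pi * 7" by (intro mult_left_mono) auto
    with mu pi_bounds show False by (simp add: mu_def)
  qed
qed

text \<open>The shift by \<open>1 / 24\<close> comes from the prefactor between
  \<open>crank_product\<close> and \<open>crank_eta\<close>. The correction \<open>2 q\<close> only
  concerns the index 1, hence not \<open>n \<ge> 3\<close>.\<close>

lemma signed_coefficient_integral:
  assumes n: "n \<ge> 3" and y: "y > 0"
  shows "((\<lambda>x. crank_eta (Complex x y) * exp (- (2 * pi * \<i> * of_real (real n - 1 / 24) * Complex x y))) has_integral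
           of_real ((- 1) ^ n * (real (M0 n) - real (M1 n)))) {-1/2..1/2}"
proof -
  define c :: "nat \<Rightarrow> complex" where "c k = (- 1) ^ k * (of_real (real (M0 k) - real (M1 k)) - (if k = 1 then 2 else 0))" for k
  have sums: "(\<lambda>k. c k * q ^ k) sums crank_product (- q)" if q: "norm q < 1" for q
  proof -
    have "(\<lambda>k. of_real (real (M0 k) - real (M1 k)) * (- q) ^ k) sums (crank_product (- q) + 2 * (- q))"
      using crank_parity_generating_function[of "- q"] q by (simp add: crank_product_def)
    moreover have "(\<lambda>k. if k = 1 then 2 * (- q) else 0) sums (2 * (- q))" by (rule sums_single)
    ultimately have "(\<lambda>k. of_real (real (M0 k) - real (M1 k)) * (- q) ^ k - (if k = 1 then 2 * (- q) else 0)) sums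
       (crank_product (- q) + 2 * (- q) - 2 * (- q))" by (rule sums_diff)
    also have "(\<lambda>k. of_real (real (M0 k) - real (M1 k)) * (- q) ^ k - (if k = 1 then 2 * (- q) else 0)) = (\<lambda>k. c k * q ^ k)"
      by (auto simp: c_def fun_eq_iff power_minus[of q] algebra_simps)
    finally show ?thesis by simp
  qed
  have "((\<lambda>x. crank_product (- exp (2 * pi * \<i> * (of_real x + \<i> * y))) * exp (- (2 * pi * \<i> * of_nat n * (of_real x + \<i> * y)))) has_integral c n) {-1/2..1/2}"
    by (rule coefficient_integral[OF sums y])
  also have "c n = of_real ((- 1) ^ n * (real (M0 n) - real (M1 n)))" using n by (simp add: c_def)
  also have "(\<lambda>x. crank_product (- exp (2 * pi * \<i> * (of_real x + \<i> * y))) * exp (- (2 * pi * \<i> * of_nat n * (of_real x + \<i> * y)))) =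
     (\<lambda>x. crank_eta (Complex x y) * exp (- (2 * pi * \<i> * of_real (real n - 1 / 24) * Complex x y)))"
  proof
    fix x
    define t where "t = Complex x y"
    have t: "of_real x + \<i> * y = t" by (simp add: t_def complex_eq_iff)
    have "crank_product (- exp (2 * pi * \<i> * t)) * exp (- (2 * pi * \<i> * of_nat n * t)) =
       crank_eta t * (exp (2 * pi * \<i> * t / 24) * exp (- (2 * pi * \<i> * of_nat n * t)))"
      using y by (subst crank_product_eta) (simp_all add: t_def)
    also have "exp (2 * pi * \<i> * t / 24) * exp (- (2 * pi * \<i> * of_nat n * t)) = exp (- (2 * pi * \<i> * of_real (real n - 1 / 24) * t))"
      unfolding exp_add[symmetric] by (simp add: algebra_simps)
    finally show "crank_product (- exp (2 * pi * \<i> * (of_real x + \<i> * y))) * exp (- (2 * pi * \<i> * of_nat n * (of_real x + \<i> * y))) =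
      crank_eta (Complex x y) * exp (- (2 * pi * \<i> * of_real (real n - 1 / 24) * Complex x y))"
      unfolding t unfolding t_def .
  qed
  finally show ?thesis .
qed

text \<open>On this arc \<open>|t| \<le> 2 y\<close>, so \<open>s = - 1 / (4 t)\<close> has height
  at least \<open>1 / (16 y)\<close>. There \<open>crank_eta s\<close> is
  \<open>exp (pi / (48 z))\<close> up to a relative error of \<open>16 |Q|\<close>, and
  \<open>|Q| = exp (- 2 pi Im s)\<close> more than cancels the growth
  \<open>exp (pi Im s / 12)\<close>, so that no exponential is left in the error.\<close>

lemma crank_eta_major_arc:
  fixes x y :: real and z :: complex
  assumes y: "0 < y" and x: "x\<^sup>2 \<le> 3 * y\<^sup>2" and y': "y \<le> 1 / 8"
  defines "z \<equiv> complex_of_real y - \<i> * of_real x"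
  shows "norm (crank_eta (Complex x y) - exp (pi / (48 * z)) / csqrt (2 * z)) \<le> 16 / sqrt (2 * y)"
proof -
  define t where "t = Complex x y"
  define s where "s = - 1 / (4 * t)"
  define Q where "Q = exp (2 * pi * \<i> * s)"
  have t: "t \<noteq> 0" "Im t > 0" using y by (auto simp: t_def complex_eq_iff)
  have z0: "z \<noteq> 0" using y by (auto simp: z_def complex_eq_iff)
  have tz: "t = \<i> * z" by (simp add: t_def z_def complex_eq_iff)
  have nt: "(norm t)\<^sup>2 = x\<^sup>2 + y\<^sup>2" by (simp add: cmod_power2 t_def)
  have "Im s = (4 * y) / (4\<^sup>2 * (norm t)\<^sup>2)" unfolding s_def Im_minus_one_over
    by (simp add: norm_mult power_mult_distrib t_def)
  also have "\<dots> = y / (4 * (norm t)\<^sup>2)" by simp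
  finally have Ims: "Im s = y / (4 * (x\<^sup>2 + y\<^sup>2))" unfolding nt .
  have "Im s \<ge> y / (4 * (4 * y\<^sup>2))"
    unfolding Ims using x y by (intro divide_left_mono mult_pos_pos) (auto intro!: add_nonneg_pos)
  also have "y / (4 * (4 * y\<^sup>2)) = 1 / (16 * y)" using y by (simp add: power2_eq_square)
  finally have "Im s \<ge> 1 / (16 * y)" .
  moreover have "1 / (16 * y) \<ge> 1 / 2" using y y' by (simp add: field_simps)
  ultimately have s2: "Im s \<ge> 1 / 2" by linarith
  have nQ: "norm Q = exp (- (2 * pi * Im s))" by (simp add: Q_def)
  have "norm Q \<le> exp (- pi)" unfolding nQ using s2 by simp
  also have "exp (- pi) = inverse ((exp (pi / 2))\<^sup>2)" by (simp add: exp_minus flip: exp_double)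
  also have "\<dots> \<le> inverse (4\<^sup>2)" using exp_half_pi_ge by (intro le_imp_inverse_le power_mono) auto
  finally have Q: "norm Q \<le> 1 / 16" by simp
  \<comment> \<open>\<open>exp v - 1 \<le> v + v\<^sup>2 \<le> 2 v\<close> for
    \<open>v = 8 |Q| \<le> 1 / 2\<close>.\<close>
  have "norm (crank_product (- Q) - 1) \<le> exp (8 * norm Q) - 1"
    using crank_product_minus_1_bound[of "- Q"] Q by simp
  also have "exp (8 * norm Q) \<le> 1 + 8 * norm Q + (8 * norm Q)\<^sup>2" using Q by (intro exp_bound) auto
  also have "(8 * norm Q)\<^sup>2 \<le> 8 * norm Q * 1" unfolding power2_eq_square using Q by (intro mult_left_mono) auto
  finally have cp: "norm (crank_product (- Q) - 1) \<le> 16 * norm Q" by simp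
  have cs: "crank_eta s = csqrt (2 * z) * crank_eta t"
  proof -
    have eq: "- (2 * \<i> * t) = 2 * z" by (simp add: tz complex_eq_iff)
    show ?thesis using crank_eta_transformation[OF t(2)] unfolding s_def eq .
  qed
  have c0: "csqrt (2 * z) \<noteq> 0" using z0 by simp
  have e: "exp (pi / (48 * z)) = exp (- (2 * pi * \<i> * s / 24))"
  proof -
    have "- (2 * pi * \<i> * s / 24) = pi / (48 * z)" unfolding s_def tz using z0 by (simp add: field_simps)
    thus ?thesis by simp
  qed
  have "exp (- (2 * pi * \<i> * s / 24)) * crank_product (- Q) = crank_eta s"
    unfolding Q_def using s2 by (subst crank_product_eta) (simp_all add: exp_minus)
  hence "crank_eta t = exp (pi / (48 * z)) * crank_product (- Q) / csqrt (2 * z)"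
    using cs c0 unfolding e by (simp add: field_simps)
  hence "crank_eta t - exp (pi / (48 * z)) / csqrt (2 * z) = exp (pi / (48 * z)) * (crank_product (- Q) - 1) / csqrt (2 * z)"
    by (simp add: diff_divide_distrib right_diff_distrib)
  hence "norm (crank_eta t - exp (pi / (48 * z)) / csqrt (2 * z)) = exp (pi * Im s / 12) * norm (crank_product (- Q) - 1) / sqrt (norm (2 * z))"
    unfolding e by (simp add: norm_mult norm_divide norm_csqrt mult.commute)
  also have "\<dots> \<le> exp (pi * Im s / 12) * (16 * norm Q) / sqrt (2 * y)"
  proof (intro frac_le mult_left_mono cp real_sqrt_le_mono)
    have "y \<le> norm z" using abs_Re_le_cmod[of z] y by (simp add: z_def)
    thus "2 * y \<le> norm (2 * z)" by (simp add: norm_mult)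
  qed (use y in auto)
  also have "\<dots> = 16 / sqrt (2 * y) * exp (pi * Im s / 12 - 2 * pi * Im s)"
    unfolding nQ exp_diff by (simp add: exp_minus field_simps)
  also have "\<dots> \<le> 16 / sqrt (2 * y) * 1"
  proof (intro mult_left_mono)
    have "pi * Im s \<ge> 0" using s2 by (intro mult_nonneg_nonneg) auto
    thus "exp (pi * Im s / 12 - 2 * pi * Im s) \<le> 1" by simp
  qed (use y in auto)
  finally show ?thesis by (simp add: t_def)
qed

text \<open>Three errors: at most \<open>12 sqrt m exp (m / 4)\<close> from the two outer segments,
  \<open>8 exp (m / 8)\<close> from replacing \<open>crank_eta\<close> on the middle segment, and
  \<open>exp (m / 4)\<close> from truncating the Gaussian. As \<open>sqrt m \<ge> 2\<close>, their
  sum stays below the constant 63.\<close>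

theorem crank_parity_asymptotics:
  assumes n: "n \<ge> 3"
  shows "\<bar>(- 1) ^ n * (real (M0 n) - real (M1 n)) - pi / (sqrt 6 * mu n) * exp (mu n / 2)\<bar>
           \<le> 63 * sqrt (mu n) * exp (mu n / 4)"
proof -
  define m where "m = mu n"
  have m: "m \<ge> 4" using n mu_ge_4_iff by (simp add: m_def)
  \<comment> \<open>Minimises \<open>a y + pi / (192 y)\<close>, the exponent of the bound on the
    outer segments; both terms then equal \<open>m / 8\<close>, see \<open>ay\<close> and
    \<open>y192\<close>.\<close>
  define y where "y = pi / (24 * m)"
  define a where "a = 2 * pi * (n - 1 / 24)"
  have y: "y > 0" using m by (simp add: y_def)
  have y30: "y \<le> 1 / 30"
  proof -
    have "pi * 30 \<le> 24 * m" using pi_bounds m by linarith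
    thus ?thesis using m by (simp add: y_def field_simps)
  qed
  have a_pos: "a > 0" using n by (simp add: a_def)
  have m2: "m\<^sup>2 = pi * a / 3"
    using n by (simp add: m_def mu_def a_def power_mult_distrib power_divide) (simp add: power2_eq_square field_simps)
  have ay: "a * y = m / 8"
  proof -
    have "a = 3 * m\<^sup>2 / pi" unfolding m2 by simp
    thus ?thesis using m by (simp add: y_def power2_eq_square)
  qed
  \<comment> \<open>Identifies \<open>4 a y\<^sup>2 / z\<close> in the saddle point integrand with
    \<open>pi / (48 z)\<close> from the transformation formula.\<close>
  have ayy: "4 * a * y\<^sup>2 = pi / 48" using ay m by (simp add: power2_eq_square y_def field_simps)
  have y192: "pi / (192 * y) = m / 8" using m by (simp add: y_def)
  define \<delta> where "\<delta> = sqrt 3 * y"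
  have s3: "sqrt 3 \<le> 7 / 4" by (rule real_le_lsqrt) (auto simp: power2_eq_square)
  have \<delta>: "\<delta> > 0" "\<delta>\<^sup>2 = 3 * y\<^sup>2" "\<delta> \<le> 7 / 4 * y" "\<delta> < 1 / 2"
  proof -
    show "\<delta> > 0" "\<delta>\<^sup>2 = 3 * y\<^sup>2" using y by (auto simp: \<delta>_def power_mult_distrib)
    show "\<delta> \<le> 7 / 4 * y" unfolding \<delta>_def using s3 y by (intro mult_right_mono) auto
    thus "\<delta> < 1 / 2" using y30 by linarith
  qed
  define J where "J x = crank_eta (Complex x y) * exp (- (2 * pi * \<i> * of_real (real n - 1 / 24) * Complex x y))" for x
  have nJ: "norm (J x) = norm (crank_eta (Complex x y)) * exp (m / 8)" for x
  proof -
    have "norm (exp (- (2 * pi * \<i> * of_real (real n - 1 / 24) * Complex x y))) = exp (a * y)" by (simp add: a_def)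
    thus ?thesis by (simp add: J_def norm_mult ay)
  qed
  have total: "(J has_integral of_real ((- 1) ^ n * (real (M0 n) - real (M1 n)))) {-1/2..1/2}"
    unfolding J_def[abs_def] by (rule signed_coefficient_integral[OF n y])
  have sub: "J integrable_on {l..u}" if "- 1/2 \<le> l" "u \<le> 1/2" for l u
    by (rule integrable_on_subinterval[of J "{-1/2..1/2}"]) (use total that in auto)
  obtain I1 where I1: "(J has_integral I1) {-1/2..-\<delta>}" using sub[of "-1/2" "-\<delta>"] \<delta> by (auto simp: integrable_on_def)
  obtain I2 where I2: "(J has_integral I2) {-\<delta>..\<delta>}" using sub[of "-\<delta>" "\<delta>"] \<delta> by (auto simp: integrable_on_def)
  obtain I3 where I3: "(J has_integral I3) {\<delta>..1/2}" using sub[of "\<delta>" "1/2"] \<delta> by (auto simp: integrable_on_def)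
  have "(J has_integral I1 + I2) {-1/2..\<delta>}"
    by (rule has_integral_combine[OF _ _ I1 I2]) (use \<delta> in auto)
  hence "(J has_integral I1 + I2 + I3) {-1/2..1/2}"
    by (rule has_integral_combine[rotated 2, OF _ I3]) (use \<delta> in auto)
  hence split: "of_real ((- 1) ^ n * (real (M0 n) - real (M1 n))) = I1 + I2 + I3"
    by (rule has_integral_unique[OF total])
  define B where "B = 4 / sqrt y * exp (m / 4)"
  have B0: "B \<ge> 0" using y by (simp add: B_def)
  have minor: "norm (J x) \<le> B" if "\<bar>x\<bar> \<le> 1 / 2" "\<delta> \<le> \<bar>x\<bar>" for x
  proof -
    have "\<delta>\<^sup>2 \<le> \<bar>x\<bar>\<^sup>2" using that \<delta> by (intro power_mono) auto
    hence "norm (crank_eta (Complex x y)) \<le> 4 / sqrt y * exp (pi / (192 * y))"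
      using y y30 that \<delta> by (intro norm_crank_eta_minor_arc) auto
    hence "norm (J x) \<le> 4 / sqrt y * exp (m / 8) * exp (m / 8)"
      unfolding nJ y192 by (intro mult_right_mono) auto
    also have "\<dots> = B" unfolding B_def by (simp add: exp_add[symmetric])
    finally show ?thesis .
  qed
  have "norm I1 \<le> B * (- \<delta> - (- 1/2))"
    using has_integral_bound_real[OF B0 finite.emptyI I1] minor \<delta> by (auto simp: content_real)
  also have "\<dots> \<le> B * (1/2)" using B0 \<delta> by (intro mult_left_mono) auto
  finally have b1: "norm I1 \<le> B / 2" by simp
  have "norm I3 \<le> B * (1/2 - \<delta>)"
    using has_integral_bound_real[OF B0 finite.emptyI I3] minor \<delta> by (auto simp: content_real)
  also have "\<dots> \<le> B * (1/2)" using B0 \<delta> by (intro mult_left_mono) auto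
  finally have b3: "norm I3 \<le> B / 2" by simp
  define h where "h x = exp (a * (y - \<i> * x) + 4 * a * y\<^sup>2 / (y - \<i> * x)) / csqrt (2 * (y - \<i> * x))" for x :: real
  obtain I where I: "(h has_integral I) {- \<delta>..\<delta>}"
    "norm (I - of_real (sqrt pi / sqrt (2 * a) * exp (4 * a * y))) \<le> 2 * sqrt pi / sqrt (2 * a) * exp (2 * a * y)"
    using saddle_point_integral[OF a_pos y] unfolding h_def \<delta>_def by blast
  define C where "C = 16 / sqrt (2 * y) * exp (m / 8)"
  have C0: "C \<ge> 0" using y by (simp add: C_def)
  have major: "norm (J x - h x) \<le> C" if "x \<in> {- \<delta>..\<delta>}" for x
  proof -
    define z where "z = complex_of_real y - \<i> * of_real x"
    have "\<bar>x\<bar>\<^sup>2 \<le> \<delta>\<^sup>2" using that by (intro power_mono) auto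
    hence bd: "norm (crank_eta (Complex x y) - exp (pi / (48 * z)) / csqrt (2 * z)) \<le> 16 / sqrt (2 * y)"
      unfolding z_def using y y30 \<delta> by (intro crank_eta_major_arc) auto
    have e1: "- (2 * pi * \<i> * of_real (real n - 1 / 24) * Complex x y) = a * z"
      by (simp add: z_def a_def complex_eq_iff)
    have e2: "4 * complex_of_real a * (of_real y)\<^sup>2 / z = pi / (48 * z)"
    proof -
      have eq: "4 * complex_of_real a * (of_real y)\<^sup>2 = of_real (pi / 48)" unfolding ayy[symmetric] by simp
      show ?thesis unfolding eq by simp
    qed
    have "h x = exp (a * z) * (exp (pi / (48 * z)) / csqrt (2 * z))"
      unfolding h_def z_def[symmetric] using e2 by (simp add: exp_add)
    moreover have "J x = exp (a * z) * crank_eta (Complex x y)"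
      unfolding J_def e1 by (simp add: mult.commute)
    ultimately have "J x - h x = exp (a * z) * (crank_eta (Complex x y) - exp (pi / (48 * z)) / csqrt (2 * z))"
      by (simp only: right_diff_distrib)
    hence "norm (J x - h x) = exp (a * y) * norm (crank_eta (Complex x y) - exp (pi / (48 * z)) / csqrt (2 * z))"
      by (simp add: norm_mult z_def)
    also have "\<dots> \<le> exp (m / 8) * (16 / sqrt (2 * y))" unfolding ay using bd by (intro mult_left_mono) auto
    finally show ?thesis by (simp add: C_def mult.commute)
  qed
  have "((\<lambda>x. J x - h x) has_integral (I2 - I)) {- \<delta>..\<delta>}" by (intro has_integral_diff I2 I(1))
  from has_integral_bound_real[OF C0 finite.emptyI this] major \<delta>
  have "norm (I2 - I) \<le> C * (2 * \<delta>)" by (auto simp: content_real)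
  also have "\<dots> \<le> C * (2 * (7 / 4 * y))" using C0 \<delta> by (intro mult_left_mono) auto
  also have "\<dots> = 56 / sqrt 2 * sqrt y * exp (m / 8)"
  proof -
    have "y / sqrt y = sqrt y" using y by (simp add: real_div_sqrt)
    moreover have "C * (2 * (7 / 4 * y)) = 56 / sqrt 2 * (y / sqrt y) * exp (m / 8)"
      by (simp add: C_def real_sqrt_mult mult_ac)
    ultimately show ?thesis by simp
  qed
  also have "\<dots> \<le> 40 * (1 / 5) * exp (m / 8)"
  proof (intro mult_right_mono mult_mono)
    have "7 / 5 \<le> sqrt 2" by (rule real_le_rsqrt) (auto simp: power2_eq_square)
    hence "56 / sqrt 2 \<le> 56 / (7 / 5)" by (intro divide_left_mono) auto
    thus "56 / sqrt 2 \<le> 40" by simp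
    show "sqrt y \<le> 1 / 5" using y y30 by (intro real_le_lsqrt) (auto simp: power2_eq_square)
  qed (use y in auto)
  finally have b2: "norm (I2 - I) \<le> 8 * exp (m / 8)" by simp
  \<comment> \<open>\<open>6 m\<^sup>2 = 2 pi a\<close> turns the Gaussian constant into the
    coefficient of the main term.\<close>
  have main: "sqrt pi / sqrt (2 * a) = pi / (sqrt 6 * m)"
  proof -
    have "sqrt 6 * m = sqrt (6 * m\<^sup>2)" using m by (simp add: real_sqrt_mult)
    also have "6 * m\<^sup>2 = pi * (2 * a)" unfolding m2 by simp
    also have "sqrt (pi * (2 * a)) = sqrt pi * sqrt (2 * a)" by (rule real_sqrt_mult)
    finally have "pi / (sqrt 6 * m) = (sqrt pi * sqrt pi) / (sqrt pi * sqrt (2 * a))" by simp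
    thus ?thesis by (simp add: real_sqrt_mult del: real_sqrt_mult_self)
  qed
  have main1: "pi / (sqrt 6 * m) \<le> 1 / 2"
  proof -
    have "2 \<le> sqrt 6" by (rule real_le_rsqrt) simp
    hence "2 * 4 \<le> sqrt 6 * m" using m by (intro mult_mono) auto
    hence "2 * pi \<le> sqrt 6 * m" using pi_bounds by linarith
    moreover have "sqrt 6 * m > 0" using m by simp
    ultimately show ?thesis by (simp add: field_simps)
  qed
  have ex: "exp (4 * a * y) = exp (m / 2)" "exp (2 * a * y) = exp (m / 4)" using ay by (simp_all add: mult.assoc)
  have "norm (I - of_real (pi / (sqrt 6 * m) * exp (m / 2))) \<le> 2 * (pi / (sqrt 6 * m)) * exp (m / 4)"
    using I(2) unfolding ex main[symmetric] by simp
  also have "\<dots> \<le> 2 * (1 / 2) * exp (m / 4)" using main1 by (intro mult_right_mono mult_left_mono) auto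
  finally have b4: "norm (I - of_real (pi / (sqrt 6 * m) * exp (m / 2))) \<le> exp (m / 4)" by simp
  have sm: "sqrt m \<ge> 2" using m by (intro real_le_rsqrt) auto
  \<comment> \<open>\<open>24 / pi\<close> is rounded up to the square 9, so
    \<open>1 / sqrt y \<le> 3 sqrt m\<close> and \<open>12 = 4 * 3\<close>.\<close>
  have BB: "B \<le> 12 * sqrt m * exp (m / 4)"
  proof -
    have "1 / sqrt y = sqrt (24 * m / pi)" using m by (simp add: y_def real_sqrt_divide)
    also have "\<dots> \<le> sqrt (9 * m)"
    proof (rule real_sqrt_le_mono)
      have "24 * m / pi \<le> 24 * m / 3" using pi_bounds m by (intro divide_left_mono) auto
      thus "24 * m / pi \<le> 9 * m" using m by linarith
    qed
    also have "sqrt (9 * m) = 3 * sqrt m" by (simp add: real_sqrt_mult)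
    finally have "4 * (1 / sqrt y) * exp (m / 4) \<le> 4 * (3 * sqrt m) * exp (m / 4)"
      by (intro mult_right_mono mult_left_mono) auto
    thus ?thesis by (simp add: B_def)
  qed
  have "\<bar>(- 1) ^ n * (real (M0 n) - real (M1 n)) - pi / (sqrt 6 * m) * exp (m / 2)\<bar> =
     norm (of_real ((- 1) ^ n * (real (M0 n) - real (M1 n))) - complex_of_real (pi / (sqrt 6 * m) * exp (m / 2)))"
    by (simp only: of_real_diff[symmetric] norm_of_real)
  also have "\<dots> = norm (I1 + I3 + (I2 - I) + (I - of_real (pi / (sqrt 6 * m) * exp (m / 2))))"
    unfolding split by (simp add: algebra_simps)
  also have "\<dots> \<le> norm I1 + norm I3 + norm (I2 - I) + norm (I - of_real (pi / (sqrt 6 * m) * exp (m / 2)))"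
    by (intro order.trans[OF norm_triangle_ineq] add_mono order.refl)
  also have "\<dots> \<le> B + 8 * exp (m / 8) + exp (m / 4)" using b1 b2 b3 b4 by linarith
  also have "\<dots> \<le> 12 * sqrt m * exp (m / 4) + 8 * exp (m / 4) + exp (m / 4)"
  proof -
    have "exp (m / 8) \<le> exp (m / 4)" using m by simp
    with BB show ?thesis by linarith
  qed
  also have "\<dots> = (12 * sqrt m + 9) * exp (m / 4)" by (simp add: algebra_simps)
  also have "\<dots> \<le> (63 * sqrt m) * exp (m / 4)" using sm by - (rule mult_right_mono, linarith, simp)
  finally show ?thesis by (simp add: m_def)
qed

theorem theorem2p1:
  shows "(\<forall>n. mu n \<ge> 4 \<longleftrightarrow> n \<ge> 3) \<and>
    (\<exists>E :: nat \<Rightarrow> real. \<forall>n. mu n \<ge> 4 \<longrightarrow>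
      real (M0 n) - real (M1 n) = (-1) ^ n * pi / (sqrt 6 * mu n) * exp (mu n / 2) + E n \<and>
      \<bar>E n\<bar> \<le> 63 * sqrt (mu n) * exp (mu n / 4))"
proof (rule conjI)
  show "\<forall>n. mu n \<ge> 4 \<longleftrightarrow> n \<ge> 3" using mu_ge_4_iff by blast
  \<comment> \<open>The exact difference; a factor \<open>(- 1) ^ n\<close> does not change its
    absolute value and moves the sign to the side of the coefficient.\<close>
  let ?E = "\<lambda>n. real (M0 n) - real (M1 n) - (-1) ^ n * pi / (sqrt 6 * mu n) * exp (mu n / 2)"
  have "\<bar>?E n\<bar> \<le> 63 * sqrt (mu n) * exp (mu n / 4)" if "mu n \<ge> 4" for n
  proof -
    let ?b = "real (M0 n) - real (M1 n)" and ?M = "pi / (sqrt 6 * mu n) * exp (mu n / 2)"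
    have "\<bar>?E n\<bar> = \<bar>(-1) ^ n * (?b - (-1) ^ n * ?M)\<bar>" by (simp add: abs_mult)
    also have "(-1) ^ n * (?b - (-1) ^ n * ?M) = (-1) ^ n * ?b - ((-1) ^ n * (-1) ^ n) * ?M"
      by (simp only: right_diff_distrib mult.assoc)
    also have "(-1 :: real) ^ n * (-1) ^ n = 1" by (simp flip: power_mult_distrib)
    finally show ?thesis using crank_parity_asymptotics[of n] that mu_ge_4_iff by simp
  qed
  thus "\<exists>E :: nat \<Rightarrow> real. \<forall>n. mu n \<ge> 4 \<longrightarrow>
      real (M0 n) - real (M1 n) = (-1) ^ n * pi / (sqrt 6 * mu n) * exp (mu n / 2) + E n \<and>
      \<bar>E n\<bar> \<le> 63 * sqrt (mu n) * exp (mu n / 4)"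
    by (intro exI[of _ ?E]) simp
qed

end
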